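(* Let $N\ge3$, $r\ge1$, let $\mathbf f\in C^{r+1}(U\times V,\mathbb R^N)$ with $U\subset\mathbb R^N$, $V\subset\mathbb R$ open and connected, and suppose that for every $\mu\in V$ the system $\dot{\mathbf x}=\mathbf f(\mathbf x;\mu)$ has a fixed point $\mathbf x_0(\mu)\in U$ depending $C^r$-smoothly on $\mu$. After shifting the fixed point to the origin, write the system as $\dot{\mathbf x}=\mathbf A(\mu)\mathbf x+\mathbf f_0(\mathbf x;\mu)$ with $\mathbf A(\mu)=D_{\mathbf x}\mathbf f(\mathbf x_0(\mu),\mu)$ and $\mathbf f_0(\mathbf x;\mu)=O(\|\mathbf x\|^2)$. Let $\lambda_1(\mu),\dots,\lambda_N(\mu)$ be the eigenvalues of $\mathbf A(\mu)$ and $\mu_0\in V$. Assume: (A4) $\lambda_{1,2}(\mu)=\alpha(\mu)\pm i\omega(\mu)$ with $\omega(\mu)\ne0$, $\alpha(\mu_0)=0$, $\alpha(\mu)<0$ for $\mu<\mu_0$, $\alpha(\mu)>0$ for $\mu>\mu_0$; and $\operatorname{Re}\lambda_N(\mu)\le\dots\le\operatorname{Re}\lambda_3(\mu)<0$. (A5) $\lambda_3(\mu)=\nu(\mu)$ is real and negative with $\nu(\mu)<\operatorname{Re}\lambda_{1,2}(\mu)$ for all $\mu\le\mu_0$. (A6) $\lambda_1(\mu),\lambda_2(\mu),\lambda_3(\mu)$ are simple and disjoint from the rest of the spectrum of $\mathbf A(\mu)$. Let $m\ge1$ be an integer and let $\tilde V_{2m}=(\mu_{2m},\mu_0+M)$,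 $M>0$, be the parameter interval described in the context. Then the coefficients $\mathbf R^{\mathbf k}(\mu)$ in the expansion $$\dot{\mathbf u}=\mathbf R(\mathbf u,\mu)=\sum_{1\le|\mathbf k|\le2m+2}\mathbf R^{\mathbf k}(\mu)\mathbf u^{\mathbf k}+o(\|\mathbf u\|^{2m+2})$$ of the reduced dynamics on the spectral submanifold $W(E;\mu)$ are uniquely computable for all multi-indices $|\mathbf k|\le2m+2$ and all $\mu\in\tilde V_{2m}$. Moreover, the coefficients $\mathbf R^{\mathbf k}(\mu)$ vary $C^r$ smoothly in $\mu$ on $\tilde V_{2m}$.
   Context: Eigenvalues are listed with multiplicity. $E(\mu)$ is the two-dimensional real spectral subspace of $\mathbf A(\mu)$ associated with $\lambda_{1,2}(\mu)$; $P_E(\mu)$ is the spectral projection onto $E(\mu)$; $\mathbf S_{\mathbf u}(\mu)\in\mathbb R^{N\times2}$ is a basis of $E(\mu)$ depending $C^r$-smoothly on $\mu$; the reduced coordinate $\mathbf u\in\mathbb R^2$ is defined by $\mathbf S_{\mathbf u}(\mu)\mathbf u=P_E(\mu)\mathbf x$. For a multi-index $\mathbf k=(k_1,k_2)$, $|\mathbf k|=k_1+k_2$ and $\mathbf u^{\mathbf k}=u_1^{k_1}u_2^{k_2}$. The spectral submanifold $W(E;\mu)$ is an invariant manifold through the fixed point, tangent there to $E(\mu)$, written as a graph over $E(\mu)$: $\mathbf x=\mathbf W(\mathbf u;\mu)=\mathbf S_{\mathbf u}(\mu)\mathbf u+\sum_{2\le|\mathbf k|\le2m+1}\mathbf W^{\mathbf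 k}(\mu)\mathbf u^{\mathbf k}+o(\|\mathbf u\|^{2m+1})$ with $P_E(\mu)\mathbf W(\mathbf u;\mu)=\mathbf S_{\mathbf u}(\mu)\mathbf u$. The reduced dynamics is the full dynamics restricted to $W(E;\mu)$ expressed in $\mathbf u$, i.e. $\mathbf S_{\mathbf u}(\mu)\mathbf R(\mathbf u,\mu)=P_E(\mu)\big[\mathbf A(\mu)\mathbf W(\mathbf u;\mu)+\mathbf f_0(\mathbf W(\mathbf u;\mu);\mu)\big]$, where $\mathbf W$ satisfies the invariance equation $D_{\mathbf u}\mathbf W\,\mathbf R=\mathbf A\mathbf W+\mathbf f_0(\mathbf W;\mu)$. "Uniquely computable" means that the coefficients $\mathbf R^{\mathbf k}(\mu)$ with $|\mathbf k|\le 2m+2$ are uniquely determined by these relations, i.e. are the same for every such invariant manifold. A resonance is a relation $\lambda_l(\mu)=m_1\lambda_1(\mu)+m_2\lambda_2(\mu)$ with $l\ge3$, $m_1,m_2\in\mathbb N_0$, $m_1+m_2\ge2$; its order is $m_1+m_2$. The interval $\tilde V_{2m}=(\mu_{2m},\mu_0+M)\subset V$ contains $\mu_0$; here $\mu_{2m}<\mu_0$ is a parameter with $\nu(\mu_{2m})=2m\,\alpha(\mu_{2m})$, $M>0$ is such that the ordering $\operatorname{Re}\lambda_N(\mu)\le\dots\le\operatorname{Re}\lambda_3(\mu)<0$ continues to hold, and on $\tilde V_{2m}$ there are only resonances of order higher than $2m$; the lowest order of a resonance that can be encountered on $\tilde V_{2m}$ is $2m+2$.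
   Formalization: The C^r dependence of R^k(μ) is proved under the added assumption that f_0(·;μ) has an expansion of order 2m+2 at 0 with coefficients C^r in μ, since f in C^{r+1} alone does not suffice; unique computability is proved as stated. *)

theory Defs
  imports "HOL-Analysis.Analysis" "HOL-Library.Landau_Symbols"
begin

(* f is of class C^n on the open set X: all iterated directional derivatives up to order n
   exist as Frechet derivatives and those of order n are continuous. *)
fun C_k_on :: "nat \<Rightarrow> ('a::euclidean_space \<Rightarrow> 'b::real_normed_vector) \<Rightarrow> 'a set \<Rightarrow> bool" where
  "C_k_on 0 f X \<longleftrightarrow> continuous_on X f"
| "C_k_on (Suc n) f X \<longleftrightarrow>
     (\<forall>x\<in>X. f differentiable (at x)) \<and>
     (\<forall>v. C_k_on n (\<lambda>x. frechet_derivative f (at x) v) X)"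

(* A multi-index for vectors in real^'a is a function k :: 'a => nat; for real^2 the pair
   (k_1, k_2) is (k 1, k 2). *)
definition mdeg :: "('a::finite \<Rightarrow> nat) \<Rightarrow> nat" where
  "mdeg k = (\<Sum>i\<in>UNIV. k i)"

definition mpow :: "real ^ 'a \<Rightarrow> ('a::finite \<Rightarrow> nat) \<Rightarrow> real" where
  "mpow x k = (\<Prod>i\<in>UNIV. (x $ i) ^ k i)"

(* g(x) = (sum over multi-indices k with p <= |k| <= q of c_k x^k) + o(|x|^q) as x -> 0 *)
definition has_expansion ::
    "(real ^ 'a::finite \<Rightarrow> 'b::real_normed_vector) \<Rightarrow> (('a \<Rightarrow> nat) \<Rightarrow> 'b) \<Rightarrow> nat \<Rightarrow> nat \<Rightarrow> bool" where
  "has_expansion g c p q \<longleftrightarrow>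
     (\<lambda>x. norm (g x - (\<Sum>k | p \<le> mdeg k \<and> mdeg k \<le> q. mpow x k *\<^sub>R c k)))
       \<in> o[at 0](\<lambda>x. norm x ^ q)"

(* ev 1, ..., ev N are the eigenvalues of A, listed with algebraic multiplicity. *)
definition eigenvalue_list :: "real ^ 'n ^ 'n::finite \<Rightarrow> (nat \<Rightarrow> complex) \<Rightarrow> bool" where
  "eigenvalue_list A ev \<longleftrightarrow>
     (\<forall>z. det (mat z - map_matrix complex_of_real A) = (\<Prod>i = 1..CARD('n). (z - ev i)))"

definition generalized_eigenspace :: "real ^ 'n ^ 'n::finite \<Rightarrow> complex \<Rightarrow> (complex ^ 'n) set" where
  "generalized_eigenspace A z =
     {v. \<exists>p. (((*v) (map_matrix complex_of_real A - mat z)) ^^ p) v = 0}"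

(* The real vectors in the complex span of the generalized eigenspaces belonging to \<Lambda>;
   intended for \<Lambda> closed under conjugation. *)
definition spectral_subspace :: "real ^ 'n ^ 'n::finite \<Rightarrow> complex set \<Rightarrow> (real ^ 'n) set" where
  "spectral_subspace A \<Lambda> =
     {x. (\<chi> i. complex_of_real (x $ i)) \<in> vec.span (\<Union>z\<in>\<Lambda>. generalized_eigenspace A z)}"

(* P is the projection onto the spectral subspace of \<Lambda> along that of the rest of the spectrum. *)
definition is_spectral_projection ::
    "real ^ 'n ^ 'n::finite \<Rightarrow> complex set \<Rightarrow> real ^ 'n ^ 'n \<Rightarrow> bool" where
  "is_spectral_projection A \<Lambda> P \<longleftrightarrow>
     (\<forall>x \<in> spectral_subspace A \<Lambda>. P *v x = x) \<and>
     (\<forall>x \<in> spectral_subspace A (- \<Lambda>). P *v x = 0)"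

definition resonance :: "nat \<Rightarrow> (nat \<Rightarrow> complex) \<Rightarrow> nat \<Rightarrow> bool" where
  "resonance N ev q \<longleftrightarrow>
     (\<exists>l m1 m2. 3 \<le> l \<and> l \<le> N \<and> 2 \<le> m1 + m2 \<and> q = m1 + m2 \<and>
        ev l = of_nat m1 * ev 1 + of_nat m2 * ev 2)"

(* For the system x' = A x + g x on X, at one fixed parameter value: W parametrizes, near 0, a C^1
   invariant manifold that is a graph over the range E of S (P being the projection onto E), with an
   expansion up to order q, and R is its reduced vector field. Tangency to E at 0 is contained
   in the expansion, whose linear part is S. *)
definition spectral_submanifold ::
    "real ^ 'n ^ 'n::finite \<Rightarrow> (real ^ 'n \<Rightarrow> real ^ 'n) \<Rightarrow> (real ^ 'n) set \<Rightarrow>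
     real ^ 'n ^ 'n \<Rightarrow> real ^ 2 ^ 'n \<Rightarrow> nat \<Rightarrow>
     (real ^ 2 \<Rightarrow> real ^ 'n) \<Rightarrow> (real ^ 2 \<Rightarrow> real ^ 2) \<Rightarrow> bool" where
  "spectral_submanifold A g X P S q W R \<longleftrightarrow>
     W 0 = 0 \<and>
     (\<exists>c. has_expansion (\<lambda>u. W u - S *v u) c 2 q) \<and>
     (\<exists>D. open D \<and> 0 \<in> D \<and> C_k_on 1 W D \<and>
       (\<forall>u\<in>D. W u \<in> X \<and>
          P *v W u = S *v u \<and>
          S *v R u = P *v (A *v W u + g (W u)) \<and>
          frechet_derivative W (at u) (R u) = A *v W u + g (W u)))"

end

theory Submission
  imports Defs "HOL-Computational_Algebra.Fundamental_Theorem_Algebra"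
begin

text \<open>A homogeneous discrepancy of degree \<open>k\<close> between two invariant graphs, or between an invariant graph and
  its formal expansion, solves the homological equation \<open>DH(u) L u = A H(u) + B(u)\<close> with values in the kernel of
  the spectral projection. In a complex coordinate \<open>\<zeta>\<close> of the plane with \<open>\<zeta>(L u) = l \<zeta>(u)\<close> this equation
  decouples into the linear systems \<open>(a l + b cnj l - A) h = \<dots>\<close>, which absence of resonances makes invertible,
  and Cramer's rule gives a solution that is \<open>C\<^sup>r\<close> in the parameter. Since the nonlinearity is quadratic, knowing
  \<open>W\<close> up to order \<open>k\<close> gives \<open>R\<close> up to order \<open>k + 1\<close>. The manifold is only \<open>C\<^sup>1\<close>, so its
  expansion cannot be differentiated termwise; the homological equation is obtained from the differential equation
  by a maximum principle as in the stability of viscosity solutions. Smoothness of the spectral projection is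
  algebraic: \<open>P B = S S\<^sup>T\<close> for the invertible matrix \<open>B = (A - l)(A - cnj l) + S S\<^sup>T\<close>.\<close>

section \<open>Functions of class \<open>C\<^sup>k\<close>\<close>

text \<open>Two claims are kept apart. Independence of the coefficients from the manifold rests on
  the estimate \<open>norm (g x - g y) \<le> C * (norm x + norm y) * norm (x - y)\<close>, which
  second-order differentiability gives; their smoothness in the parameter rests on a Taylor
  expansion of the nonlinearity with smooth coefficients. Existence of a manifold is asserted
  nowhere, and nothing relates the manifolds at different parameters. Smooth coefficients are
  therefore found formally on the whole interval, and every manifold that exists is then shown to
  have them.

  The eigenvalue \<open>l\<close> is taken with imaginary part
  \<open>\<bar>\<omega> \<mu>\<bar>\<close>: the sign of \<omega> may jump with the parameter, while
  \<alpha> and the absolute value are recovered from trace and determinant of the restriction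
  \<open>L\<close> of \<open>A\<close> to the plane. At \<alpha> = 0 the sums
  \<open>a l + b cnj l\<close> can meet \<open>l\<close> itself, as in
  \<open>2 l + cnj l = l\<close>. This is harmless because the graph condition confines the unknown
  coefficients to the kernel of \<open>P\<close>.\<close>

lemma C_k_on_cong_imp:
  assumes "open X" "\<And>x. x \<in> X \<Longrightarrow> f x = g x" "C_k_on n f X"
  shows "C_k_on n g X"
  using assms(2,3)
proof (induction n arbitrary: f g)
  case 0
  then show ?case by (simp cong: continuous_on_cong)
next
  case (Suc n)
  have *: "(g has_derivative frechet_derivative f (at x)) (at x)" if "x \<in> X" for x
    using Suc.prems that frechet_derivative_works[of f "at x"]
    by (auto intro: has_derivative_transform_within_open[OF _ assms(1)])
  have "C_k_on n (\<lambda>x. frechet_derivative g (at x) v) X" for v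
  proof (rule Suc.IH)
    show "C_k_on n (\<lambda>x. frechet_derivative f (at x) v) X" using Suc.prems(2) by simp
    show "frechet_derivative f (at x) v = frechet_derivative g (at x) v" if "x \<in> X" for x
      using frechet_derivative_at[OF *[OF that]] by simp
  qed
  moreover have "g differentiable (at x)" if "x \<in> X" for x
    using *[OF that] unfolding differentiable_def by blast
  ultimately show ?case by simp
qed

text \<open>Any candidate derivative may be supplied in place of the chosen
  \<open>frechet_derivative\<close>, since derivatives at a point are unique. Most calculus rules
  below are inductions on \<open>n\<close> that end in this lemma.\<close>

lemma C_k_on_SucI:
  assumes "open X" "\<And>x. x \<in> X \<Longrightarrow> (f has_derivative f' x) (at x)" "\<And>v. C_k_on n (\<lambda>x. f' x v) X"
  shows "C_k_on (Suc n) f X"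
proof -
  have "C_k_on n (\<lambda>x. frechet_derivative f (at x) v) X" for v
    by (rule C_k_on_cong_imp[OF assms(1) _ assms(3)[of v]]) (simp add: frechet_derivative_at[OF assms(2), symmetric])
  with assms(2) show ?thesis by (auto simp: differentiable_def)
qed

lemma C_k_on_SucD:
  assumes "C_k_on (Suc n) f X" "x \<in> X"
  shows "(f has_derivative frechet_derivative f (at x)) (at x)"
  using assms by (simp add: frechet_derivative_works)

lemma C_k_on_frechet_derivative:
  "C_k_on (Suc n) f X \<Longrightarrow> C_k_on n (\<lambda>x. frechet_derivative f (at x) v) X"
  by simp

lemma C_k_on_Suc_imp: "C_k_on (Suc n) f X \<Longrightarrow> C_k_on n f X"
proof (induction n arbitrary: f)
  case 0
  then show ?case by (auto intro!: continuous_at_imp_continuous_on differentiable_imp_continuous_within)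
qed auto

lemma C_k_on_mono: "C_k_on n f X \<Longrightarrow> k \<le> n \<Longrightarrow> C_k_on k f X"
  by (induction n) (metis le_zero_eq, metis C_k_on_Suc_imp le_Suc_eq)

lemma C_k_on_subset: "C_k_on n f X \<Longrightarrow> Y \<subseteq> X \<Longrightarrow> C_k_on n f Y"
  by (induction n arbitrary: f) (auto intro: continuous_on_subset)

lemma C_k_on_const: "C_k_on n (\<lambda>x. c) X"
  by (induction n arbitrary: c) (auto simp: frechet_derivative_const)

lemma C_k_on_add:
  assumes "open X" "C_k_on n f X" "C_k_on n g X"
  shows "C_k_on n (\<lambda>x. f x + g x) X"
  using assms(2,3)
proof (induction n arbitrary: f g)
  case 0
  then show ?case by (auto intro: continuous_on_add)
next
  case (Suc n)
  show ?case
    by (rule C_k_on_SucI[OF assms(1) has_derivative_add[OF C_k_on_SucD[OF Suc.prems(1)] C_k_on_SucD[OF Suc.prems(2)]]])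
      (use Suc in auto)
qed

text \<open>One product rule for multiplication, scaling and the complex scalar action on vectors.
  The derivative contains \<open>f\<close> and \<open>g\<close> undifferentiated, hence the descent
  by \<open>C_k_on_Suc_imp\<close>.\<close>

lemma C_k_on_bilinear:
  assumes "bounded_bilinear bil" "open X" "C_k_on n f X" "C_k_on n g X"
  shows "C_k_on n (\<lambda>x. bil (f x) (g x)) X"
  using assms(3,4)
proof (induction n arbitrary: f g)
  case 0
  then show ?case using bounded_bilinear.continuous_on[OF assms(1)] by auto
next
  case (Suc n)
  have "C_k_on n (\<lambda>x. bil (f x) (frechet_derivative g (at x) v) + bil (frechet_derivative f (at x) v) (g x)) X" for v
    by (intro C_k_on_add assms(2) Suc.IH C_k_on_Suc_imp[OF Suc.prems(1)] C_k_on_Suc_imp[OF Suc.prems(2)]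
        C_k_on_frechet_derivative Suc.prems)
  then show ?case
    by (intro C_k_on_SucI[OF assms(2) bounded_bilinear.FDERIV[OF assms(1) C_k_on_SucD[OF Suc.prems(1)] C_k_on_SucD[OF Suc.prems(2)]]])
qed

lemma C_k_on_linear:
  assumes "bounded_linear L" "open X" "C_k_on n f X"
  shows "C_k_on n (\<lambda>x. L (f x)) X"
  using assms(3)
proof (induction n arbitrary: f)
  case 0
  then show ?case using bounded_linear.continuous_on[OF assms(1)] by auto
next
  case (Suc n)
  show ?case
    by (rule C_k_on_SucI[OF assms(2) bounded_linear.has_derivative[OF assms(1) C_k_on_SucD[OF Suc.prems(1)]]])
      (use Suc in auto)
qed

lemma C_k_on_ident: "open X \<Longrightarrow> C_k_on n (\<lambda>x. x) X"
  by (cases n) (auto intro!: C_k_on_SucI[of _ _ "\<lambda>_ v. v"] C_k_on_const)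

lemma C_k_on_sum:
  assumes "open X" "\<And>i. i \<in> I \<Longrightarrow> C_k_on n (f i) X"
  shows "C_k_on n (\<lambda>x. \<Sum>i\<in>I. f i x) X"
  using assms(2) by (induction I rule: infinite_finite_induct) (auto intro: C_k_on_const C_k_on_add assms(1))

lemma C_k_on_minus: "open X \<Longrightarrow> C_k_on n f X \<Longrightarrow> C_k_on n (\<lambda>x. - f x) X"
  by (rule C_k_on_linear[OF bounded_linear_minus[OF bounded_linear_ident]])

lemma C_k_on_diff:
  "open X \<Longrightarrow> C_k_on n f X \<Longrightarrow> C_k_on n g X \<Longrightarrow> C_k_on n (\<lambda>x. f x - g x) X"
  using C_k_on_add[of X n f "\<lambda>x. - g x"] C_k_on_minus[of X n g] by simp

lemmas C_k_on_mult = C_k_on_bilinear[OF bounded_bilinear_mult]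
lemmas C_k_on_scaleR = C_k_on_bilinear[OF bounded_bilinear_scaleR]

lemma C_k_on_prod:
  fixes f :: "'i \<Rightarrow> 'a::euclidean_space \<Rightarrow> 'b::real_normed_field"
  assumes "open X" "\<And>i. i \<in> I \<Longrightarrow> C_k_on n (f i) X"
  shows "C_k_on n (\<lambda>x. \<Prod>i\<in>I. f i x) X"
  using assms(2) by (induction I rule: infinite_finite_induct) (auto intro: C_k_on_const C_k_on_mult assms(1))

lemma C_k_on_power:
  fixes f :: "'a::euclidean_space \<Rightarrow> 'b::real_normed_field"
  shows "open X \<Longrightarrow> C_k_on n f X \<Longrightarrow> C_k_on n (\<lambda>x. f x ^ k) X"
  by (induction k) (auto intro: C_k_on_const C_k_on_mult)

text \<open>The derivative of the inverse contains the inverse itself, so the induction bootstraps: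
  class \<open>n\<close> of the inverse gives class \<open>n\<close> of its derivative.\<close>

lemma C_k_on_inverse:
  fixes f :: "'a::euclidean_space \<Rightarrow> 'b::real_normed_field"
  assumes "open X" "C_k_on n f X" "\<And>x. x \<in> X \<Longrightarrow> f x \<noteq> 0"
  shows "C_k_on n (\<lambda>x. inverse (f x)) X"
  using assms(2)
proof (induction n)
  case 0
  then show ?case using assms(3) by (auto intro: continuous_on_inverse)
next
  case (Suc n)
  have IH: "C_k_on n (\<lambda>x. inverse (f x)) X" using Suc C_k_on_Suc_imp by blast
  have "C_k_on n (\<lambda>x. - (inverse (f x) * frechet_derivative f (at x) v * inverse (f x))) X" for v
    by (intro C_k_on_mult C_k_on_minus IH assms(1) C_k_on_frechet_derivative Suc.prems)
  then show ?case
    by (intro C_k_on_SucI[OF assms(1) Deriv.has_derivative_inverse[OF assms(3) C_k_on_SucD[OF Suc.prems]]])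
qed

lemma C_k_on_divide:
  fixes f :: "'a::euclidean_space \<Rightarrow> 'b::real_normed_field"
  assumes "open X" "C_k_on n f X" "C_k_on n g X" "\<And>x. x \<in> X \<Longrightarrow> g x \<noteq> 0"
  shows "C_k_on n (\<lambda>x. f x / g x) X"
  unfolding divide_inverse by (intro C_k_on_mult C_k_on_inverse assms)

lemma C_k_on_sqrt:
  assumes "open X" "C_k_on n f X" "\<And>x. x \<in> X \<Longrightarrow> f x > 0"
  shows "C_k_on n (\<lambda>x. sqrt (f x)) X"
  using assms(2)
proof (induction n)
  case 0
  then have "continuous_on X f" by simp
  then show ?case using continuous_on_real_sqrt[of X f] by (simp only: C_k_on.simps)
next
  case (Suc n)
  have IH: "C_k_on n (\<lambda>x. sqrt (f x)) X" using Suc C_k_on_Suc_imp by blast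
  have "((\<lambda>x. sqrt (f x)) has_derivative (\<lambda>v. frechet_derivative f (at x) v * (inverse (sqrt (f x)) / 2))) (at x)"
    if "x \<in> X" for x
    using has_derivative_real_sqrt[OF assms(3)[OF that] C_k_on_SucD[OF Suc.prems that]]
    by (simp add: mult.commute)
  moreover have "sqrt (f x) \<noteq> 0" if "x \<in> X" for x
    using assms(3)[OF that] by simp
  then have "C_k_on n (\<lambda>x. frechet_derivative f (at x) v * (inverse (sqrt (f x)) / 2)) X" for v
    by (intro C_k_on_mult C_k_on_divide C_k_on_inverse C_k_on_const IH assms(1) C_k_on_frechet_derivative Suc.prems)
      auto
  ultimately show ?case by (rule C_k_on_SucI[OF assms(1)])
qed

lemma C_k_on_compose:
  fixes g :: "'b::euclidean_space \<Rightarrow> 'c::real_normed_vector" and h :: "'a::euclidean_space \<Rightarrow> 'b"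
  assumes "open X" "h ` X \<subseteq> Y" "C_k_on n g Y" "C_k_on n h X"
  shows "C_k_on n (\<lambda>x. g (h x)) X"
  using assms(3,4)
proof (induction n arbitrary: g)
  case 0
  then have "continuous_on Y g" "continuous_on X h" by auto
  from continuous_on_compose2[OF this assms(2)] show ?case by simp
next
  case (Suc n)
  have Y: "h x \<in> Y" if "x \<in> X" for x using assms(2) that by auto
  have d: "((\<lambda>x. g (h x)) has_derivative (\<lambda>v. frechet_derivative g (at (h x)) (frechet_derivative h (at x) v))) (at x)"
    if "x \<in> X" for x
    using diff_chain_at[OF C_k_on_SucD[OF Suc.prems(2) that] C_k_on_SucD[OF Suc.prems(1) Y[OF that]]]
    by (simp add: o_def)
  \<comment> \<open>\<open>C_k_on\<close> speaks of fixed directions, whereas the chain rule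
    differentiates \<open>g\<close> in a direction that varies with \<open>x\<close>. Expanding this
    direction in \<open>Basis\<close> leaves fixed directions with scalar coefficients.\<close>
  have eq: "(\<Sum>b\<in>Basis. (frechet_derivative h (at x) v \<bullet> b) *\<^sub>R frechet_derivative g (at (h x)) b)
      = frechet_derivative g (at (h x)) (frechet_derivative h (at x) v)" if "x \<in> X" for x v
  proof -
    have "linear (frechet_derivative g (at (h x)))"
      using C_k_on_SucD[OF Suc.prems(1) Y[OF that]] has_derivative_linear by blast
    then show ?thesis
      using linear_sum[of "frechet_derivative g (at (h x))"] linear_scale[of "frechet_derivative g (at (h x))"]
      by (metis (no_types, lifting) euclidean_representation sum.cong)
  qed
  show ?case
  proof (rule C_k_on_SucI[OF assms(1) d])
    fix v
    have "C_k_on n (\<lambda>x. \<Sum>b\<in>Basis. (frechet_derivative h (at x) v \<bullet> b) *\<^sub>R frechet_derivative g (at (h x)) b) X"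
      by (intro C_k_on_sum C_k_on_scaleR assms(1) C_k_on_linear[OF bounded_linear_inner_left] Suc.IH
        C_k_on_frechet_derivative Suc.prems C_k_on_Suc_imp[OF Suc.prems(2)])
    then show "C_k_on n (\<lambda>x. frechet_derivative g (at (h x)) (frechet_derivative h (at x) v)) X"
      by (rule C_k_on_cong_imp[OF assms(1) eq, rotated])
  qed auto
qed

section \<open>Vectors, matrices and linear systems of class \<open>C^k\<close>\<close>

lemma bounded_linear_vec_single: "bounded_linear (\<lambda>y. \<chi> j. if j = i then y else (0::'b::real_normed_vector))"
proof (rule bounded_linear_intro[where K = 1])
  fix y :: 'b
  have "norm (\<chi> j. if j = i then y else 0) \<le> (\<Sum>j\<in>UNIV. norm (if j = i then y else 0))"
    unfolding norm_vec_def by (rule order_trans[OF L2_set_le_sum]) auto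
  also have "\<dots> = norm y" by (simp add: if_distrib[of norm] cong: if_cong)
  finally show "norm (\<chi> j. if j = i then y else 0) \<le> norm y * 1" by simp
qed (auto simp: vec_eq_iff)

lemma C_k_on_vec_nth: "open X \<Longrightarrow> C_k_on n f X \<Longrightarrow> C_k_on n (\<lambda>x. f x $ i) X"
  by (rule C_k_on_linear[OF bounded_linear_vec_nth])

lemma C_k_on_vecI:
  fixes f :: "'a::euclidean_space \<Rightarrow> 'b::real_normed_vector ^ 'n"
  assumes "open X" "\<And>i. C_k_on n (\<lambda>x. f x $ i) X"
  shows "C_k_on n f X"
proof -
  have "(\<lambda>x. f x) = (\<lambda>x. \<Sum>i\<in>UNIV. \<chi> j. if j = i then f x $ i else 0)"
    by (auto simp: vec_eq_iff fun_eq_iff sum.delta)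
  moreover have "C_k_on n (\<lambda>x. \<Sum>i\<in>UNIV. \<chi> j. if j = i then f x $ i else 0) X"
    by (intro C_k_on_sum C_k_on_linear[OF bounded_linear_vec_single] assms)
  ultimately show ?thesis by metis
qed

lemma C_k_on_matrix_nth: "open X \<Longrightarrow> C_k_on n f X \<Longrightarrow> C_k_on n (\<lambda>x. f x $ i $ j) X"
  by (intro C_k_on_vec_nth)

lemma C_k_on_matrix_matrix_mult:
  fixes f :: "'a::euclidean_space \<Rightarrow> 'b::real_normed_field ^ 'm ^ 'n" and g :: "'a \<Rightarrow> 'b ^ 'k ^ 'm"
  assumes "open X" "C_k_on n f X" "C_k_on n g X"
  shows "C_k_on n (\<lambda>x. f x ** g x) X"
  by (rule C_k_on_vecI[OF assms(1)], rule C_k_on_vecI[OF assms(1)])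
    (auto simp: matrix_matrix_mult_def intro!: C_k_on_sum C_k_on_mult C_k_on_matrix_nth assms)

lemma C_k_on_matrix_vector_mult:
  fixes f :: "'a::euclidean_space \<Rightarrow> 'b::real_normed_field ^ 'm ^ 'n" and g :: "'a \<Rightarrow> 'b ^ 'm"
  assumes "open X" "C_k_on n f X" "C_k_on n g X"
  shows "C_k_on n (\<lambda>x. f x *v g x) X"
  by (rule C_k_on_vecI[OF assms(1)])
    (auto simp: matrix_vector_mult_def intro!: C_k_on_sum C_k_on_mult C_k_on_matrix_nth C_k_on_vec_nth assms)

lemma C_k_on_transpose: "open X \<Longrightarrow> C_k_on n f X \<Longrightarrow> C_k_on n (\<lambda>x. transpose (f x)) X"
  by (rule C_k_on_vecI, assumption, rule C_k_on_vecI) (auto simp: transpose_def intro!: C_k_on_matrix_nth)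

lemma C_k_on_mat:
  assumes "open X" "C_k_on n f X"
  shows "C_k_on n (\<lambda>x. mat (f x)) X"
proof (rule C_k_on_vecI[OF assms(1)], rule C_k_on_vecI[OF assms(1)])
  fix i j :: 'c
  show "C_k_on n (\<lambda>x. mat (f x) $ i $ j) X"
    using assms(2) by (cases "i = j") (auto simp: mat_def C_k_on_const)
qed

lemma C_k_on_det:
  fixes f :: "'a::euclidean_space \<Rightarrow> 'b::real_normed_field ^ 'n ^ 'n"
  assumes "open X" "C_k_on n f X"
  shows "C_k_on n (\<lambda>x. det (f x)) X"
  unfolding det_def by (intro C_k_on_sum C_k_on_mult C_k_on_prod C_k_on_const C_k_on_matrix_nth assms)

text \<open>Cramer's rule writes the solution as a quotient of determinants, so a solution that was
  merely chosen pointwise inherits the smoothness of the data. The matrices \<open>L\<close>,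
  \<open>T\<close>, \<open>P\<close> and the homological coefficients all become smooth this
  way.\<close>

lemma C_k_on_solve:
  fixes M :: "'a::euclidean_space \<Rightarrow> 'b::real_normed_field ^ 'n ^ 'n"
  assumes "open X" "C_k_on n M X" "C_k_on n b X"
    and "\<And>x. x \<in> X \<Longrightarrow> M x *v y x = b x" "\<And>x. x \<in> X \<Longrightarrow> det (M x) \<noteq> 0"
  shows "C_k_on n y X"
proof -
  define z where "z x = (\<chi> k. det (\<chi> i j. if j = k then b x $ i else M x $ i $ j) / det (M x))" for x
  have D: "C_k_on n (\<lambda>x. det (\<chi> i j. if j = k then b x $ i else M x $ i $ j)) X" for k
  proof (rule C_k_on_det[OF assms(1)], rule C_k_on_vecI[OF assms(1)], rule C_k_on_vecI[OF assms(1)])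
    fix i j
    show "C_k_on n (\<lambda>x. (\<chi> i j. if j = k then b x $ i else M x $ i $ j) $ i $ j) X"
      using assms by (cases "j = k") (auto intro!: C_k_on_matrix_nth C_k_on_vec_nth)
  qed
  have "C_k_on n z X"
  proof (rule C_k_on_vecI[OF assms(1)])
    show "C_k_on n (\<lambda>x. z x $ k) X" for k
      using C_k_on_divide[OF assms(1) D[of k] C_k_on_det[OF assms(1,2)] assms(5)] by (simp add: z_def)
  qed
  moreover have "z x = y x" if "x \<in> X" for x
    using cramer[OF assms(5)[OF that], of "y x" "b x"] assms(4)[OF that] by (simp add: z_def)
  ultimately show ?thesis by (rule C_k_on_cong_imp[OF assms(1), rotated])
qed

lemma C_k_on_solve_matrix:
  fixes M :: "'a::euclidean_space \<Rightarrow> 'b::real_normed_field ^ 'n ^ 'n" and Y :: "'a \<Rightarrow> 'b ^ 'm ^ 'n"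
  assumes "open X" "C_k_on n M X" "C_k_on n B X"
    and "\<And>x. x \<in> X \<Longrightarrow> M x ** Y x = B x" "\<And>x. x \<in> X \<Longrightarrow> det (M x) \<noteq> 0"
  shows "C_k_on n Y X"
proof (rule C_k_on_vecI[OF assms(1)], rule C_k_on_vecI[OF assms(1)])
  fix i j
  have "C_k_on n (\<lambda>x. column j (Y x)) X"
  proof (rule C_k_on_solve[OF assms(1,2) _ _ assms(5)])
    show "C_k_on n (\<lambda>x. column j (B x)) X"
      by (rule C_k_on_vecI[OF assms(1)]) (auto simp: column_def intro!: C_k_on_matrix_nth assms)
    show "M x *v column j (Y x) = column j (B x)" if "x \<in> X" for x
      using assms(4)[OF that, symmetric]
      by (auto simp: column_def matrix_matrix_mult_def matrix_vector_mult_def)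
  qed
  then show "C_k_on n (\<lambda>x. Y x $ i $ j) X"
    using C_k_on_vec_nth[OF assms(1), of n "\<lambda>x. column j (Y x)" i] by (simp add: column_def)
qed

section \<open>Orders of vanishing and homogeneous polynomials\<close>

text \<open>The filter includes the origin, unlike the one in \<open>has_expansion\<close>, and so
  forces \<open>f 0 = 0\<close>. This allows composition with functions that take the value 0 away
  from the origin.\<close>

definition small_at0 :: "nat \<Rightarrow> ('a::real_normed_vector \<Rightarrow> 'b::real_normed_vector) \<Rightarrow> bool" where
  "small_at0 q f \<longleftrightarrow> (\<forall>e>0. \<forall>\<^sub>F u in nhds 0. norm (f u) \<le> e * norm u ^ q)"

definition big_at0 :: "nat \<Rightarrow> ('a::real_normed_vector \<Rightarrow> 'b::real_normed_vector) \<Rightarrow> bool" where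
  "big_at0 q f \<longleftrightarrow> (\<exists>C. \<forall>\<^sub>F u in nhds 0. norm (f u) \<le> C * norm u ^ q)"

lemma eventually_norm_less_nhds_0: "0 < d \<Longrightarrow> \<forall>\<^sub>F u in nhds 0. norm u < d"
  by (auto simp: eventually_nhds_metric intro!: exI[of _ d])

lemma big_at0E:
  assumes "big_at0 q f"
  obtains C where "C > 0" "\<forall>\<^sub>F u in nhds 0. norm (f u) \<le> C * norm u ^ q"
proof -
  obtain C where "\<forall>\<^sub>F u in nhds 0. norm (f u) \<le> C * norm u ^ q"
    using assms by (auto simp: big_at0_def)
  then have "\<forall>\<^sub>F u in nhds 0. norm (f u) \<le> max C 1 * norm u ^ q"
    by eventually_elim (meson max.cobounded1 mult_right_mono norm_ge_zero order_trans zero_le_power)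
  then show ?thesis by (intro that[of "max C 1"]) auto
qed

lemma small_at0_imp_big: "small_at0 q f \<Longrightarrow> big_at0 q f"
  unfolding small_at0_def big_at0_def by (metis zero_less_one)

lemma big_at0_mono:
  assumes "big_at0 q f" "p \<le> q"
  shows "big_at0 p f"
proof -
  obtain C where C: "C > 0" "\<forall>\<^sub>F u in nhds 0. norm (f u) \<le> C * norm u ^ q" using big_at0E[OF assms(1)] by blast
  have "\<forall>\<^sub>F u in nhds 0. norm (f u) \<le> C * norm u ^ p"
    using C(2) eventually_norm_less_nhds_0[OF zero_less_one]
  proof eventually_elim
    case (elim u)
    then have "norm u ^ q \<le> norm u ^ p" using assms(2) by (intro power_decreasing) auto
    then show ?case using elim C(1) by (meson less_imp_le mult_left_mono order_trans)
  qed
  then show ?thesis by (auto simp: big_at0_def)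
qed

lemma big_at0_imp_small:
  assumes "big_at0 q f" "p < q"
  shows "small_at0 p f"
  unfolding small_at0_def
proof (intro allI impI)
  fix e :: real assume e: "e > 0"
  have "big_at0 (Suc p) f" using big_at0_mono assms by (metis Suc_leI)
  then obtain C where C: "C > 0" "\<forall>\<^sub>F u in nhds 0. norm (f u) \<le> C * norm u ^ Suc p" using big_at0E[OF \<open>big_at0 (Suc p) f\<close>] by blast
  have "\<forall>\<^sub>F u in nhds 0. norm (u::'a) < e / C" using C e by (intro eventually_norm_less_nhds_0) auto
  then show "\<forall>\<^sub>F u in nhds 0. norm (f u) \<le> e * norm u ^ p" using C(2)
  proof eventually_elim
    case (elim u)
    have "C * norm u \<le> e" using elim C(1) by (simp add: field_simps)
    then have "C * norm u * norm u ^ p \<le> e * norm u ^ p" by (intro mult_right_mono) auto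
    then show ?case using elim by simp
  qed
qed

lemma small_at0_mono: "small_at0 q f \<Longrightarrow> p \<le> q \<Longrightarrow> small_at0 p f"
  by (metis big_at0_imp_small le_neq_implies_less small_at0_imp_big)

lemma small_at0_zero [simp]: "small_at0 q (\<lambda>u. 0)"
  by (simp add: small_at0_def)

lemma small_at0_cong:
  assumes "\<forall>\<^sub>F u in nhds 0. f u = g u" "small_at0 q f"
  shows "small_at0 q g"
  unfolding small_at0_def
proof (intro allI impI)
  fix e :: real assume "e > 0"
  with assms(2) have "\<forall>\<^sub>F u in nhds 0. norm (f u) \<le> e * norm u ^ q" by (simp add: small_at0_def)
  with assms(1) show "\<forall>\<^sub>F u in nhds 0. norm (g u) \<le> e * norm u ^ q" by eventually_elim simp
qed

lemma small_at0_add: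
  assumes "small_at0 q f" "small_at0 q g"
  shows "small_at0 q (\<lambda>u. f u + g u)"
  unfolding small_at0_def
proof (intro allI impI)
  fix e :: real assume "e > 0"
  then have "\<forall>\<^sub>F u in nhds 0. norm (f u) \<le> e/2 * norm u ^ q" "\<forall>\<^sub>F u in nhds 0. norm (g u) \<le> e/2 * norm u ^ q"
    using assms by (auto simp: small_at0_def simp del: times_divide_eq_left)
  then show "\<forall>\<^sub>F u in nhds 0. norm (f u + g u) \<le> e * norm u ^ q"
    by eventually_elim (rule norm_triangle_le, simp)
qed

lemma small_at0_minus: "small_at0 q f \<Longrightarrow> small_at0 q (\<lambda>u. - f u)"
  by (simp add: small_at0_def)

lemma small_at0_diff: "small_at0 q f \<Longrightarrow> small_at0 q g \<Longrightarrow> small_at0 q (\<lambda>u. f u - g u)"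
  using small_at0_add[of q f "\<lambda>u. - g u"] small_at0_minus[of q g] by simp

lemma small_at0_sum: "(\<And>i. i \<in> I \<Longrightarrow> small_at0 q (f i)) \<Longrightarrow> small_at0 q (\<lambda>u. \<Sum>i\<in>I. f i u)"
  by (induction I rule: infinite_finite_induct) (auto intro: small_at0_add)

lemma big_at0_add:
  assumes "big_at0 q f" "big_at0 q g"
  shows "big_at0 q (\<lambda>u. f u + g u)"
proof -
  obtain C D where "\<forall>\<^sub>F u in nhds 0. norm (f u) \<le> C * norm u ^ q" "\<forall>\<^sub>F u in nhds 0. norm (g u) \<le> D * norm u ^ q"
    using assms by (auto simp: big_at0_def)
  then have "\<forall>\<^sub>F u in nhds 0. norm (f u + g u) \<le> (C + D) * norm u ^ q"
    by eventually_elim (rule norm_triangle_le, simp add: algebra_simps)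
  then show ?thesis by (auto simp: big_at0_def)
qed

lemma big_at0_zero [simp]: "big_at0 q (\<lambda>u. 0)"
  by (auto simp: big_at0_def intro: exI[of _ 0])

lemma big_at0_sum: "(\<And>i. i \<in> I \<Longrightarrow> big_at0 q (f i)) \<Longrightarrow> big_at0 q (\<lambda>u. \<Sum>i\<in>I. f i u)"
  by (induction I rule: infinite_finite_induct) (auto intro: big_at0_add)

lemma big_at0_dominated:
  assumes "big_at0 q g" "\<forall>\<^sub>F u in nhds 0. norm (f u) \<le> C * norm (g u)" "C \<ge> 0"
  shows "big_at0 q f"
proof -
  obtain D where "\<forall>\<^sub>F u in nhds 0. norm (g u) \<le> D * norm u ^ q" using assms by (auto simp: big_at0_def)
  with assms(2) have "\<forall>\<^sub>F u in nhds 0. norm (f u) \<le> (C * D) * norm u ^ q"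
    by eventually_elim (metis (no_types, lifting) assms(3) mult.assoc mult_left_mono order_trans)
  then show ?thesis by (auto simp: big_at0_def)
qed

lemma bounded_bilinear_linear_scaleR:
  "bounded_linear L \<Longrightarrow> bounded_bilinear (\<lambda>x (s::real). s *\<^sub>R L x)"
  by (rule bounded_bilinear.flip[OF bounded_bilinear.comp[OF bounded_bilinear_scaleR bounded_linear_ident]])

lemma big_at0_bilinear:
  assumes "bounded_bilinear bil" "big_at0 p f" "big_at0 q g"
  shows "big_at0 (p + q) (\<lambda>u. bil (f u) (g u))"
proof -
  obtain K where K: "K > 0" "\<forall>x y. norm (bil x y) \<le> norm x * norm y * K"
    using bounded_bilinear.pos_bounded[OF assms(1)] by blast
  obtain C where C: "C > 0" "\<forall>\<^sub>F u in nhds 0. norm (f u) \<le> C * norm u ^ p"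
    using big_at0E[OF assms(2)] by blast
  obtain D where D: "D > 0" "\<forall>\<^sub>F u in nhds 0. norm (g u) \<le> D * norm u ^ q"
    using big_at0E[OF assms(3)] by blast
  from C(2) D(2) have "\<forall>\<^sub>F u in nhds 0. norm (bil (f u) (g u)) \<le> (C * D * K) * norm u ^ (p + q)"
  proof eventually_elim
    case (elim u)
    have "norm (f u) * norm (g u) \<le> (C * norm u ^ p) * (D * norm u ^ q)"
      using elim C(1) by (intro mult_mono) auto
    then have "norm (f u) * norm (g u) * K \<le> (C * norm u ^ p) * (D * norm u ^ q) * K"
      using K(1) by (intro mult_right_mono) auto
    also have "\<dots> = (C * D * K) * norm u ^ (p + q)" by (simp add: power_add algebra_simps)
    finally show ?case using K(2) by (meson order_trans)
  qed
  then show ?thesis by (auto simp: big_at0_def)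
qed

lemma small_at0_bilinear:
  assumes "bounded_bilinear bil" "small_at0 p f" "big_at0 q g"
  shows "small_at0 (p + q) (\<lambda>u. bil (f u) (g u))"
  unfolding small_at0_def
proof (intro allI impI)
  fix e :: real assume e: "e > 0"
  obtain K where K: "K > 0" "\<forall>x y. norm (bil x y) \<le> norm x * norm y * K"
    using bounded_bilinear.pos_bounded[OF assms(1)] by blast
  obtain D where D: "D > 0" "\<forall>\<^sub>F u in nhds 0. norm (g u) \<le> D * norm u ^ q"
    using big_at0E[OF assms(3)] by blast
  have "\<forall>\<^sub>F u in nhds 0. norm (f u) \<le> (e / (D * K)) * norm u ^ p"
    using assms(2) e D(1) K(1) unfolding small_at0_def by (metis divide_pos_pos mult_pos_pos)
  with D(2) show "\<forall>\<^sub>F u in nhds 0. norm (bil (f u) (g u)) \<le> e * norm u ^ (p + q)"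
  proof eventually_elim
    case (elim u)
    have "norm (f u) * norm (g u) \<le> ((e / (D * K)) * norm u ^ p) * (D * norm u ^ q)"
      using elim e D(1) K(1) by (intro mult_mono) auto
    then have "norm (f u) * norm (g u) * K \<le> ((e / (D * K)) * norm u ^ p) * (D * norm u ^ q) * K"
      using K(1) by (intro mult_right_mono) auto
    also have "\<dots> = e * norm u ^ (p + q)" using D(1) K(1) by (simp add: power_add field_simps)
    finally show ?case using K(2) by (meson order_trans)
  qed
qed

lemma small_at0_bilinear_right:
  assumes "bounded_bilinear bil" "big_at0 p f" "small_at0 q g"
  shows "small_at0 (p + q) (\<lambda>u. bil (f u) (g u))"
  using small_at0_bilinear[OF bounded_bilinear.flip[OF assms(1)] assms(3,2)] by (simp add: add.commute)

lemma big_at0_const [simp]: "big_at0 0 (\<lambda>u. c)"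
  by (auto simp: big_at0_def)

lemma big_at0_linear:
  assumes "bounded_linear L" "big_at0 q f"
  shows "big_at0 q (\<lambda>u. L (f u))"
proof -
  obtain K where "K \<ge> 0" "\<And>x. norm (L x) \<le> norm x * K" using bounded_linear.nonneg_bounded[OF assms(1)] by blast
  then show ?thesis by (intro big_at0_dominated[OF assms(2), of _ K]) (auto simp: mult.commute)
qed

lemma small_at0_linear:
  assumes "bounded_linear L" "small_at0 q f"
  shows "small_at0 q (\<lambda>u. L (f u))"
proof -
  have "bounded_bilinear (\<lambda>x (s::real). s *\<^sub>R L x)"
    by (rule bounded_bilinear_linear_scaleR[OF assms(1)])
  from small_at0_bilinear[OF this assms(2) big_at0_const[of 1]] show ?thesis by simp
qed

lemma big_at0_tendsto_0:
  assumes "big_at0 q f" "q > 0"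
  shows "(f \<longlongrightarrow> 0) (nhds 0)"
proof (rule tendstoI)
  fix e :: real assume "e > 0"
  have "small_at0 0 f" using big_at0_imp_small assms by blast
  then have "\<forall>\<^sub>F u in nhds 0. norm (f u) \<le> e/2" using \<open>e > 0\<close> by (auto simp: small_at0_def dest!: spec[of _ "e/2"])
  then show "\<forall>\<^sub>F u in nhds 0. dist (f u) 0 < e" by eventually_elim (use \<open>e > 0\<close> in auto)
qed

lemma small_at0_compose:
  assumes "small_at0 q e" "big_at0 1 g"
  shows "small_at0 q (\<lambda>u. e (g u))"
  unfolding small_at0_def
proof (intro allI impI)
  fix s :: real assume s: "s > 0"
  obtain C where C: "C > 0" "\<forall>\<^sub>F u in nhds 0. norm (g u) \<le> C * norm u ^ 1" using big_at0E[OF assms(2)] by blast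
  have "\<forall>\<^sub>F x in nhds 0. norm (e x) \<le> s / C ^ q * norm x ^ q"
    using assms(1) s C(1) unfolding small_at0_def by (metis divide_pos_pos zero_less_power)
  then have "\<forall>\<^sub>F u in nhds 0. norm (e (g u)) \<le> s / C ^ q * norm (g u) ^ q"
    using big_at0_tendsto_0[OF assms(2)] by (auto simp: filterlim_iff)
  then show "\<forall>\<^sub>F u in nhds 0. norm (e (g u)) \<le> s * norm u ^ q" using C(2)
  proof eventually_elim
    case (elim u)
    have "s / C ^ q * norm (g u) ^ q \<le> s / C ^ q * (C * norm u) ^ q"
      using elim s C(1) by (intro mult_left_mono power_mono) auto
    also have "\<dots> = s * norm u ^ q" using C(1) by (simp add: power_mult_distrib)
    finally show ?case using elim by simp
  qed
qed

section \<open>Homogeneous polynomials in two variables and their smooth families\<close>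

definition hom_poly :: "nat \<Rightarrow> (nat \<Rightarrow> 'b::real_normed_vector) \<Rightarrow> real ^ 2 \<Rightarrow> 'b" where
  "hom_poly k c u = (\<Sum>a\<le>k. (u $ 1 ^ a * u $ 2 ^ (k - a)) *\<^sub>R c a)"

definition is_hom :: "nat \<Rightarrow> (real ^ 2 \<Rightarrow> 'b::real_normed_vector) \<Rightarrow> bool" where
  "is_hom k H \<longleftrightarrow> (\<exists>c. H = hom_poly k c)"

definition hom_family ::
    "nat \<Rightarrow> real set \<Rightarrow> nat \<Rightarrow> (real ^ 2 \<Rightarrow> real \<Rightarrow> 'b::real_normed_vector) \<Rightarrow> bool" where
  "hom_family r V k h \<longleftrightarrow>
     (\<exists>c. (\<forall>a. C_k_on r (c a) V) \<and> (\<forall>\<mu>\<in>V. \<forall>u. h u \<mu> = hom_poly k (\<lambda>a. c a \<mu>) u))"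

text \<open>A single polynomial is a family that is constant in the parameter, so closure properties
  proved for families specialise to it.\<close>

lemma is_hom_iff_family: "is_hom k H \<longleftrightarrow> hom_family 0 UNIV k (\<lambda>u _. H u)"
proof
  assume "is_hom k H"
  then obtain c where "H = hom_poly k c" by (auto simp: is_hom_def)
  then show "hom_family 0 UNIV k (\<lambda>u _. H u)"
    unfolding hom_family_def by (intro exI[of _ "\<lambda>a _. c a"]) (simp only: C_k_on_const, simp)
next
  assume "hom_family 0 UNIV k (\<lambda>u _. H u)"
  then obtain c where "\<forall>\<mu> u. H u = hom_poly k (\<lambda>a. c a \<mu>) u" by (auto simp: hom_family_def)
  then show "is_hom k H" by (auto simp: is_hom_def fun_eq_iff)
qed

lemma hom_family_imp_is_hom: "hom_family r V k h \<Longrightarrow> \<mu> \<in> V \<Longrightarrow> is_hom k (\<lambda>u. h u \<mu>)"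
  by (auto simp: hom_family_def is_hom_def fun_eq_iff)

lemma hom_family_cong: "(\<And>u \<mu>. \<mu> \<in> V \<Longrightarrow> h u \<mu> = g u \<mu>) \<Longrightarrow> hom_family r V k h \<Longrightarrow> hom_family r V k g"
  by (auto simp: hom_family_def)

lemma hom_family_zero: "hom_family r V k (\<lambda>u \<mu>. 0)"
  unfolding hom_family_def by (intro exI[of _ "\<lambda>a _. 0"]) (simp only: C_k_on_const, simp add: hom_poly_def)

lemma hom_family_add:
  assumes "open V" "hom_family r V k h" "hom_family r V k g"
  shows "hom_family r V k (\<lambda>u \<mu>. h u \<mu> + g u \<mu>)"
proof -
  obtain c d where "\<forall>a. C_k_on r (c a) V" "\<forall>\<mu>\<in>V. \<forall>u. h u \<mu> = hom_poly k (\<lambda>a. c a \<mu>) u"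
    "\<forall>a. C_k_on r (d a) V" "\<forall>\<mu>\<in>V. \<forall>u. g u \<mu> = hom_poly k (\<lambda>a. d a \<mu>) u"
    using assms(2,3) unfolding hom_family_def by blast
  then show ?thesis unfolding hom_family_def
    by (intro exI[of _ "\<lambda>a \<mu>. c a \<mu> + d a \<mu>"])
      (auto simp: hom_poly_def scaleR_add_right sum.distrib intro: C_k_on_add assms(1))
qed

lemma hom_family_sum:
  assumes "open V" "\<And>i. i \<in> I \<Longrightarrow> hom_family r V k (h i)"
  shows "hom_family r V k (\<lambda>u \<mu>. \<Sum>i\<in>I. h i u \<mu>)"
  using assms(2) by (induction I rule: infinite_finite_induct) (auto intro: hom_family_zero hom_family_add assms(1))

lemma hom_family_monom:
  assumes "C_k_on r c V" "a + b = k"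
  shows "hom_family r V k (\<lambda>u \<mu>. (u $ 1 ^ a * u $ 2 ^ b) *\<^sub>R c \<mu>)"
proof -
  have "hom_poly k (\<lambda>i. if i = a then c \<mu> else 0) u = (u $ 1 ^ a * u $ 2 ^ b) *\<^sub>R c \<mu>" for u \<mu>
    using assms(2) unfolding hom_poly_def by (auto simp: if_distrib[of "scaleR _"] sum.delta cong: if_cong)
  moreover have "C_k_on r (\<lambda>\<mu>. if i = a then c \<mu> else 0) V" for i
    using assms(1) by (cases "i = a") (simp_all add: C_k_on_const)
  ultimately show ?thesis unfolding hom_family_def
    by (intro exI[of _ "\<lambda>i \<mu>. if i = a then c \<mu> else 0"]) auto
qed

lemma hom_family_const: "C_k_on r c V \<Longrightarrow> hom_family r V 0 (\<lambda>u. c)"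
  using hom_family_monom[of r c V 0 0 0] by simp

lemma hom_family_bilinear:
  assumes "open V" "bounded_bilinear bil" "hom_family r V k h" "hom_family r V l g"
  shows "hom_family r V (k + l) (\<lambda>u \<mu>. bil (h u \<mu>) (g u \<mu>))"
proof -
  obtain c d where c: "\<forall>a. C_k_on r (c a) V" "\<forall>\<mu>\<in>V. \<forall>u. h u \<mu> = hom_poly k (\<lambda>a. c a \<mu>) u"
    and d: "\<forall>a. C_k_on r (d a) V" "\<forall>\<mu>\<in>V. \<forall>u. g u \<mu> = hom_poly l (\<lambda>a. d a \<mu>) u"
    using assms(3,4) unfolding hom_family_def by blast
  interpret bounded_bilinear bil by fact
  have "hom_family r V (k + l) (\<lambda>u \<mu>. \<Sum>a\<le>k. \<Sum>b\<le>l. (u $ 1 ^ (a + b) * u $ 2 ^ ((k - a) + (l - b))) *\<^sub>R bil (c a \<mu>) (d b \<mu>))"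
  proof (intro hom_family_sum assms(1) hom_family_monom C_k_on_bilinear[OF assms(2,1)])
    show "C_k_on r (c a) V" "C_k_on r (d a) V" for a using c(1) d(1) by auto
  qed auto
  then show ?thesis
  proof (rule hom_family_cong[rotated])
    fix u \<mu> assume "\<mu> \<in> V"
    then have "bil (h u \<mu>) (g u \<mu>) = (\<Sum>a\<le>k. \<Sum>b\<le>l. bil ((u $ 1 ^ a * u $ 2 ^ (k - a)) *\<^sub>R c a \<mu>) ((u $ 1 ^ b * u $ 2 ^ (l - b)) *\<^sub>R d b \<mu>))"
      using c(2) d(2) by (simp only: hom_poly_def sum_left) (simp only: sum_right)
    then show "(\<Sum>a\<le>k. \<Sum>b\<le>l. (u $ 1 ^ (a + b) * u $ 2 ^ ((k - a) + (l - b))) *\<^sub>R bil (c a \<mu>) (d b \<mu>)) = bil (h u \<mu>) (g u \<mu>)"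
      by (simp only: scaleR_left scaleR_right scaleR_scaleR power_add mult.assoc mult.commute mult.left_commute)
  qed
qed

lemma hom_family_linear:
  assumes "open V" "bounded_linear L" "hom_family r V k h"
  shows "hom_family r V k (\<lambda>u \<mu>. L (h u \<mu>))"
proof -
  have "bounded_bilinear (\<lambda>x (s::real). s *\<^sub>R L x)"
    by (rule bounded_bilinear_linear_scaleR[OF assms(2)])
  from hom_family_bilinear[OF assms(1) this assms(3) hom_family_const[OF C_k_on_const[of r 1]]] show ?thesis by simp
qed

lemma hom_family_nth: "open V \<Longrightarrow> hom_family r V 1 (\<lambda>u \<mu>. u $ i)"
  using hom_family_monom[OF C_k_on_const[of r "1::real" V], of 1 0 1] hom_family_monom[OF C_k_on_const[of r "1::real" V], of 0 1 1]
    exhaust_2[of i] by auto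

text \<open>For \<open>k = 0\<close> the truncated degree \<open>k - 1\<close> is 0, and both
  partial derivatives are the zero family.\<close>

lemma hom_family_has_derivative:
  assumes "open V" "hom_family r V k h"
  shows "\<exists>g1 g2. hom_family r V (k - 1) g1 \<and> hom_family r V (k - 1) g2 \<and>
    (\<forall>\<mu>\<in>V. \<forall>u. ((\<lambda>u. h u \<mu>) has_derivative (\<lambda>v. v $ 1 *\<^sub>R g1 u \<mu> + v $ 2 *\<^sub>R g2 u \<mu>)) (at u))"
proof -
  obtain c where c: "\<And>a. C_k_on r (c a) V" "\<forall>\<mu>\<in>V. \<forall>u. h u \<mu> = hom_poly k (\<lambda>a. c a \<mu>) u"
    using assms(2) unfolding hom_family_def by blast
  \<comment> \<open>The summand \<open>a = 0\<close> is removed rather than left with factor 0,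
    because its truncated exponents would give a monomial of degree \<open>k\<close>. The same holds
    for \<open>a = k\<close> in \<open>g2\<close>.\<close>
  define g1 where "g1 u \<mu> = (\<Sum>a\<le>k. if a = 0 then 0 else (u $ 1 ^ (a - 1) * u $ 2 ^ (k - a)) *\<^sub>R (real a *\<^sub>R c a \<mu>))" for u :: "real^2" and \<mu>
  define g2 where "g2 u \<mu> = (\<Sum>a\<le>k. if a = k then 0 else (u $ 1 ^ a * u $ 2 ^ (k - a - 1)) *\<^sub>R (real (k - a) *\<^sub>R c a \<mu>))" for u :: "real^2" and \<mu>
  have "hom_family r V (k - 1) (\<lambda>u \<mu>. if a = 0 then 0 else (u $ 1 ^ (a - 1) * u $ 2 ^ (k - a)) *\<^sub>R (real a *\<^sub>R c a \<mu>))" if "a \<le> k" for a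
    using that by (cases "a = 0") (auto simp del: scaleR_scaleR intro!: hom_family_zero hom_family_monom C_k_on_scaleR C_k_on_const c assms)
  then have 1: "hom_family r V (k - 1) g1" unfolding g1_def by (intro hom_family_sum assms(1)) auto
  have "hom_family r V (k - 1) (\<lambda>u \<mu>. if a = k then 0 else (u $ 1 ^ a * u $ 2 ^ (k - a - 1)) *\<^sub>R (real (k - a) *\<^sub>R c a \<mu>))" if "a \<le> k" for a
    using that by (cases "a = k") (auto simp del: scaleR_scaleR intro!: hom_family_zero hom_family_monom C_k_on_scaleR C_k_on_const c assms)
  then have 2: "hom_family r V (k - 1) g2" unfolding g2_def by (intro hom_family_sum assms(1)) auto
  have "((\<lambda>u. h u \<mu>) has_derivative (\<lambda>v. v $ 1 *\<^sub>R g1 u \<mu> + v $ 2 *\<^sub>R g2 u \<mu>)) (at u)" if "\<mu> \<in> V" for \<mu> u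
  proof -
    have "((\<lambda>u. u $ i) has_derivative (\<lambda>v. v $ i)) (at u)" for i and u :: "real^2"
      by (rule bounded_linear.has_derivative[OF bounded_linear_vec_nth has_derivative_ident])
    note d = this
    have "((\<lambda>u. hom_poly k (\<lambda>a. c a \<mu>) u) has_derivative
      (\<lambda>v. \<Sum>a\<le>k. (u $ 1 ^ a * (real (k - a) * (v $ 2) * u $ 2 ^ (k - a - 1)) + (real a * v $ 1 * u $ 1 ^ (a - 1)) * u $ 2 ^ (k - a)) *\<^sub>R c a \<mu>)) (at u)"
      unfolding hom_poly_def
      by (rule derivative_eq_intros d refl | simp)+
    also have "(\<lambda>v. \<Sum>a\<le>k. (u $ 1 ^ a * (real (k - a) * (v $ 2) * u $ 2 ^ (k - a - 1)) + (real a * v $ 1 * u $ 1 ^ (a - 1)) * u $ 2 ^ (k - a)) *\<^sub>R c a \<mu>)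
        = (\<lambda>v. v $ 1 *\<^sub>R g1 u \<mu> + v $ 2 *\<^sub>R g2 u \<mu>)"
      unfolding g1_def g2_def scaleR_sum_right sum.distrib[symmetric]
      by (intro ext sum.cong refl) (auto simp: algebra_simps)
    finally show ?thesis using c(2) that by simp
  qed
  with 1 2 show ?thesis by blast
qed

lemma is_hom_has_derivative:
  assumes "is_hom k H"
  shows "\<exists>g1 g2. is_hom (k - 1) g1 \<and> is_hom (k - 1) g2 \<and>
    (\<forall>u. (H has_derivative (\<lambda>v. v $ 1 *\<^sub>R g1 u + v $ 2 *\<^sub>R g2 u)) (at u))"
proof -
  obtain g1 g2 where g: "hom_family 0 UNIV (k - 1) g1" "hom_family 0 UNIV (k - 1) g2"
    "\<forall>\<mu>\<in>UNIV. \<forall>u. (H has_derivative (\<lambda>v. v $ 1 *\<^sub>R g1 u \<mu> + v $ 2 *\<^sub>R g2 u \<mu>)) (at u)"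
    using hom_family_has_derivative[OF open_UNIV iffD1[OF is_hom_iff_family assms]] by blast
  then show ?thesis
    by (intro exI[of _ "\<lambda>u. g1 u 0"] exI[of _ "\<lambda>u. g2 u 0"]) (auto intro: hom_family_imp_is_hom)
qed

lemma is_hom_zero: "is_hom k (\<lambda>u. 0)"
  using hom_family_zero is_hom_iff_family by blast

lemma is_hom_add: "is_hom k H \<Longrightarrow> is_hom k G \<Longrightarrow> is_hom k (\<lambda>u. H u + G u)"
  using hom_family_add[OF open_UNIV, of 0 k "\<lambda>u _. H u" "\<lambda>u _. G u"] unfolding is_hom_iff_family .

lemma is_hom_linear: "bounded_linear L \<Longrightarrow> is_hom k H \<Longrightarrow> is_hom k (\<lambda>u. L (H u))"
  unfolding is_hom_iff_family by (rule hom_family_linear[OF open_UNIV])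

lemma is_hom_minus: "is_hom k H \<Longrightarrow> is_hom k (\<lambda>u. - H u)"
  by (rule is_hom_linear[OF bounded_linear_minus[OF bounded_linear_ident]])

lemma is_hom_diff: "is_hom k H \<Longrightarrow> is_hom k G \<Longrightarrow> is_hom k (\<lambda>u. H u - G u)"
  using is_hom_add[of k H "\<lambda>u. - G u"] is_hom_minus[of k G] by simp

lemma is_hom_scale: "is_hom k H \<Longrightarrow> H (t *\<^sub>R u) = t ^ k *\<^sub>R H u"
  by (auto simp: is_hom_def hom_poly_def scaleR_sum_right power_mult_distrib
      power_add[symmetric] intro!: sum.cong)

lemma is_hom_continuous_on: "is_hom k H \<Longrightarrow> continuous_on S H"
  unfolding is_hom_def hom_poly_def by (auto intro!: continuous_intros)

lemma is_hom_big:
  assumes "is_hom k H"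
  shows "big_at0 k H"
proof -
  obtain c where c: "H = hom_poly k c" using assms by (auto simp: is_hom_def)
  have "norm (H u) \<le> (\<Sum>a\<le>k. norm (c a)) * norm u ^ k" for u
  proof -
    have "norm (H u) \<le> (\<Sum>a\<le>k. norm ((u $ 1 ^ a * u $ 2 ^ (k - a)) *\<^sub>R c a))"
      unfolding c hom_poly_def by (rule norm_sum)
    also have "\<dots> \<le> (\<Sum>a\<le>k. norm u ^ k * norm (c a))"
    proof (rule sum_mono)
      fix a assume "a \<in> {..k}"
      then have "norm u ^ k = norm u ^ a * norm u ^ (k - a)" by (simp add: power_add[symmetric])
      moreover have "\<bar>u $ 1\<bar> ^ a * \<bar>u $ 2\<bar> ^ (k - a) \<le> norm u ^ a * norm u ^ (k - a)"
        using component_le_norm_cart[of u] by (intro mult_mono power_mono) auto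
      ultimately show "norm ((u $ 1 ^ a * u $ 2 ^ (k - a)) *\<^sub>R c a) \<le> norm u ^ k * norm (c a)"
        by (simp add: abs_mult power_abs mult_right_mono)
    qed
    also have "\<dots> = (\<Sum>a\<le>k. norm (c a)) * norm u ^ k" by (subst sum_distrib_right) (simp only: mult.commute)
    finally show ?thesis .
  qed
  then show ?thesis unfolding big_at0_def by (intro exI always_eventually allI)
qed

text \<open>Both sides of the estimate scale by \<open>t ^ k\<close> along the ray through
  \<open>u\<close>, so a bound valid near 0 holds at \<open>u\<close> itself, for every
  \<open>e\<close>.\<close>

lemma is_hom_small_imp_zero:
  assumes "is_hom k H" "small_at0 k H"
  shows "H u = 0"
proof -
  have "norm (H u) \<le> e * norm u ^ k" if "e > 0" for e
  proof -
    obtain d where d: "d > 0" "\<And>u. norm u < d \<Longrightarrow> norm (H u) \<le> e * norm u ^ k"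
      using assms(2) \<open>e > 0\<close> by (auto simp: small_at0_def eventually_nhds_metric)
    define t where "t = d / (norm u + 1) / 2"
    have t: "t > 0" using d(1) by (simp add: t_def add_nonneg_pos)
    have "norm u + 1 \<noteq> 0" by (metis add_nonneg_pos less_irrefl norm_ge_zero zero_less_one)
    then have "t * (norm u + 1) = d / 2" by (simp only: t_def) (simp only: nonzero_eq_divide_eq times_divide_eq_left, simp)
    then have "t * (norm u + 1) < d" using d(1) by simp
    then have "norm (t *\<^sub>R u) < d" using t by (simp add: algebra_simps)
    from d(2)[OF this] have "t ^ k * norm (H u) \<le> t ^ k * (e * norm u ^ k)"
      using t by (simp add: is_hom_scale[OF assms(1)] power_mult_distrib algebra_simps)
    then show ?thesis using t by (simp add: mult_le_cancel_left)
  qed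
  then have *: "norm (H u) \<le> e * norm u ^ k" if "e > 0" for e using that by blast
  have "norm (H u) \<le> 0 + e" if "e > 0" for e
  proof -
    have "norm u ^ k + 1 > 0" by (simp add: add_nonneg_pos)
    then have "norm (H u) \<le> e / (norm u ^ k + 1) * norm u ^ k"
      using that by (intro * divide_pos_pos)
    also have "\<dots> \<le> e" using that \<open>norm u ^ k + 1 > 0\<close> by (simp add: field_simps)
    finally show ?thesis by simp
  qed
  then show ?thesis by (metis field_le_epsilon norm_le_zero_iff)
qed

lemma small_at0_tail:
  assumes "\<And>j. j \<in> J \<Longrightarrow> is_hom j (H j)" "\<And>j. j \<in> J \<Longrightarrow> q < j"
  shows "small_at0 q (\<lambda>u. \<Sum>j\<in>J. H j u)"
  using assms by (intro small_at0_sum big_at0_imp_small[OF is_hom_big]) auto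

text \<open>Strong induction on the degree: lower parts vanish already, higher parts are negligible
  at order \<open>j\<close>, so the part of degree \<open>j\<close> is itself small and hence
  zero.\<close>

lemma hom_sum_small_imp_zero:
  assumes "\<And>j. j \<in> {s..q} \<Longrightarrow> is_hom j (H j)" "small_at0 q (\<lambda>u. \<Sum>j=s..q. H j u)" "j \<in> {s..q}"
  shows "H j u = 0"
  using assms(3)
proof (induction j arbitrary: u rule: less_induct)
  case (less j)
  have eq: "(\<Sum>i=s..q. H i u) - (\<Sum>i\<in>{j<..q}. H i u) = H j u" for u
  proof -
    have "(\<Sum>i=s..q. H i u) = (\<Sum>i\<in>{s..<j} \<union> {j} \<union> {j<..q}. H i u)"
      using less.prems by (intro sum.cong) auto
    also have "\<dots> = H j u + (\<Sum>i\<in>{j<..q}. H i u)"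
      using less by (subst sum.union_disjoint) auto
    finally show ?thesis by simp
  qed
  have "small_at0 j (\<lambda>u. (\<Sum>i=s..q. H i u) - (\<Sum>i\<in>{j<..q}. H i u))"
    using less.prems assms(1) by (intro small_at0_diff small_at0_mono[OF assms(2)] small_at0_tail) auto
  then show ?case using is_hom_small_imp_zero[of j "H j"] assms(1) less.prems by (simp add: eq)
qed

section \<open>Leading terms of transported functions\<close>

text \<open>No bound on \<open>d' - H'\<close> is available, but at a maximum of \<open>t\<^sup>-\<^sup>k d(t u) - H(u) - |u - u\<^sub>0|\<^sup>2\<close>
  the derivatives of \<open>d\<close> and \<open>H\<close> agree up to the last term, and the maximum tends to \<open>u\<^sub>0\<close>.\<close>

lemma transport_limit_near:
  fixes d H G :: "real ^ 2 \<Rightarrow> real" and R L :: "real ^ 2 \<Rightarrow> real ^ 2"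
  assumes d: "\<forall>\<^sub>F u in nhds 0. (d has_derivative d' u) (at u)"
    and H: "\<And>u. (H has_derivative H' u) (at u)"
    and hom: "\<And>t u. H (t *\<^sub>R u) = t ^ k * H u" "\<And>t u. G (t *\<^sub>R u) = t ^ k * G u"
    and L: "bounded_linear L"
    and small: "small_at0 k (\<lambda>u. d u - H u)" "small_at0 k (\<lambda>u. d' u (R u) - G u)" "small_at0 1 (\<lambda>u. R u - L u)"
    and e: "e > 0"
  obtains u v where "norm (u - u0) \<le> e" "norm (v - L u) \<le> e" "\<bar>H' u v + 2 * ((u - u0) \<bullet> v) - G u\<bar> \<le> e"
proof -
  \<comment> \<open>\<open>K\<close> bounds the norm on the closed unit ball around
    \<open>u0\<close>. The bound \<open>e' \<le> 1/2\<close> keeps the maximum point off the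
    boundary of that ball, and \<open>s\<close> makes both \<open>s * K ^ k\<close> and
    \<open>s * K\<close> at most half of \<open>e'\<^sup>2\<close>, which is at most
    \<open>e\<close>.\<close>
  define K where "K = norm u0 + 1"
  define e' where "e' = min e (1/2)"
  define s where "s = e'\<^sup>2 / 2 / (K ^ k + K)"
  have K: "K \<ge> 1" "K ^ k > 0" by (auto simp: K_def add_nonneg_pos)
  have e': "0 < e'" "e' \<le> e" "e' \<le> 1/2" using e by (auto simp: e'_def)
  have "e' * e' \<le> e' * 1" using e' by (intro mult_left_mono) auto
  then have e2: "e'\<^sup>2 \<le> e" using e' unfolding power2_eq_square by linarith
  have s: "s > 0" using e' K by (auto simp: s_def intro!: divide_pos_pos add_pos_pos)
  have "K ^ k + K \<noteq> 0" using K by linarith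
  then have "s * (K ^ k + K) = e'\<^sup>2 / 2"
    unfolding s_def by (subst times_divide_eq_left, intro nonzero_mult_div_cancel_right)
  moreover have "s * K ^ k \<ge> 0" "s * K \<ge> 0" using s K by auto
  ultimately have sK: "s * K ^ k \<le> e'\<^sup>2 / 2" "s * K \<le> e'\<^sup>2 / 2"
    by (auto simp: distrib_left)
  have "\<forall>\<^sub>F u in nhds 0. (d has_derivative d' u) (at u) \<and> norm (d u - H u) \<le> s * norm u ^ k
      \<and> norm (d' u (R u) - G u) \<le> s * norm u ^ k \<and> norm (R u - L u) \<le> s * norm u ^ 1"
    using d small s unfolding small_at0_def by (auto intro!: eventually_conj)
  then obtain \<delta> where \<delta>: "\<delta> > 0" and near: "\<And>u. norm u < \<delta> \<Longrightarrow> (d has_derivative d' u) (at u) \<and> norm (d u - H u) \<le> s * norm u ^ k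
      \<and> norm (d' u (R u) - G u) \<le> s * norm u ^ k \<and> norm (R u - L u) \<le> s * norm u"
    by (auto simp: eventually_nhds_metric)
  \<comment> \<open>Shrinking by \<open>t\<close> moves all of \<open>cball u0 1\<close> into the
    neighbourhood where \<open>near\<close> applies.\<close>
  define t where "t = \<delta> / K / 2"
  have t: "t > 0" "t * K < \<delta>" using \<delta> K by (auto simp: t_def)
  have bnd: "norm (t *\<^sub>R u) < \<delta>" "norm u \<le> K" if "u \<in> cball u0 1" for u
  proof -
    show *: "norm u \<le> K" using that norm_triangle_sub[of u u0] by (simp add: K_def dist_norm norm_minus_commute)
    have "t * norm u \<le> t * K" using * t by simp
    moreover have "norm (t *\<^sub>R u) = t * norm u" using t by simp
    ultimately show "norm (t *\<^sub>R u) < \<delta>" using t by linarith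
  qed
  \<comment> \<open>By homogeneity of \<open>H\<close> the first two terms differ by at most
    \<open>s * K ^ k\<close> on the ball; the subtracted square then keeps every maximum point close
    to \<open>u0\<close>.\<close>
  define \<psi> where "\<psi> u = d (t *\<^sub>R u) / t ^ k - H u - (u - u0) \<bullet> (u - u0)" for u
  have \<psi>': "(\<psi> has_derivative (\<lambda>v. d' (t *\<^sub>R u) (t *\<^sub>R v) / t ^ k - H' u v - 2 * ((u - u0) \<bullet> v))) (at u)"
    if u: "u \<in> cball u0 1" for u
  proof -
    have "(d has_derivative d' (t *\<^sub>R u)) (at (t *\<^sub>R u))" using near[OF bnd(1)[OF u]] by blast
    moreover have "((\<lambda>u. t *\<^sub>R u) has_derivative (\<lambda>v. t *\<^sub>R v)) (at u)"
      by (intro derivative_eq_intros) auto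
    ultimately have *: "((\<lambda>u. d (t *\<^sub>R u)) has_derivative (\<lambda>v. d' (t *\<^sub>R u) (t *\<^sub>R v))) (at u)"
      using has_derivative_compose[of "\<lambda>u. t *\<^sub>R u" _ u UNIV d] by blast
    have **: "((\<lambda>u. (u - u0) \<bullet> (u - u0)) has_derivative (\<lambda>v. 2 * ((u - u0) \<bullet> v))) (at u)"
      by (auto intro!: derivative_eq_intros simp: inner_commute)
    show ?thesis unfolding \<psi>_def
      by (intro has_derivative_diff bounded_linear.has_derivative[OF bounded_linear_divide *] H **)
  qed
  have "continuous_on (cball u0 1) \<psi>"
    using \<psi>' has_derivative_continuous by (intro continuous_at_imp_continuous_on) blast
  then obtain u where u: "u \<in> cball u0 1" and max: "\<And>y. y \<in> cball u0 1 \<Longrightarrow> \<psi> y \<le> \<psi> u"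
    using continuous_attains_sup[of "cball u0 1" \<psi>] by auto
  have diff: "\<bar>d (t *\<^sub>R u) / t ^ k - H u\<bar> \<le> s * K ^ k" if u: "u \<in> cball u0 1" for u
  proof -
    have "\<bar>d (t *\<^sub>R u) - t ^ k * H u\<bar> \<le> s * (t ^ k * norm u ^ k)"
      using near[OF bnd(1)[OF u]] t by (simp add: hom power_mult_distrib)
    also have "\<dots> \<le> s * (t ^ k * K ^ k)"
      using s t bnd(2)[OF u] by (intro mult_left_mono power_mono) auto
    finally have "\<bar>d (t *\<^sub>R u) - t ^ k * H u\<bar> / t ^ k \<le> s * K ^ k" using t by (simp add: field_simps)
    moreover have "\<bar>d (t *\<^sub>R u) - t ^ k * H u\<bar> / t ^ k = \<bar>d (t *\<^sub>R u) / t ^ k - H u\<bar>"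
      using t by (subst abs_of_pos[of "t ^ k", symmetric]) (simp, simp add: abs_divide[symmetric] field_simps)
    ultimately show ?thesis by simp
  qed
  \<comment> \<open>Comparing \<psi> at \<open>u0\<close> and at the maximum point: the two
    approximation errors together are at most \<open>e'\<^sup>2\<close>, and they bound the
    penalty.\<close>
  have "(u - u0) \<bullet> (u - u0) \<le> e'\<^sup>2"
  proof -
    have "u0 \<in> cball u0 1" by simp
    from diff[OF this] diff[OF u] max[OF this] sK(1) show ?thesis by (simp add: \<psi>_def abs_le_iff)
  qed
  then have ue: "norm (u - u0) \<le> e'" using e' by (simp add: dot_square_norm power2_le_iff_abs_le)
  then have "u \<in> ball u0 1" using e' by (simp add: dist_norm norm_minus_commute)
  then have crit: "(\<lambda>v. d' (t *\<^sub>R u) (t *\<^sub>R v) / t ^ k - H' u v - 2 * ((u - u0) \<bullet> v)) = (\<lambda>v. 0)"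
    using max by (intro differential_zero_maxmin[OF _ open_ball \<psi>'[OF u]]) auto
  \<comment> \<open>\<open>v\<close> is the field \<open>R\<close> in the rescaled variable. As
    \<open>L\<close> is linear, \<open>v - L u\<close> is the error of \<open>R\<close> at
    \<open>t *\<^sub>R u\<close> divided by \<open>t\<close>.\<close>
  define v where "v = R (t *\<^sub>R u) /\<^sub>R t"
  have eq: "d' (t *\<^sub>R u) (R (t *\<^sub>R u)) / t ^ k = H' u v + 2 * ((u - u0) \<bullet> v)"
    using fun_cong[OF crit, of v] t by (simp add: v_def)
  have "\<bar>d' (t *\<^sub>R u) (R (t *\<^sub>R u)) - t ^ k * G u\<bar> \<le> s * (t ^ k * norm u ^ k)"
    using near[OF bnd(1)[OF u]] t by (simp add: hom power_mult_distrib)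
  also have "\<dots> \<le> s * (t ^ k * K ^ k)"
    using s t bnd(2)[OF u] by (intro mult_left_mono power_mono) auto
  finally have "\<bar>d' (t *\<^sub>R u) (R (t *\<^sub>R u)) - t ^ k * G u\<bar> / t ^ k \<le> s * K ^ k" using t by (simp add: field_simps)
  moreover have "\<bar>d' (t *\<^sub>R u) (R (t *\<^sub>R u)) - t ^ k * G u\<bar> / t ^ k = \<bar>d' (t *\<^sub>R u) (R (t *\<^sub>R u)) / t ^ k - G u\<bar>"
    using t by (subst abs_of_pos[of "t ^ k", symmetric]) (simp, simp add: abs_divide[symmetric] field_simps)
  ultimately have 3: "\<bar>H' u v + 2 * ((u - u0) \<bullet> v) - G u\<bar> \<le> e" using sK e2 e eq by simp
  have "L (t *\<^sub>R u) = t *\<^sub>R L u" using L by (simp add: linear_simps)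
  then have "v - L u = (R (t *\<^sub>R u) - L (t *\<^sub>R u)) /\<^sub>R t" using t by (simp add: v_def scaleR_diff_right)
  then have "norm (v - L u) = norm (R (t *\<^sub>R u) - L (t *\<^sub>R u)) / t" using t by (simp add: divide_inverse mult.commute)
  also have "\<dots> \<le> s * norm (t *\<^sub>R u) / t" using near[OF bnd(1)[OF u]] t by (intro divide_right_mono) auto
  also have "\<dots> = s * norm u" using t by simp
  also have "\<dots> \<le> s * K" using bnd(2)[OF u] s by simp
  finally have "norm (v - L u) \<le> e" using sK e2 e by simp
  with 3 ue e' show thesis by (intro that[of u v]) auto
qed

text \<open>Inner products with a fixed \<open>w\<close> reduce this to the scalar case. Tolerances
  \<open>1 / (n + 1)\<close> give points tending to \<open>u0\<close> and velocities tending to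
  \<open>L u0\<close>; the partial derivatives of \<open>H\<close> are homogeneous polynomials,
  hence continuous, so the relation passes to the limit.\<close>

lemma transport_limit:
  fixes d H G :: "real ^ 2 \<Rightarrow> 'b::real_inner" and R L :: "real ^ 2 \<Rightarrow> real ^ 2"
  assumes d: "\<forall>\<^sub>F u in nhds 0. (d has_derivative d' u) (at u)"
    and H: "is_hom k H" "is_hom k G"
    and L: "bounded_linear L"
    and small: "small_at0 k (\<lambda>u. d u - H u)" "small_at0 k (\<lambda>u. d' u (R u) - G u)" "small_at0 1 (\<lambda>u. R u - L u)"
    and H': "(H has_derivative H') (at u0)"
  shows "H' (L u0) = G u0"
proof -
  obtain g1 g2 where g: "is_hom (k - 1) g1" "is_hom (k - 1) g2"
    and Hd: "\<And>u. (H has_derivative (\<lambda>v. v $ 1 *\<^sub>R g1 u + v $ 2 *\<^sub>R g2 u)) (at u)"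
    using is_hom_has_derivative[OF H(1)] by blast
  have "w \<bullet> (L u0 $ 1 *\<^sub>R g1 u0 + L u0 $ 2 *\<^sub>R g2 u0) = w \<bullet> G u0" for w
  proof -
    have bl: "bounded_linear ((\<bullet>) w)" by (rule bounded_linear_inner_right)
    have Hwd: "((\<lambda>u. w \<bullet> H u) has_derivative (\<lambda>v. w \<bullet> (v $ 1 *\<^sub>R g1 u + v $ 2 *\<^sub>R g2 u))) (at u)" for u
      by (rule bounded_linear.has_derivative[OF bl Hd])
    have dwd: "\<forall>\<^sub>F u in nhds 0. ((\<lambda>u. w \<bullet> d u) has_derivative (\<lambda>v. w \<bullet> d' u v)) (at u)"
      using d by eventually_elim (rule bounded_linear.has_derivative[OF bl])
    have hom: "w \<bullet> H (t *\<^sub>R u) = t ^ k * (w \<bullet> H u)" "w \<bullet> G (t *\<^sub>R u) = t ^ k * (w \<bullet> G u)" for t u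
      by (simp_all add: is_hom_scale[OF H(1)] is_hom_scale[OF H(2)])
    have sm: "small_at0 k (\<lambda>u. w \<bullet> d u - w \<bullet> H u)" "small_at0 k (\<lambda>u. w \<bullet> d' u (R u) - w \<bullet> G u)"
      using small_at0_linear[OF bl small(1)] small_at0_linear[OF bl small(2)] by (simp_all add: inner_diff_right)
    define Q where "Q e p \<longleftrightarrow> norm (fst p - u0) \<le> e \<and> norm (snd p - L (fst p)) \<le> e \<and>
       \<bar>w \<bullet> (snd p $ 1 *\<^sub>R g1 (fst p) + snd p $ 2 *\<^sub>R g2 (fst p)) + 2 * ((fst p - u0) \<bullet> snd p) - w \<bullet> G (fst p)\<bar> \<le> e" for e p
    have "\<exists>p. Q e p" if "e > 0" for e
    proof (rule transport_limit_near[OF dwd Hwd hom L sm small(3) that, of u0])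
      fix u v
      assume "norm (u - u0) \<le> e" "norm (v - L u) \<le> e"
        "\<bar>w \<bullet> (v $ 1 *\<^sub>R g1 u + v $ 2 *\<^sub>R g2 u) + 2 * ((u - u0) \<bullet> v) - w \<bullet> G u\<bar> \<le> e"
      then show ?thesis unfolding Q_def by (intro exI[of _ "(u, v)"]) simp
    qed
    then have "\<forall>n. \<exists>p. Q (inverse (real (Suc n))) p" by simp
    from choice[OF this] obtain p where "\<forall>n. Q (inverse (real (Suc n))) (p n)" by blast
    then have p: "\<And>n. norm (fst (p n) - u0) \<le> inverse (real (Suc n))"
      "\<And>n. norm (snd (p n) - L (fst (p n))) \<le> inverse (real (Suc n))"
      "\<And>n. \<bar>w \<bullet> (snd (p n) $ 1 *\<^sub>R g1 (fst (p n)) + snd (p n) $ 2 *\<^sub>R g2 (fst (p n))) + 2 * ((fst (p n) - u0) \<bullet> snd (p n)) - w \<bullet> G (fst (p n))\<bar> \<le> inverse (real (Suc n))"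
      unfolding Q_def by blast+
    have u: "(\<lambda>n. fst (p n)) \<longlonglongrightarrow> u0"
      by (rule LIM_zero_cancel, rule Lim_null_comparison[OF _ LIMSEQ_inverse_real_of_nat])
        (intro always_eventually allI p(1))
    have "(\<lambda>n. snd (p n) - L (fst (p n))) \<longlonglongrightarrow> 0"
      by (rule Lim_null_comparison[OF _ LIMSEQ_inverse_real_of_nat]) (intro always_eventually allI p(2))
    moreover have "(\<lambda>n. L (fst (p n))) \<longlonglongrightarrow> L u0" by (rule bounded_linear.tendsto[OF L u])
    ultimately have v: "(\<lambda>n. snd (p n)) \<longlonglongrightarrow> L u0"
      using tendsto_add by fastforce
    have cont: "(\<lambda>n. F (fst (p n))) \<longlonglongrightarrow> F u0" if "is_hom j F" for j and F :: "real^2 \<Rightarrow> 'b"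
      by (rule isCont_tendsto_compose[OF _ u])
        (use is_hom_continuous_on[OF that, of UNIV] in \<open>simp add: continuous_on_eq_continuous_at\<close>)
    have lim: "(\<lambda>n. w \<bullet> (snd (p n) $ 1 *\<^sub>R g1 (fst (p n)) + snd (p n) $ 2 *\<^sub>R g2 (fst (p n))) + 2 * ((fst (p n) - u0) \<bullet> snd (p n)) - w \<bullet> G (fst (p n)))
        \<longlonglongrightarrow> w \<bullet> (L u0 $ 1 *\<^sub>R g1 u0 + L u0 $ 2 *\<^sub>R g2 u0) + 2 * ((u0 - u0) \<bullet> L u0) - w \<bullet> G u0"
      by (intro tendsto_intros u v cont[OF g(1)] cont[OF g(2)] cont[OF H(2)])
    have lim0: "(\<lambda>n. w \<bullet> (snd (p n) $ 1 *\<^sub>R g1 (fst (p n)) + snd (p n) $ 2 *\<^sub>R g2 (fst (p n))) + 2 * ((fst (p n) - u0) \<bullet> snd (p n)) - w \<bullet> G (fst (p n))) \<longlonglongrightarrow> 0"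
      by (rule Lim_null_comparison[OF _ LIMSEQ_inverse_real_of_nat])
        (unfold real_norm_def, intro always_eventually allI p(3))
    show ?thesis using LIMSEQ_unique[OF lim lim0] by simp
  qed
  then have "L u0 $ 1 *\<^sub>R g1 u0 + L u0 $ 2 *\<^sub>R g2 u0 = G u0" by (metis vector_eq_ldot)
  then show ?thesis using has_derivative_unique[OF H' Hd[of u0]] by simp
qed

text \<open>The homogeneous parts depend on \<open>z\<close> only through the parameter
  \<open>fst z\<close>. Taking \<open>z\<close> to consist of a parameter and a manifold, one smooth
  expansion serves all manifolds over the same parameter; the error estimate is pointwise in
  \<open>z\<close>, with no uniformity.\<close>

definition expands ::
    "nat \<Rightarrow> real set \<Rightarrow> (real \<times> 'w) set \<Rightarrow> nat \<Rightarrow> nat \<Rightarrow> (real \<times> 'w \<Rightarrow> real ^ 2 \<Rightarrow> 'b::real_normed_vector) \<Rightarrow> bool" where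
  "expands r V \<Omega> s q p \<longleftrightarrow> (\<exists>h. (\<forall>j. hom_family r V j (h j)) \<and>
     (\<forall>z\<in>\<Omega>. small_at0 q (\<lambda>u. p z u - (\<Sum>j=s..q. h j u (fst z)))))"

context
  fixes r :: nat and V :: "real set" and \<Omega> :: "(real \<times> 'w) set"
  assumes V: "open V" and dom: "\<forall>z\<in>\<Omega>. fst z \<in> V"
begin

private lemma \<Omega>: "z \<in> \<Omega> \<Longrightarrow> fst z \<in> V"
  using dom by blast

lemma expands_cong:
  "(\<And>z. z \<in> \<Omega> \<Longrightarrow> \<forall>\<^sub>F u in nhds 0. p z u = p' z u) \<Longrightarrow> expands r V \<Omega> s q p \<Longrightarrow> expands r V \<Omega> s q p'"
  unfolding expands_def by (elim exE conjE, intro exI conjI ballI, assumption)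
    (rule small_at0_cong[rotated], auto elim!: eventually_mono)

lemma expands_small: "(\<And>z. z \<in> \<Omega> \<Longrightarrow> small_at0 q (p z)) \<Longrightarrow> expands r V \<Omega> s q p"
  unfolding expands_def by (intro exI[of _ "\<lambda>j u \<mu>. 0"]) (auto intro: hom_family_zero)

lemma expands_add:
  assumes "expands r V \<Omega> s q p" "expands r V \<Omega> s q p'"
  shows "expands r V \<Omega> s q (\<lambda>z u. p z u + p' z u)"
proof -
  obtain h h' where h: "\<And>j. hom_family r V j (h j)" "\<And>z. z \<in> \<Omega> \<Longrightarrow> small_at0 q (\<lambda>u. p z u - (\<Sum>j=s..q. h j u (fst z)))"
    "\<And>j. hom_family r V j (h' j)" "\<And>z. z \<in> \<Omega> \<Longrightarrow> small_at0 q (\<lambda>u. p' z u - (\<Sum>j=s..q. h' j u (fst z)))"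
    using assms unfolding expands_def by blast
  have "small_at0 q (\<lambda>u. p z u + p' z u - (\<Sum>j=s..q. h j u (fst z) + h' j u (fst z)))" if "z \<in> \<Omega>" for z
    using small_at0_add[OF h(2)[OF that] h(4)[OF that]] by (simp add: sum.distrib algebra_simps)
  then show ?thesis unfolding expands_def
    using h by (intro exI[of _ "\<lambda>j u \<mu>. h j u \<mu> + h' j u \<mu>"]) (auto intro: hom_family_add V)
qed

lemma expands_sum:
  "(\<And>i. i \<in> I \<Longrightarrow> expands r V \<Omega> s q (p i)) \<Longrightarrow> expands r V \<Omega> s q (\<lambda>z u. \<Sum>i\<in>I. p i z u)"
  by (induction I rule: infinite_finite_induct) (auto intro: expands_small expands_add)

lemma expands_linear:
  assumes "bounded_linear L" "expands r V \<Omega> s q p"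
  shows "expands r V \<Omega> s q (\<lambda>z u. L (p z u))"
proof -
  obtain h where h: "\<And>j. hom_family r V j (h j)" "\<And>z. z \<in> \<Omega> \<Longrightarrow> small_at0 q (\<lambda>u. p z u - (\<Sum>j=s..q. h j u (fst z)))"
    using assms(2) unfolding expands_def by blast
  interpret bounded_linear L by fact
  have "small_at0 q (\<lambda>u. L (p z u) - (\<Sum>j=s..q. L (h j u (fst z))))" if "z \<in> \<Omega>" for z
    using small_at0_linear[OF assms(1) h(2)[OF that]] by (simp add: diff sum)
  then show ?thesis unfolding expands_def
    using h by (intro exI[of _ "\<lambda>j u \<mu>. L (h j u \<mu>)"]) (auto intro: hom_family_linear V assms(1))
qed

lemma expands_diff:
  "expands r V \<Omega> s q p \<Longrightarrow> expands r V \<Omega> s q p' \<Longrightarrow> expands r V \<Omega> s q (\<lambda>z u. p z u - p' z u)"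
  using expands_add[of s q p "\<lambda>z u. - p' z u"]
    expands_linear[OF bounded_linear_minus[OF bounded_linear_ident], of s q p'] by simp

lemma expands_weaken:
  assumes "expands r V \<Omega> s q p" "s' \<le> s" "q' \<le> q"
  shows "expands r V \<Omega> s' q' p"
proof -
  obtain h where h: "\<And>j. hom_family r V j (h j)" "\<And>z. z \<in> \<Omega> \<Longrightarrow> small_at0 q (\<lambda>u. p z u - (\<Sum>j=s..q. h j u (fst z)))"
    using assms(1) unfolding expands_def by blast
  \<comment> \<open>Degrees below \<open>s\<close> get the coefficient 0, since the wider sum now
    includes them; degrees above \<open>q'\<close> go into the error.\<close>
  define g where "g j = (if j < s then (\<lambda>u \<mu>. 0) else h j)" for j
  have g: "hom_family r V j (g j)" for j using h(1) hom_family_zero by (auto simp: g_def)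
  have "small_at0 q' (\<lambda>u. p z u - (\<Sum>j=s'..q'. g j u (fst z)))" if "z \<in> \<Omega>" for z
  proof -
    have "(\<Sum>j=s..q. h j u (fst z)) - (\<Sum>j=s'..q'. g j u (fst z)) = (\<Sum>j\<in>{j\<in>{s..q}. q' < j}. g j u (fst z))" for u
    proof -
      have "(\<Sum>j=s..q. h j u (fst z)) = (\<Sum>j=s'..q. g j u (fst z))"
        using assms(2) by (intro sum.mono_neutral_cong_left) (auto simp: g_def)
      also have "\<dots> = (\<Sum>j\<in>{s'..q'} \<union> {j\<in>{s'..q}. q' < j}. g j u (fst z))"
        using assms by (intro sum.mono_neutral_cong_left) (auto simp: g_def)
      also have "\<dots> = (\<Sum>j=s'..q'. g j u (fst z)) + (\<Sum>j\<in>{j\<in>{s'..q}. q' < j}. g j u (fst z))"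
        by (intro sum.union_disjoint) auto
      also have "(\<Sum>j\<in>{j\<in>{s'..q}. q' < j}. g j u (fst z)) = (\<Sum>j\<in>{j\<in>{s..q}. q' < j}. g j u (fst z))"
        using assms by (intro sum.mono_neutral_cong_right) (auto simp: g_def)
      finally show ?thesis by simp
    qed
    moreover have "small_at0 q' (\<lambda>u. \<Sum>j\<in>{j\<in>{s..q}. q' < j}. g j u (fst z))"
      using hom_family_imp_is_hom[OF g \<Omega>[OF that]] by (intro small_at0_tail) auto
    ultimately have "small_at0 q' (\<lambda>u. (p z u - (\<Sum>j=s..q. h j u (fst z))) + ((\<Sum>j=s..q. h j u (fst z)) - (\<Sum>j=s'..q'. g j u (fst z))))"
      using small_at0_add[OF small_at0_mono[OF h(2)[OF that] assms(3)]] by (simp only:)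
    then show ?thesis by (simp only: diff_add_eq diff_add_cancel add_diff_eq add_diff_cancel_right')
  qed
  with g show ?thesis unfolding expands_def by blast
qed

lemma expands_hom_family:
  assumes "hom_family r V k h" "s \<le> k"
  shows "expands r V \<Omega> s q (\<lambda>z u. h u (fst z))"
proof -
  have "small_at0 q (\<lambda>u. h u (fst z) - (\<Sum>j=s..q. if j = k then h u (fst z) else 0))" if "z \<in> \<Omega>" for z
  proof (cases "k \<le> q")
    case False
    then show ?thesis using big_at0_imp_small[OF is_hom_big[OF hom_family_imp_is_hom[OF assms(1) \<Omega>[OF that]]]] by simp
  qed (use assms in simp)
  moreover have "hom_family r V j (\<lambda>u \<mu>. if j = k then h u \<mu> else 0)" for j
    using assms(1) by (cases "j = k") (auto intro: hom_family_zero)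
  ultimately show ?thesis unfolding expands_def
    by (intro exI[of _ "\<lambda>j u \<mu>. if j = k then h u \<mu> else 0"]) blast
qed

lemma expands_const: "C_k_on r c V \<Longrightarrow> expands r V \<Omega> 0 q (\<lambda>z u. c (fst z))"
  using expands_hom_family[OF hom_family_const] by blast

lemma expands_big:
  assumes "expands r V \<Omega> s q p" "s \<le> q" "z \<in> \<Omega>"
  shows "big_at0 s (p z)"
proof -
  obtain h where h: "\<And>j. hom_family r V j (h j)" "small_at0 q (\<lambda>u. p z u - (\<Sum>j=s..q. h j u (fst z)))"
    using assms unfolding expands_def by blast
  have "big_at0 s (\<lambda>u. (p z u - (\<Sum>j=s..q. h j u (fst z))) + (\<Sum>j=s..q. h j u (fst z)))"
    by (intro big_at0_add big_at0_sum big_at0_mono[OF small_at0_imp_big[OF h(2)] assms(2)]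
        big_at0_mono[OF is_hom_big[OF hom_family_imp_is_hom[OF h(1) \<Omega>[OF assms(3)]]]]) auto
  then show ?thesis by simp
qed

text \<open>An error of order \<open>q\<close> multiplied by a factor vanishing to order
  \<open>s'\<close> improves to order \<open>q + s'\<close>, and symmetrically. This improvement is
  the source of the extra order of the reduced dynamics.\<close>

lemma expands_bilinear:
  assumes bil: "bounded_bilinear bil" and p: "expands r V \<Omega> s q p" "s \<le> q" and p': "expands r V \<Omega> s' q' p'" "s' \<le> q'"
  shows "expands r V \<Omega> (s + s') (min (q + s') (q' + s)) (\<lambda>z u. bil (p z u) (p' z u))"
proof -
  obtain h where h: "\<And>j. hom_family r V j (h j)" "\<And>z. z \<in> \<Omega> \<Longrightarrow> small_at0 q (\<lambda>u. p z u - (\<Sum>j=s..q. h j u (fst z)))"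
    using p(1) unfolding expands_def by blast
  obtain h' where h': "\<And>j. hom_family r V j (h' j)" "\<And>z. z \<in> \<Omega> \<Longrightarrow> small_at0 q' (\<lambda>u. p' z u - (\<Sum>j=s'..q'. h' j u (fst z)))"
    using p'(1) unfolding expands_def by blast
  interpret bounded_bilinear bil by fact
  define I where "I = {s..q} \<times> {s'..q'}"
  define Q where "Q = min (q + s') (q' + s)"
  define g where "g n u \<mu> = (\<Sum>x\<in>{x\<in>I. fst x + snd x = n}. bil (h (fst x) u \<mu>) (h' (snd x) u \<mu>))" for n u \<mu>
  have finI: "finite I" by (simp add: I_def)
  have t: "hom_family r V (fst x + snd x) (\<lambda>u \<mu>. bil (h (fst x) u \<mu>) (h' (snd x) u \<mu>))" for x
    by (intro hom_family_bilinear V bil h h')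
  have g: "hom_family r V n (g n)" for n
    unfolding g_def using t by (intro hom_family_sum V) auto
  have "small_at0 Q (\<lambda>u. bil (p z u) (p' z u) - (\<Sum>n=s+s'..Q. g n u (fst z)))" if z: "z \<in> \<Omega>" for z
  proof -
    let ?S = "\<lambda>u. \<Sum>j=s..q. h j u (fst z)" and ?S' = "\<lambda>u. \<Sum>j=s'..q'. h' j u (fst z)"
    have bigS: "big_at0 s ?S"
      by (intro big_at0_sum big_at0_mono[OF is_hom_big[OF hom_family_imp_is_hom[OF h(1) \<Omega>[OF z]]]]) auto
    \<comment> \<open>The error of the product is split as
      \<open>bil (p - S) p' + bil S (p' - S')\<close>, where \<open>S\<close> and \<open>S'\<close>
      are the partial sums.\<close>
    have "small_at0 (q + s') (\<lambda>u. bil (p z u - ?S u) (p' z u))"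
      by (rule small_at0_bilinear[OF bil h(2)[OF z] expands_big[OF p' z]])
    moreover have "small_at0 (s + q') (\<lambda>u. bil (?S u) (p' z u - ?S' u))"
      by (rule small_at0_bilinear_right[OF bil bigS h'(2)[OF z]])
    ultimately have 1: "small_at0 Q (\<lambda>u. bil (p z u - ?S u) (p' z u) + bil (?S u) (p' z u - ?S' u))"
      unfolding Q_def by (intro small_at0_add; elim small_at0_mono) auto
    have 2: "small_at0 Q (\<lambda>u. \<Sum>x\<in>{x\<in>I. Q < fst x + snd x}. bil (h (fst x) u (fst z)) (h' (snd x) u (fst z)))"
      by (intro small_at0_sum) (auto intro!: big_at0_imp_small[OF is_hom_big[OF hom_family_imp_is_hom[OF t \<Omega>[OF z]]]])
    have 3: "bil (?S u) (?S' u) = (\<Sum>n=s+s'..Q. g n u (fst z)) + (\<Sum>x\<in>{x\<in>I. Q < fst x + snd x}. bil (h (fst x) u (fst z)) (h' (snd x) u (fst z)))" for u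
    proof -
      let ?f = "\<lambda>x. bil (h (fst x) u (fst z)) (h' (snd x) u (fst z))"
      have "bil (?S u) (?S' u) = (\<Sum>x\<in>I. ?f x)"
        unfolding I_def by (simp only: sum_left) (simp add: sum_right sum.cartesian_product split_beta)
      also have "\<dots> = (\<Sum>x\<in>{x\<in>I. fst x + snd x \<le> Q}. ?f x) + (\<Sum>x\<in>{x\<in>I. Q < fst x + snd x}. ?f x)"
        by (subst sum.union_disjoint[symmetric]) (auto simp: finI intro!: sum.cong)
      also have "(\<Sum>x\<in>{x\<in>I. fst x + snd x \<le> Q}. ?f x) = (\<Sum>n=s+s'..Q. g n u (fst z))"
      proof -
        have "(\<Sum>n=s+s'..Q. g n u (fst z)) = (\<Sum>n=s+s'..Q. \<Sum>x\<in>{x. x \<in> {x\<in>I. fst x + snd x \<le> Q} \<and> fst x + snd x = n}. ?f x)"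
          unfolding g_def by (intro sum.cong refl) auto
        also have "\<dots> = (\<Sum>x\<in>{x\<in>I. fst x + snd x \<le> Q}. ?f x)"
          using finI by (intro sum.group) (auto simp: I_def)
        finally show ?thesis by simp
      qed
      finally show ?thesis .
    qed
    show ?thesis
      by (rule small_at0_cong[OF _ small_at0_add[OF 1 2]]) (simp add: diff_left diff_right 3[symmetric] always_eventually, simp add: 3 algebra_simps)
  qed
  with g show ?thesis unfolding expands_def Q_def by blast
qed

text \<open>Each factor starts at order 1, so every further factor raises the accuracy by one; the
  count \<open>q - 1 + mdeg k\<close> starts from a single factor of accuracy
  \<open>q\<close>.\<close>

lemma expands_prod:
  fixes p :: "'i::finite \<Rightarrow> real \<times> 'w \<Rightarrow> real ^ 2 \<Rightarrow> real"
  assumes "\<And>i. expands r V \<Omega> 1 q (p i)" "1 \<le> q"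
  shows "expands r V \<Omega> (mdeg k) (q - 1 + mdeg k) (\<lambda>z u. \<Prod>i\<in>UNIV. p i z u ^ k i)"
proof -
  have pow: "expands r V \<Omega> n (q - 1 + n) (\<lambda>z u. p i z u ^ n)" for i n
  proof (induction n)
    case 0
    then show ?case using expands_const[OF C_k_on_const[of r 1 V]] by simp
  next
    case (Suc n)
    from expands_bilinear[OF bounded_bilinear_mult assms(1)[of i] assms(2) Suc] assms(2)
    show ?case by (simp add: min_def split: if_splits)
  qed
  have "expands r V \<Omega> (\<Sum>i\<in>I. k i) (q - 1 + (\<Sum>i\<in>I. k i)) (\<lambda>z u. \<Prod>i\<in>I. p i z u ^ k i)" if "finite I" for I
    using that
  proof induction
    case empty
    then show ?case using expands_const[OF C_k_on_const[of r 1 V]] by simp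
  next
    case (insert i I)
    from expands_bilinear[OF bounded_bilinear_mult pow[of "k i" i] _ insert.IH] insert.hyps
    show ?case by (simp add: min_def algebra_simps split: if_splits)
  qed
  from this[of UNIV] show ?thesis by (simp add: mdeg_def)
qed

end

section \<open>Generalized eigenspaces and the spectral projection\<close>

lemma mat_mult_vec: "mat c *v x = c *s (x::'a::comm_semiring_1 ^ 'n)"
  by (simp add: mat_def matrix_vector_mult_def vec_eq_iff if_distrib if_distribR sum.delta' cong: if_cong)

lemma sub_mat_mult_vec: "(B - mat z) *v v = B *v v - z *s (v::'a::comm_ring_1 ^ 'n)"
  by (simp add: matrix_vector_mult_diff_rdistrib mat_mult_vec)

definition gen_eigenspace :: "complex ^ 'n ^ 'n::finite \<Rightarrow> complex \<Rightarrow> (complex ^ 'n) set" where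
  "gen_eigenspace B z = {v. \<exists>p. (((*v) (B - mat z)) ^^ p) v = 0}"

lemma matrix_funpow_add:
  fixes B :: "complex ^ 'n ^ 'n::finite"
  shows "((*v) B ^^ p) (u + v) = ((*v) B ^^ p) u + ((*v) B ^^ p) v"
  by (induction p) (simp_all add: matrix_vector_right_distrib)

lemma matrix_funpow_scale:
  fixes B :: "complex ^ 'n ^ 'n::finite"
  shows "((*v) B ^^ p) (c *s v) = c *s ((*v) B ^^ p) v"
  by (induction p) (simp_all add: vector_scalar_commute)

lemma matrix_funpow_zero:
  fixes B :: "complex ^ 'n ^ 'n::finite"
  shows "((*v) B ^^ p) 0 = 0"
  by (induction p) simp_all

lemma subspace_gen_eigenspace: "vec.subspace (gen_eigenspace B z)"
proof (rule vec.subspaceI)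
  show "0 \<in> gen_eigenspace B z" by (auto simp: gen_eigenspace_def matrix_funpow_zero)
next
  fix u v assume "u \<in> gen_eigenspace B z" "v \<in> gen_eigenspace B z"
  then obtain p q where p: "((*v) (B - mat z) ^^ p) u = 0" and q: "((*v) (B - mat z) ^^ q) v = 0"
    by (auto simp: gen_eigenspace_def)
  have "((*v) (B - mat z) ^^ (q + p)) u = 0"
    by (simp only: funpow_add o_apply p matrix_funpow_zero)
  moreover have "((*v) (B - mat z) ^^ (q + p)) v = 0"
    by (simp only: add.commute[of q p] funpow_add o_apply q matrix_funpow_zero)
  ultimately show "u + v \<in> gen_eigenspace B z"
    unfolding gen_eigenspace_def by (auto simp: matrix_funpow_add intro!: exI[of _ "q + p"])
next
  fix c v assume "v \<in> gen_eigenspace B z"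
  then show "c *s v \<in> gen_eigenspace B z" by (auto simp: gen_eigenspace_def matrix_funpow_scale)
qed

lemma gen_eigenspace_invariant:
  assumes "v \<in> gen_eigenspace B z"
  shows "B *v v \<in> gen_eigenspace B z"
proof -
  obtain p where "((*v) (B - mat z) ^^ p) v = 0" using assms by (auto simp: gen_eigenspace_def)
  then have "((*v) (B - mat z) ^^ p) ((B - mat z) *v v) = 0"
    by (metis funpow_swap1 matrix_vector_mult_0_right)
  then have "(B - mat z) *v v \<in> gen_eigenspace B z" by (auto simp: gen_eigenspace_def)
  moreover have "B *v v = (B - mat z) *v v + z *s v" by (simp add: sub_mat_mult_vec)
  ultimately show ?thesis
    using assms vec.subspace_add[OF subspace_gen_eigenspace] vec.subspace_scale[OF subspace_gen_eigenspace] by metis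
qed

lemma eigenvector_in_gen_eigenspace: "(B - mat z) *v v = 0 \<Longrightarrow> v \<in> gen_eigenspace B z"
  unfolding gen_eigenspace_def by (auto intro!: exI[of _ 1])

text \<open>\<open>B - z\<close> is the invertible scalar \<open>y - z\<close> plus the nilpotent
  \<open>B - y\<close>, so its Neumann series terminates. The induction peels off one term:
  \<open>v1\<close> solves the scalar part, and the remainder \<open>(B - y) v1\<close> is killed by
  one power less.\<close>

lemma gen_eigenspace_solve:
  assumes "y \<noteq> z" "((*v) (B - mat y) ^^ p) w = 0"
  shows "\<exists>v\<in>gen_eigenspace B y. (B - mat z) *v v = w"
  using assms(2)
proof (induction p arbitrary: w)
  case 0
  then show ?case by (auto intro!: bexI[of _ 0] vec.subspace_0[OF subspace_gen_eigenspace])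
next
  case (Suc p)
  define v1 where "v1 = inverse (y - z) *s w"
  have w: "w \<in> gen_eigenspace B y" using Suc.prems unfolding gen_eigenspace_def by blast
  have "((*v) (B - mat y) ^^ p) ((B - mat y) *v w) = 0" using Suc.prems by (simp add: funpow_swap1)
  then have "((*v) (B - mat y) ^^ p) ((B - mat y) *v v1) = 0"
    by (simp add: v1_def vector_scalar_commute matrix_funpow_scale)
  from Suc.IH[OF this] obtain v2 where v2: "v2 \<in> gen_eigenspace B y" "(B - mat z) *v v2 = (B - mat y) *v v1" by blast
  have "(B - mat z) *v v1 = (B - mat y) *v v1 + (y - z) *s v1"
    by (simp add: sub_mat_mult_vec vec.scale_left_diff_distrib)
  also have "(y - z) *s v1 = w" using assms(1) by (simp add: v1_def vector_smult_assoc)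
  finally have "(B - mat z) *v (v1 - v2) = w" using v2 by (simp add: matrix_vector_mult_diff_distrib)
  moreover have "v1 - v2 \<in> gen_eigenspace B y"
    unfolding v1_def using w v2(1)
    by (intro vec.subspace_diff[OF subspace_gen_eigenspace] vec.subspace_scale[OF subspace_gen_eigenspace])
  ultimately show ?case by blast
qed

text \<open>Up to an error in the generalized eigenspace of \<open>z\<close>, the image
  \<open>(B - z) v\<close> equals \<open>(B - z) v'\<close> with \<open>v'\<close> in the span. Then
  \<open>v' - v\<close> is annihilated by a power of \<open>B - z\<close>, hence lies in the span
  too.\<close>

lemma span_gen_eigenspaces_step:
  assumes "(B - mat z) *v v \<in> vec.span (\<Union>z. gen_eigenspace B z)"
  shows "v \<in> vec.span (\<Union>z. gen_eigenspace B z)"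
proof -
  let ?Y = "vec.span (\<Union>z. gen_eigenspace B z)"
  \<comment> \<open>Generators belonging to \<open>z\<close> are absorbed by the error with
    \<open>v' = 0\<close>; all others are solved exactly by
    \<open>gen_eigenspace_solve\<close>.\<close>
  have "\<exists>v'\<in>?Y. (B - mat z) *v v' - w \<in> gen_eigenspace B z" if "w \<in> ?Y" for w
    using that
  proof (induction rule: vec.span_induct_alt)
    case base
    show ?case using vec.subspace_0[OF subspace_gen_eigenspace[of B z]] by (intro bexI[of _ 0] vec.span_zero) simp
  next
    case (step c x y)
    then obtain y' x0 where y': "y' \<in> ?Y" "(B - mat z) *v y' - y \<in> gen_eigenspace B z" and x0: "x \<in> gen_eigenspace B x0"
      by blast
    have "\<exists>x'\<in>?Y. (B - mat z) *v x' - x \<in> gen_eigenspace B z"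
    proof (cases "x0 = z")
      case True
      then show ?thesis
        using x0 vec.subspace_neg[OF subspace_gen_eigenspace] by (intro bexI[of _ 0] vec.span_zero) simp
    next
      case False
      from x0 obtain p where "((*v) (B - mat x0) ^^ p) x = 0" by (auto simp: gen_eigenspace_def)
      from gen_eigenspace_solve[OF False this] obtain x' where "x' \<in> gen_eigenspace B x0" "(B - mat z) *v x' = x"
        by blast
      then show ?thesis
        using vec.subspace_0[OF subspace_gen_eigenspace[of B z]] by (intro bexI[of _ x'] vec.span_base) auto
    qed
    then obtain x' where x': "x' \<in> ?Y" "(B - mat z) *v x' - x \<in> gen_eigenspace B z" by blast
    have "(B - mat z) *v (c *s x' + y') - (c *s x + y) = c *s ((B - mat z) *v x' - x) + ((B - mat z) *v y' - y)"
      by (simp add: matrix_vector_right_distrib vector_scalar_commute vec.scale_right_diff_distrib)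
    also have "\<dots> \<in> gen_eigenspace B z"
      using x' y' by (intro vec.subspace_add[OF subspace_gen_eigenspace] vec.subspace_scale[OF subspace_gen_eigenspace])
    finally show ?case
      using x' y' by (intro bexI[of _ "c *s x' + y'"] vec.span_add vec.span_scale)
  qed
  from this[OF assms] obtain v' where v': "v' \<in> ?Y" "(B - mat z) *v v' - (B - mat z) *v v \<in> gen_eigenspace B z" by blast
  then have "(B - mat z) *v (v' - v) \<in> gen_eigenspace B z" by (simp add: matrix_vector_mult_diff_distrib)
  then obtain p where "((*v) (B - mat z) ^^ p) ((B - mat z) *v (v' - v)) = 0" by (auto simp: gen_eigenspace_def)
  then have "((*v) (B - mat z) ^^ Suc p) (v' - v) = 0" by (simp add: funpow_swap1)
  then have "v' - v \<in> gen_eigenspace B z" unfolding gen_eigenspace_def by blast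
  then have "v' - v \<in> ?Y" by (intro vec.span_base UN_I UNIV_I)
  from vec.span_diff[OF v'(1) this] show ?thesis by simp
qed

text \<open>The vector \<open>p(B) v\<close>, computed from the iterates of \<open>B\<close> on
  \<open>v\<close> without introducing matrix polynomials.\<close>

definition poly_action :: "complex ^ 'n ^ 'n::finite \<Rightarrow> complex poly \<Rightarrow> complex ^ 'n \<Rightarrow> complex ^ 'n" where
  "poly_action B p v = (\<Sum>i\<le>degree p. coeff p i *s ((*v) B ^^ i) v)"

lemma poly_action_eq:
  assumes "degree p \<le> N"
  shows "poly_action B p v = (\<Sum>i\<le>N. coeff p i *s ((*v) B ^^ i) v)"
  unfolding poly_action_def using assms by (intro sum.mono_neutral_left) (auto simp: coeff_eq_0)

lemma poly_action_linear_factor: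
  "poly_action B ([:-z, 1:] * q) v = poly_action B q ((B - mat z) *v v)"
proof -
  define N where "N = degree q"
  have "degree ([:-z, 1:] * q) \<le> Suc N" using degree_mult_le[of "[:-z, 1:]" q] by (simp add: N_def)
  then have "poly_action B ([:-z, 1:] * q) v = (\<Sum>i\<le>Suc N. coeff ([:-z, 1:] * q) i *s ((*v) B ^^ i) v)"
    by (rule poly_action_eq)
  also have "\<dots> = (\<Sum>i\<le>Suc N. (- z * coeff q i) *s ((*v) B ^^ i) v + (case i of 0 \<Rightarrow> 0 | Suc j \<Rightarrow> coeff q j) *s ((*v) B ^^ i) v)"
    by (intro sum.cong refl) (simp add: coeff_pCons vec.scale_left_distrib vec.scale_left_diff_distrib split: nat.split)
  also have "\<dots> = (\<Sum>i\<le>Suc N. (- z * coeff q i) *s ((*v) B ^^ i) v) + (\<Sum>i\<le>N. coeff q i *s ((*v) B ^^ Suc i) v)"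
    by (simp only: sum.distrib sum.atMost_Suc_shift[of "\<lambda>i. (case i of 0 \<Rightarrow> 0 | Suc j \<Rightarrow> coeff q j) *s ((*v) B ^^ i) v"]) simp
  also have "(\<Sum>i\<le>Suc N. (- z * coeff q i) *s ((*v) B ^^ i) v) = (\<Sum>i\<le>N. (- z * coeff q i) *s ((*v) B ^^ i) v)"
    by (simp add: coeff_eq_0 N_def)
  also have "\<dots> + (\<Sum>i\<le>N. coeff q i *s ((*v) B ^^ Suc i) v) = (\<Sum>i\<le>N. coeff q i *s ((*v) B ^^ i) ((B - mat z) *v v))"
    unfolding sum.distrib[symmetric]
  proof (intro sum.cong refl)
    fix i
    have "((*v) B ^^ i) ((B - mat z) *v v) = ((*v) B ^^ i) (B *v v) + (- z) *s ((*v) B ^^ i) v"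
      by (simp add: sub_mat_mult_vec matrix_funpow_add[symmetric] matrix_funpow_scale[symmetric] del: vec.scale_minus_left)
        (simp add: vec.scale_minus_left)
    then show "(- z * coeff q i) *s ((*v) B ^^ i) v + coeff q i *s ((*v) B ^^ Suc i) v = coeff q i *s ((*v) B ^^ i) ((B - mat z) *v v)"
      by (simp add: matrix_funpow_scale funpow_swap1 vec.scale_right_distrib vec.scale_right_diff_distrib vector_smult_assoc mult.commute)
  qed
  also have "\<dots> = poly_action B q ((B - mat z) *v v)" by (simp add: poly_action_def N_def)
  finally show ?thesis .
qed

text \<open>Induction on the degree: a complex root of \<open>q\<close> splits off a linear factor,
  which is moved onto the vector, and \<open>span_gen_eigenspaces_step\<close> removes it
  again.\<close>

lemma poly_action_zero_imp_in_span:
  assumes "q \<noteq> 0" "poly_action B q v = 0"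
  shows "v \<in> vec.span (\<Union>z. gen_eigenspace B z)"
  using assms
proof (induction "degree q" arbitrary: q v)
  case 0
  then obtain c where "q = [:c:]" "c \<noteq> 0" by (metis degree_eq_zeroE pCons_0_0)
  with 0 have "v = 0" by (simp add: poly_action_def)
  then show ?case by (simp add: vec.span_zero)
next
  case (Suc n)
  have "\<not> constant (poly q)" using Suc.hyps(2) by (simp add: constant_degree)
  then obtain z where "poly q z = 0" using fundamental_theorem_of_algebra by blast
  then obtain q' where q': "q = [:-z, 1:] * q'" by (metis poly_eq_0_iff_dvd dvdE)
  have "q' \<noteq> 0" using q' Suc.prems(1) by auto
  then have "degree q = Suc (degree q')" unfolding q' by (subst degree_mult_eq) auto
  moreover have "poly_action B q' ((B - mat z) *v v) = 0"
    using Suc.prems(2) unfolding q' poly_action_linear_factor .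
  ultimately have "(B - mat z) *v v \<in> vec.span (\<Union>z. gen_eigenspace B z)"
    using Suc.hyps \<open>q' \<noteq> 0\<close> by auto
  then show ?case by (rule span_gen_eigenspaces_step)
qed

lemma annihilating_poly_exists:
  fixes B :: "complex ^ 'n ^ 'n::finite"
  obtains q where "q \<noteq> 0" "poly_action B q v = 0"
proof -
  define N where "N = CARD('n)"
  define x where "x i = ((*v) B ^^ i) v" for i
  have "\<exists>c. (\<exists>i\<le>N. c i \<noteq> 0) \<and> (\<Sum>i\<le>N. c i *s x i) = 0"
  \<comment> \<open>Linear dependence concerns the set of iterates and yields indexed coefficients
    only if they are distinct. A repetition is a relation by itself, with coefficients 1 and
    -1.\<close>
  proof (cases "inj_on x {..N}")
    case False
    then obtain i j where ij: "i \<le> N" "j \<le> N" "i \<noteq> j" "x i = x j" by (auto simp: inj_on_def)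
    define c where "c k = (if k = i then 1 else if k = j then -1 else 0 :: complex)" for k
    have "(\<Sum>k\<le>N. c k *s x k) = (\<Sum>k\<in>{i, j}. c k *s x k)"
      using ij by (intro sum.mono_neutral_right) (auto simp: c_def)
    also have "\<dots> = 0" using ij by (simp add: c_def)
    finally show ?thesis using ij(1) by (intro exI[of _ c]) (auto simp: c_def)
  next
    case True
    have "vec.dim (x ` {..N}) \<le> N"
      using vec.dim_subset_UNIV[of "x ` {..N}"] by (simp add: N_def vec.dimension_def card_cart_basis)
    then have "vec.dependent (x ` {..N})"
      using True by (intro vec.dependent_biggerset_general) (simp add: card_image)
    then obtain u where u: "\<exists>w\<in>x ` {..N}. u w \<noteq> 0" "(\<Sum>w\<in>x ` {..N}. u w *s w) = 0"
      using vec.dependent_finite[of "x ` {..N}"] by auto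
    then show ?thesis
      using True by (intro exI[of _ "\<lambda>i. u (x i)"]) (auto simp: sum.reindex)
  qed
  then obtain c i where c: "i \<le> N" "c i \<noteq> 0" "(\<Sum>i\<le>N. c i *s x i) = 0" by blast
  define q where "q = (\<Sum>i\<le>N. monom (c i) i)"
  have coeff: "coeff q j = (if j \<le> N then c j else 0)" for j
    by (simp add: q_def coeff_sum)
  have "degree q \<le> N" by (rule degree_le) (simp add: coeff)
  then have "poly_action B q v = (\<Sum>i\<le>N. c i *s x i)"
    by (simp add: poly_action_eq coeff x_def)
  moreover have "q \<noteq> 0" using c(1,2) coeff[of i] by auto
  ultimately show thesis using that c(3) by metis
qed

lemma span_gen_eigenspaces: "vec.span (\<Union>z. gen_eigenspace B z) = UNIV"
  by (metis annihilating_poly_exists poly_action_zero_imp_in_span UNIV_eq_I)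

section \<open>Real points of complex spectral subspaces\<close>

abbreviation cmat :: "real ^ 'm ^ 'n \<Rightarrow> complex ^ 'm ^ 'n" where
  "cmat \<equiv> map_matrix complex_of_real"

definition cvec :: "real ^ 'n \<Rightarrow> complex ^ 'n" where
  "cvec x = (\<chi> i. complex_of_real (x $ i))"

definition Re_vec :: "complex ^ 'n \<Rightarrow> real ^ 'n" where
  "Re_vec v = (\<chi> i. Re (v $ i))"

definition Im_vec :: "complex ^ 'n \<Rightarrow> real ^ 'n" where
  "Im_vec v = (\<chi> i. Im (v $ i))"

definition cnj_vec :: "complex ^ 'n \<Rightarrow> complex ^ 'n" where
  "cnj_vec v = (\<chi> i. cnj (v $ i))"

lemma cmat_mult_cvec: "cmat A *v cvec x = cvec (A *v x)"
  by (simp add: cvec_def matrix_vector_mult_def vec_eq_iff)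

lemma cvec_eq_0_iff: "cvec x = 0 \<longleftrightarrow> x = 0"
  by (simp add: cvec_def vec_eq_iff)

lemma cvec_diff: "cvec (x - y) = cvec x - cvec y"
  by (simp add: cvec_def vec_eq_iff)

lemma cvec_scaleR: "cvec (c *\<^sub>R x) = complex_of_real c *s cvec x"
  by (simp add: cvec_def vec_eq_iff)

lemma Re_vec_cvec: "Re_vec (cvec x) = x"
  by (simp add: cvec_def Re_vec_def vec_eq_iff)

lemma Re_vec_mult: "Re_vec (cmat A *v v) = A *v Re_vec v"
  by (simp add: Re_vec_def matrix_vector_mult_def vec_eq_iff)

lemma Im_vec_mult: "Im_vec (cmat A *v v) = A *v Im_vec v"
  by (simp add: Im_vec_def matrix_vector_mult_def vec_eq_iff)

lemma Re_vec_add: "Re_vec (u + v) = Re_vec u + Re_vec v"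
  by (simp add: Re_vec_def vec_eq_iff)

lemma Re_vec_scale: "Re_vec (z *s v) = Re z *\<^sub>R Re_vec v - Im z *\<^sub>R Im_vec v"
  by (simp add: Re_vec_def Im_vec_def vec_eq_iff)

lemma Im_vec_scale: "Im_vec (z *s v) = Im z *\<^sub>R Re_vec v + Re z *\<^sub>R Im_vec v"
  by (simp add: Re_vec_def Im_vec_def vec_eq_iff)

lemma Re_Im_vec_eq_0: "Re_vec v = 0 \<Longrightarrow> Im_vec v = 0 \<Longrightarrow> v = 0"
  by (simp add: Re_vec_def Im_vec_def vec_eq_iff complex_eq_iff)

lemma cvec_Re_vec: "cvec (Re_vec v) = (1/2) *s (v + cnj_vec v)"
  by (simp add: cvec_def Re_vec_def cnj_vec_def vec_eq_iff complex_eq_iff)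

lemma cvec_Im_vec: "cvec (Im_vec v) = (- \<i>/2) *s (v - cnj_vec v)"
  by (simp add: cvec_def Im_vec_def cnj_vec_def vec_eq_iff complex_eq_iff)

lemma cvec_Re_Im: "v = cvec (Re_vec v) + \<i> *s cvec (Im_vec v)"
  by (simp add: cvec_def Re_vec_def Im_vec_def vec_eq_iff complex_eq_iff)

lemma cnj_vec_shift: "cnj_vec ((cmat A - mat z) *v v) = (cmat A - mat (cnj z)) *v cnj_vec v"
  by (simp add: sub_mat_mult_vec) (simp add: cnj_vec_def matrix_vector_mult_def vec_eq_iff)

lemma cnj_vec_gen_eigenspace:
  assumes "v \<in> gen_eigenspace (cmat A) z"
  shows "cnj_vec v \<in> gen_eigenspace (cmat A) (cnj z)"
proof -
  obtain p where p: "((*v) (cmat A - mat z) ^^ p) v = 0" using assms by (auto simp: gen_eigenspace_def)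
  have "((*v) (cmat A - mat (cnj z)) ^^ p) (cnj_vec v) = cnj_vec (((*v) (cmat A - mat z) ^^ p) v)" for p
    by (induction p) (simp_all add: cnj_vec_shift)
  then have "((*v) (cmat A - mat (cnj z)) ^^ p) (cnj_vec v) = 0" using p by (simp add: cnj_vec_def vec_eq_iff)
  then show ?thesis unfolding gen_eigenspace_def by blast
qed

definition cspectral :: "real ^ 'n ^ 'n::finite \<Rightarrow> complex set \<Rightarrow> (complex ^ 'n) set" where
  "cspectral A \<Lambda> = vec.span (\<Union>z\<in>\<Lambda>. gen_eigenspace (cmat A) z)"

lemma mem_spectral_subspace_iff: "x \<in> spectral_subspace A \<Lambda> \<longleftrightarrow> cvec x \<in> cspectral A \<Lambda>"
  by (simp add: spectral_subspace_def cspectral_def cvec_def generalized_eigenspace_def gen_eigenspace_def)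

lemma subspace_cspectral: "vec.subspace (cspectral A \<Lambda>)"
  by (simp add: cspectral_def)

lemma gen_eigenspace_subset_cspectral: "z \<in> \<Lambda> \<Longrightarrow> v \<in> gen_eigenspace (cmat A) z \<Longrightarrow> v \<in> cspectral A \<Lambda>"
  unfolding cspectral_def by (intro vec.span_base UN_I)

lemma cspectral_invariant:
  assumes "v \<in> cspectral A \<Lambda>"
  shows "cmat A *v v \<in> cspectral A \<Lambda>"
  using assms unfolding cspectral_def
proof (induction rule: vec.span_induct_alt)
  case base
  then show ?case by (simp add: vec.span_zero)
next
  case (step c x y)
  then obtain z where "z \<in> \<Lambda>" "x \<in> gen_eigenspace (cmat A) z" by blast
  then have "cmat A *v x \<in> vec.span (\<Union>z\<in>\<Lambda>. gen_eigenspace (cmat A) z)"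
    by (intro vec.span_base UN_I gen_eigenspace_invariant)
  then show ?case using step
    by (simp add: matrix_vector_right_distrib vector_scalar_commute vec.span_add vec.span_scale)
qed

lemma cnj_vec_cspectral:
  assumes "cnj ` \<Lambda> \<subseteq> \<Lambda>" "v \<in> cspectral A \<Lambda>"
  shows "cnj_vec v \<in> cspectral A \<Lambda>"
  using assms(2) unfolding cspectral_def
proof (induction rule: vec.span_induct_alt)
  case base
  have "cnj_vec 0 = (0 :: complex ^ 'a)" by (simp add: cnj_vec_def vec_eq_iff)
  then show ?case by (simp add: vec.span_zero)
next
  case (step c x y)
  then obtain z where "z \<in> \<Lambda>" "x \<in> gen_eigenspace (cmat A) z" by blast
  then have "cnj_vec x \<in> vec.span (\<Union>z\<in>\<Lambda>. gen_eigenspace (cmat A) z)"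
    using assms(1) by (intro vec.span_base UN_I[of "cnj z"] cnj_vec_gen_eigenspace) auto
  moreover have "cnj_vec (c *s x + y) = cnj c *s cnj_vec x + cnj_vec y"
    by (simp add: cnj_vec_def vec_eq_iff)
  ultimately show ?case using step by (simp add: vec.span_add vec.span_scale)
qed

text \<open>A conjugation-invariant complex subspace contains \<open>(v + cnj v) / 2\<close> and
  \<open>(v - cnj v) / 2i\<close> together with \<open>v\<close>.\<close>

lemma Re_Im_vec_spectral_subspace:
  assumes "cnj ` \<Lambda> \<subseteq> \<Lambda>" "v \<in> cspectral A \<Lambda>"
  shows "Re_vec v \<in> spectral_subspace A \<Lambda>" "Im_vec v \<in> spectral_subspace A \<Lambda>"
  unfolding mem_spectral_subspace_iff cvec_Re_vec cvec_Im_vec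
  using cnj_vec_cspectral[OF assms] assms(2)
  by (auto intro!: vec.subspace_scale[OF subspace_cspectral] vec.subspace_add[OF subspace_cspectral]
      vec.subspace_diff[OF subspace_cspectral])

lemma spectral_decomposition:
  assumes "cnj ` \<Lambda> \<subseteq> \<Lambda>"
  obtains y y' where "y \<in> spectral_subspace A \<Lambda>" "y' \<in> spectral_subspace A (- \<Lambda>)" "x = y + y'"
proof -
  have "(\<Union>z. gen_eigenspace (cmat A) z) = (\<Union>z\<in>\<Lambda>. gen_eigenspace (cmat A) z) \<union> (\<Union>z\<in>-\<Lambda>. gen_eigenspace (cmat A) z)"
    by auto
  then have "cvec x \<in> {u + v |u v. u \<in> cspectral A \<Lambda> \<and> v \<in> cspectral A (- \<Lambda>)}"
    using span_gen_eigenspaces[of "cmat A"] unfolding cspectral_def vec.span_Un[symmetric] by simp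
  then obtain u v where uv: "cvec x = u + v" "u \<in> cspectral A \<Lambda>" "v \<in> cspectral A (- \<Lambda>)" by blast
  have "cnj ` (- \<Lambda>) \<subseteq> - \<Lambda>" using assms by (auto simp: image_subset_iff)
  then have "Re_vec v \<in> spectral_subspace A (- \<Lambda>)" using Re_Im_vec_spectral_subspace uv(3) by blast
  moreover have "Re_vec u \<in> spectral_subspace A \<Lambda>" using Re_Im_vec_spectral_subspace assms uv(2) by blast
  moreover have "x = Re_vec u + Re_vec v" using arg_cong[OF uv(1), of Re_vec] by (simp add: Re_vec_cvec Re_vec_add)
  ultimately show thesis using that by blast
qed

lemma det_nonzeroI:
  fixes M :: "'a::field ^ 'n ^ 'n"
  assumes "\<And>x. M *v x = 0 \<Longrightarrow> x = 0"
  shows "det M \<noteq> 0"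
  using assms matrix_left_invertible_ker[of M] by (auto simp: invertible_det_nz[symmetric] invertible_left_inverse)

lemma det_zero_kernel:
  fixes M :: "'a::field ^ 'n ^ 'n"
  assumes "det M = 0"
  obtains x where "x \<noteq> 0" "M *v x = 0"
  using assms det_nonzeroI by blast

lemma factor_through_range:
  fixes M :: "real ^ 'k ^ 'n" and S :: "real ^ 'm ^ 'n"
  assumes "\<And>x. M *v x \<in> range ((*v) S)"
  shows "\<exists>L. M = S ** L"
proof -
  have "\<forall>j. \<exists>l. S *v l = M *v axis j 1" using assms by (metis imageE)
  then obtain l where l: "\<And>j. S *v l j = M *v axis j 1" by metis
  have "(\<chi> i j. l j $ i) *v axis j 1 = l j" for j
    by (simp add: matrix_vector_mult_basis column_def vec_eq_iff)
  then have "(S ** (\<chi> i j. l j $ i)) *v axis j 1 = M *v axis j 1" for j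
    by (simp only: matrix_vector_mul_assoc[symmetric] l)
  then have "S ** (\<chi> i j. l j $ i) = M" by (simp add: matrix_vector_mult_basis column_def vec_eq_iff)
  then show ?thesis by metis
qed

section \<open>The spectral projection and the matrix of the homological equation\<close>

locale spectral_projection =
  fixes A P :: "real ^ 'n ^ 'n::finite" and \<Lambda> :: "complex set"
  assumes cnj_closed: "cnj ` \<Lambda> \<subseteq> \<Lambda>" and proj: "is_spectral_projection A \<Lambda> P"
begin

lemma P_eq: "x \<in> spectral_subspace A \<Lambda> \<Longrightarrow> P *v x = x"
  and P_zero: "x \<in> spectral_subspace A (- \<Lambda>) \<Longrightarrow> P *v x = 0"
  using proj by (auto simp: is_spectral_projection_def)

lemma cnj_closed_compl: "cnj ` (- \<Lambda>) \<subseteq> - \<Lambda>"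
  using cnj_closed by (auto simp: image_subset_iff)

text \<open>\<open>is_spectral_projection\<close> only prescribes values on two subspaces. As every
  vector is a sum of elements of both, these values determine \<open>P\<close> and make it the
  projection along the decomposition.\<close>

lemma P_range: "P *v x \<in> spectral_subspace A \<Lambda>"
  and diff_P_compl: "x - P *v x \<in> spectral_subspace A (- \<Lambda>)"
proof -
  obtain y y' where y: "y \<in> spectral_subspace A \<Lambda>" "y' \<in> spectral_subspace A (- \<Lambda>)" "x = y + y'"
    using spectral_decomposition[OF cnj_closed] .
  then have "P *v x = y" by (simp add: matrix_vector_right_distrib P_eq P_zero)
  with y show "P *v x \<in> spectral_subspace A \<Lambda>" "x - P *v x \<in> spectral_subspace A (- \<Lambda>)" by simp_all
qed

lemma spectral_subspace_invariant: "x \<in> spectral_subspace A \<Lambda>' \<Longrightarrow> A *v x \<in> spectral_subspace A \<Lambda>'"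
  by (simp add: mem_spectral_subspace_iff cmat_mult_cvec[symmetric] cspectral_invariant)

lemma P_commute: "P *v (A *v x) = A *v (P *v x)"
proof -
  have "P *v (A *v x) = P *v (A *v (P *v x)) + P *v (A *v (x - P *v x))"
    by (simp add: matrix_vector_mult_diff_distrib)
  also have "\<dots> = A *v (P *v x)"
    using P_eq[OF spectral_subspace_invariant[OF P_range]] P_zero[OF spectral_subspace_invariant[OF diff_P_compl]] by simp
  finally show ?thesis .
qed

lemma P_idem: "P *v (P *v x) = P *v x"
  by (rule P_eq[OF P_range])

lemma cmat_P_eq:
  assumes "v \<in> cspectral A \<Lambda>"
  shows "cmat P *v v = v"
proof -
  have "cmat P *v (cvec (Re_vec v) + \<i> *s cvec (Im_vec v)) = cvec (Re_vec v) + \<i> *s cvec (Im_vec v)"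
    using Re_Im_vec_spectral_subspace[OF cnj_closed assms]
    by (simp add: matrix_vector_right_distrib vector_scalar_commute cmat_mult_cvec P_eq)
  then show ?thesis using cvec_Re_Im[of v] by simp
qed

lemma cmat_P_zero:
  assumes "v \<in> cspectral A (- \<Lambda>)"
  shows "cmat P *v v = 0"
proof -
  have "cmat P *v (cvec (Re_vec v) + \<i> *s cvec (Im_vec v)) = 0"
    using Re_Im_vec_spectral_subspace[OF cnj_closed_compl assms]
    by (simp add: matrix_vector_right_distrib vector_scalar_commute cmat_mult_cvec P_zero cvec_eq_0_iff[THEN iffD2, OF refl])
  then show ?thesis using cvec_Re_Im[of v] by simp
qed

lemma cmat_P_commute: "cmat P *v (cmat A *v v) = cmat A *v (cmat P *v v)"
proof -
  have "cmat P *v (cmat A *v (cvec (Re_vec v) + \<i> *s cvec (Im_vec v))) = cmat A *v (cmat P *v (cvec (Re_vec v) + \<i> *s cvec (Im_vec v)))"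
    by (simp add: matrix_vector_right_distrib vector_scalar_commute cmat_mult_cvec P_commute)
  then show ?thesis using cvec_Re_Im[of v] by simp
qed

lemma cmat_P_idem: "cmat P *v (cmat P *v v) = cmat P *v v"
proof -
  have "cmat P *v (cmat P *v (cvec (Re_vec v) + \<i> *s cvec (Im_vec v))) = cmat P *v (cvec (Re_vec v) + \<i> *s cvec (Im_vec v))"
    by (simp add: matrix_vector_right_distrib vector_scalar_commute cmat_mult_cvec P_idem)
  then show ?thesis using cvec_Re_Im[of v] by simp
qed

text \<open>This is \<open>s - A\<close> on the kernel of \<open>P\<close> and the identity on its
  range. It stays invertible when \<open>s\<close> is an eigenvalue in \<Lambda>, which happens at
  \<alpha> = 0 for \<open>s = 2 l + cnj l = l\<close>, and being a full square matrix with explicit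
  entries it is open to Cramer's rule.\<close>

definition homological_matrix :: "complex \<Rightarrow> complex ^ 'n ^ 'n" where
  "homological_matrix s = (mat s - cmat A) ** (mat 1 - cmat P) + cmat P"

lemma homological_matrix_mult:
  "homological_matrix s *v h = s *s (h - cmat P *v h) - cmat A *v (h - cmat P *v h) + cmat P *v h"
  by (simp add: homological_matrix_def matrix_vector_mult_add_rdistrib matrix_vector_mul_assoc[symmetric]
      matrix_vector_mult_diff_rdistrib mat_mult_vec)

lemma P_homological_matrix: "cmat P *v (homological_matrix s *v h) = cmat P *v h"
  by (simp add: homological_matrix_mult matrix_vector_right_distrib matrix_vector_mult_diff_distrib
      vector_scalar_commute cmat_P_commute cmat_P_idem)

text \<open>A kernel vector satisfies \<open>P h = 0\<close> and is an eigenvector of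
  \<open>A\<close> for \<open>s\<close>. If it were nonzero, \<open>s\<close> would lie in \<Lambda>
  and \<open>P\<close> would fix \<open>h\<close>.\<close>

lemma det_homological_matrix:
  assumes "\<And>v. v \<noteq> 0 \<Longrightarrow> cmat A *v v = s *s v \<Longrightarrow> s \<in> \<Lambda>"
  shows "det (homological_matrix s) \<noteq> 0"
proof (rule det_nonzeroI)
  fix h assume h: "homological_matrix s *v h = 0"
  then have Ph: "cmat P *v h = 0" using P_homological_matrix[of s h] by simp
  then have eig: "cmat A *v h = s *s h" using h by (simp add: homological_matrix_mult)
  show "h = 0"
  proof (rule ccontr)
    assume "h \<noteq> 0"
    then have "s \<in> \<Lambda>" using assms eig by blast
    then have "h \<in> cspectral A \<Lambda>"
      using eig by (intro gen_eigenspace_subset_cspectral[of s] eigenvector_in_gen_eigenspace) (simp_all add: sub_mat_mult_vec)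
    then show False using cmat_P_eq Ph \<open>h \<noteq> 0\<close> by simp
  qed
qed

end

text \<open>The Gram matrix of an injective \<open>S\<close>: its quadratic form is the squared norm
  of \<open>S x\<close>. Solving with it extracts \<open>L\<close> and \<open>T\<close> smoothly
  from \<open>A S = S L\<close> and \<open>P = S T\<close>.\<close>

lemma det_transpose_mult_self:
  fixes S :: "real ^ 'm ^ 'n"
  assumes "inj ((*v) S)"
  shows "det (transpose S ** S) \<noteq> 0"
proof (rule det_nonzeroI)
  fix x assume "(transpose S ** S) *v x = 0"
  then have "(S *v x) v* S = 0" by (simp add: matrix_vector_mul_assoc[symmetric] transpose_matrix_vector)
  then have "(S *v x) \<bullet> (S *v x) = 0" by (simp add: dot_lmul_matrix[symmetric])
  then have "S *v x = S *v 0" by simp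
  then show "x = 0" using assms by (simp only: inj_eq)
qed

section \<open>The two-dimensional spectral subspace and a smooth formula for its projection\<close>

locale spectral_plane = spectral_projection A P "{Complex \<alpha> \<omega>, Complex \<alpha> (- \<omega>)}"
  for A P :: "real ^ 'n ^ 'n::finite" and \<alpha> \<omega> :: real +
  fixes S :: "real ^ 2 ^ 'n"
  assumes \<omega>: "\<omega> \<noteq> 0"
    and S: "bij_betw ((*v) S) UNIV (spectral_subspace A {Complex \<alpha> \<omega>, Complex \<alpha> (- \<omega>)})"
    and eigenvalue: "\<exists>v. v \<noteq> 0 \<and> cmat A *v v = Complex \<alpha> \<omega> *s v"
begin

abbreviation "\<Lambda> \<equiv> {Complex \<alpha> \<omega>, Complex \<alpha> (- \<omega>)}"

lemma inj_S: "inj ((*v) S)" and range_S: "range ((*v) S) = spectral_subspace A \<Lambda>"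
  using S by (auto simp: bij_betw_def)

lemma S_cancel: "S *v x = S *v y \<longleftrightarrow> x = y"
  using inj_S by (simp add: inj_eq)

lemma P_S: "P *v (S *v y) = S *v y"
  using range_S by (intro P_eq) auto

definition reduced_matrix :: "real ^ 2 ^ 2" where
  "reduced_matrix = (SOME L. A ** S = S ** L)"

text \<open>Coordinates of \<open>P x\<close> in the basis \<open>S\<close>. Since
  \<open>P S = S\<close> and \<open>S\<close> is injective, this matrix is indeed a left inverse of
  \<open>S\<close>.\<close>

definition left_inverse :: "real ^ 'n ^ 2" where
  "left_inverse = (SOME T. P = S ** T)"

lemma A_S: "A ** S = S ** reduced_matrix"
proof -
  have "(A ** S) *v x \<in> range ((*v) S)" for x
    using range_S spectral_subspace_invariant[of "S *v x"] by (auto simp: matrix_vector_mul_assoc[symmetric])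
  from factor_through_range[OF this] show ?thesis unfolding reduced_matrix_def by (rule someI_ex)
qed

lemma P_factor: "P = S ** left_inverse"
proof -
  have "P *v x \<in> range ((*v) S)" for x using range_S P_range by auto
  from factor_through_range[OF this] show ?thesis unfolding left_inverse_def by (rule someI_ex)
qed

lemma A_S_vec: "A *v (S *v y) = S *v (reduced_matrix *v y)"
  using A_S by (simp add: matrix_vector_mul_assoc)

lemma S_left_inverse: "S *v (left_inverse *v x) = P *v x"
  using P_factor by (metis matrix_vector_mul_assoc)

text \<open>Real and imaginary parts of an eigenvector of \<open>A\<close> lie in the plane; their
  coordinates \<open>a\<close>, \<open>b\<close> combine to an eigenvector of the real 2 by 2 matrix
  \<open>L\<close>. The imaginary part of \<open>det (L - l) = 0\<close> gives the trace because
  \<omega> is nonzero, and the real part then gives the determinant.\<close>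

lemma reduced_trace: "reduced_matrix $ 1 $ 1 + reduced_matrix $ 2 $ 2 = 2 * \<alpha>"
  and reduced_det: "det reduced_matrix = \<alpha>\<^sup>2 + \<omega>\<^sup>2"
proof -
  let ?l = "Complex \<alpha> \<omega>" and ?L = reduced_matrix
  obtain v where v: "v \<noteq> 0" "cmat A *v v = ?l *s v" using eigenvalue by blast
  then have "v \<in> cspectral A \<Lambda>"
    by (intro gen_eigenspace_subset_cspectral[of ?l] eigenvector_in_gen_eigenspace) (simp_all add: sub_mat_mult_vec)
  then have "Re_vec v \<in> range ((*v) S)" "Im_vec v \<in> range ((*v) S)"
    unfolding range_S using Re_Im_vec_spectral_subspace cnj_closed by blast+
  then obtain a b where a: "Re_vec v = S *v a" and b: "Im_vec v = S *v b" by auto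
  have "S *v (?L *v a) = S *v (\<alpha> *\<^sub>R a - \<omega> *\<^sub>R b)"
    using arg_cong[OF v(2), of Re_vec]
    by (simp add: Re_vec_mult Re_vec_scale a b A_S_vec matrix_vector_mult_diff_distrib matrix_vector_mult_scaleR)
  then have La: "?L *v a = \<alpha> *\<^sub>R a - \<omega> *\<^sub>R b" by (simp only: S_cancel)
  have "S *v (?L *v b) = S *v (\<omega> *\<^sub>R a + \<alpha> *\<^sub>R b)"
    using arg_cong[OF v(2), of Im_vec]
    by (simp add: Im_vec_mult Im_vec_scale a b A_S_vec matrix_vector_right_distrib matrix_vector_mult_scaleR)
  then have Lb: "?L *v b = \<omega> *\<^sub>R a + \<alpha> *\<^sub>R b" by (simp only: S_cancel)
  define q where "q = cvec a + \<i> *s cvec b"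
  have "cmat ?L *v q = ?l *s q"
    unfolding q_def matrix_vector_right_distrib vector_scalar_commute cmat_mult_cvec La Lb
    by (simp add: cvec_def vec_eq_iff complex_eq_iff)
  then have ker: "(cmat ?L - mat ?l) *v q = 0" by (simp add: sub_mat_mult_vec)
  have "q \<noteq> 0"
  proof
    assume "q = 0"
    then have "a = 0" "b = 0" by (auto simp: q_def cvec_def vec_eq_iff complex_eq_iff)
    then show False using v(1) a b Re_Im_vec_eq_0[of v] by simp
  qed
  have "det (cmat ?L - mat ?l) = 0"
  proof (rule ccontr)
    assume "det (cmat ?L - mat ?l) \<noteq> 0"
    from cramer[OF this, of q 0] cramer[OF this, of 0 0] ker \<open>q \<noteq> 0\<close> show False by simp
  qed
  then have "(of_real (?L $ 1 $ 1) - ?l) * (of_real (?L $ 2 $ 2) - ?l) = of_real (?L $ 1 $ 2 * ?L $ 2 $ 1)"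
    by (simp add: det_2 mat_def)
  then have re: "(?L $ 1 $ 1 - \<alpha>) * (?L $ 2 $ 2 - \<alpha>) - \<omega> * \<omega> = ?L $ 1 $ 2 * ?L $ 2 $ 1"
    and im: "\<omega> * (?L $ 1 $ 1 + ?L $ 2 $ 2 - 2 * \<alpha>) = 0"
    by (simp_all add: complex_eq_iff algebra_simps)
  from im \<omega> show tr: "?L $ 1 $ 1 + ?L $ 2 $ 2 = 2 * \<alpha>" by simp
  show "det ?L = \<alpha>\<^sup>2 + \<omega>\<^sup>2" unfolding det_2 power2_eq_square using re tr by algebra
qed

definition char_matrix :: "real ^ 'n ^ 'n" where
  "char_matrix = A ** A - (2 * \<alpha>) *\<^sub>R A + (\<alpha>\<^sup>2 + \<omega>\<^sup>2) *\<^sub>R mat 1"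

lemma char_matrix_mult: "char_matrix *v x = A *v (A *v x) - (2 * \<alpha>) *\<^sub>R (A *v x) + (\<alpha>\<^sup>2 + \<omega>\<^sup>2) *\<^sub>R x"
  by (simp add: char_matrix_def matrix_vector_mult_add_rdistrib matrix_vector_mult_diff_rdistrib
      scaleR_matrix_vector_assoc[symmetric] matrix_vector_mul_assoc)

text \<open>Cayley-Hamilton for the 2 by 2 matrix \<open>L\<close>, whose trace and determinant are
  known, carried over by \<open>A S = S L\<close>.\<close>

lemma char_matrix_S: "char_matrix *v (S *v y) = 0"
proof -
  let ?L = reduced_matrix
  have "?L *v (?L *v y) - (?L $ 1 $ 1 + ?L $ 2 $ 2) *\<^sub>R (?L *v y) + det ?L *\<^sub>R y = 0"
    by (simp add: vec_eq_iff forall_2 matrix_vector_mult_def sum_2 det_2 algebra_simps)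
  then have "?L *v (?L *v y) - (2 * \<alpha>) *\<^sub>R (?L *v y) + (\<alpha>\<^sup>2 + \<omega>\<^sup>2) *\<^sub>R y = 0"
    by (simp only: reduced_trace reduced_det)
  then have "S *v (?L *v (?L *v y) - (2 * \<alpha>) *\<^sub>R (?L *v y) + (\<alpha>\<^sup>2 + \<omega>\<^sup>2) *\<^sub>R y) = 0" by simp
  then show ?thesis
    unfolding char_matrix_mult A_S_vec
    by (simp only: matrix_vector_right_distrib matrix_vector_mult_diff_distrib matrix_vector_mult_scaleR)
qed

text \<open>The two linear factors are removed one at a time. Each time the vector lies both in the
  complex spectral subspace of \<Lambda>, as an eigenvector, and in the complementary one, where
  \<open>P\<close> vanishes; so it is zero.\<close>

lemma char_matrix_kernel:
  assumes "char_matrix *v x = 0" "P *v x = 0"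
  shows "x = 0"
proof -
  let ?l = "Complex \<alpha> \<omega>" and ?l' = "Complex \<alpha> (- \<omega>)"
  have "x \<in> spectral_subspace A (- \<Lambda>)" using diff_P_compl[of x] assms(2) by simp
  then have x: "cvec x \<in> cspectral A (- \<Lambda>)" by (simp add: mem_spectral_subspace_iff)
  define w where "w = (cmat A - mat ?l) *v cvec x"
  have w: "w = cmat A *v cvec x - ?l *s cvec x" by (simp add: w_def sub_mat_mult_vec)
  have w2: "w \<in> cspectral A (- \<Lambda>)"
    unfolding w using x by (intro vec.subspace_diff[OF subspace_cspectral] vec.subspace_scale[OF subspace_cspectral] cspectral_invariant)
  have "(cmat A - mat ?l') *v w = cvec (char_matrix *v x)"
    unfolding w char_matrix_mult sub_mat_mult_vec matrix_vector_mult_diff_distrib vector_scalar_commute cmat_mult_cvec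
    by (simp add: cvec_def vec_eq_iff complex_eq_iff power2_eq_square algebra_simps)
  then have "(cmat A - mat ?l') *v w = 0" using assms(1) by (simp add: cvec_eq_0_iff)
  then have "w \<in> cspectral A \<Lambda>"
    by (intro gen_eigenspace_subset_cspectral[of ?l'] eigenvector_in_gen_eigenspace) simp_all
  then have "w = 0" using cmat_P_eq cmat_P_zero[OF w2] by simp
  then have "cvec x \<in> cspectral A \<Lambda>"
    unfolding w_def by (intro gen_eigenspace_subset_cspectral[of ?l] eigenvector_in_gen_eigenspace) simp_all
  then show "x = 0" using cmat_P_eq cmat_P_zero[OF x] by (simp add: cvec_eq_0_iff)
qed

text \<open>\<open>char_matrix\<close> vanishes on the plane, and the summand built from
  \<open>S\<close> restores invertibility there. \<open>P\<close> annihilates the first summand and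
  fixes the second, so \<open>P\<close> solves a linear system with smooth data.\<close>

definition proj_matrix :: "real ^ 'n ^ 'n" where
  "proj_matrix = char_matrix + S ** transpose S"

lemma P_proj_matrix: "P ** proj_matrix = S ** transpose S"
proof -
  have "P *v (char_matrix *v x) = 0" for x
  proof -
    have "P *v (char_matrix *v x) = char_matrix *v (P *v x)"
      by (simp add: char_matrix_mult matrix_vector_right_distrib matrix_vector_mult_diff_distrib
          matrix_vector_mult_scaleR P_commute)
    then show ?thesis by (simp add: S_left_inverse[symmetric] char_matrix_S)
  qed
  then show ?thesis
    by (simp add: matrix_eq proj_matrix_def matrix_vector_mul_assoc[symmetric] matrix_vector_mult_add_rdistrib
        matrix_vector_right_distrib P_S)
qed

text \<open>Applying \<open>P\<close> to a kernel relation leaves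
  \<open>S (transpose S) x = 0\<close>, so \<open>x\<close> is orthogonal to the plane and killed by
  \<open>char_matrix\<close>. By \<open>char_matrix_kernel\<close> its component outside the plane
  vanishes; then \<open>x\<close> is in the plane and orthogonal to it.\<close>

lemma det_proj_matrix: "det proj_matrix \<noteq> 0"
proof (rule det_nonzeroI)
  fix x assume x: "proj_matrix *v x = 0"
  have "S *v (transpose S *v x) = P *v (proj_matrix *v x)"
    by (simp only: matrix_vector_mul_assoc P_proj_matrix)
  then have SS: "S *v (transpose S *v x) = S *v 0" using x by simp
  then have Sx: "transpose S *v x = 0" by (simp only: S_cancel)
  have "char_matrix *v x = 0"
    using x SS by (simp add: proj_matrix_def matrix_vector_mult_add_rdistrib matrix_vector_mul_assoc[symmetric])
  moreover have "char_matrix *v (P *v x) = 0" by (simp add: S_left_inverse[symmetric] char_matrix_S)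
  ultimately have "char_matrix *v (x - P *v x) = 0" by (simp add: matrix_vector_mult_diff_distrib)
  moreover have "P *v (x - P *v x) = 0" by (simp add: matrix_vector_mult_diff_distrib P_idem)
  ultimately have "x = P *v x" using char_matrix_kernel[of "x - P *v x"] by simp
  then have xS: "x = S *v (left_inverse *v x)" by (simp add: S_left_inverse)
  have "x \<bullet> x = (x v* S) \<bullet> (left_inverse *v x)" using xS by (simp add: dot_lmul_matrix)
  also have "\<dots> = 0" using Sx by (simp add: transpose_matrix_vector)
  finally show "x = 0" by simp
qed

end

section \<open>The homological equation\<close>

lemma bounded_linear_Re_vec: "bounded_linear (Re_vec :: complex ^ 'n::finite \<Rightarrow> real ^ 'n)"
  unfolding Re_vec_def by (rule linear_conv_bounded_linear[THEN iffD1]) (auto intro!: linearI simp: vec_eq_iff)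

lemma bounded_linear_cvec: "bounded_linear (cvec :: real ^ 'n::finite \<Rightarrow> complex ^ 'n)"
  unfolding cvec_def by (rule linear_conv_bounded_linear[THEN iffD1]) (auto intro!: linearI simp: vec_eq_iff complex_eq_iff)

lemma norm_vector_smult: "norm (c *s v) = norm c * norm (v :: complex ^ 'n::finite)"
  unfolding norm_vec_def vector_smult_component norm_mult by (simp add: L2_set_right_distrib)

lemma bounded_bilinear_smult: "bounded_bilinear (\<lambda>(c::complex) v. c *s (v :: complex ^ 'n::finite))"
  by (rule bounded_bilinear.intro)
    (auto simp: vec.scale_left_distrib vec.scale_right_distrib norm_vector_smult vec_eq_iff complex_eq_iff intro!: exI[of _ 1])

lemma matrix_vector_sum: "M *v (\<Sum>i\<in>I. f i) = (\<Sum>i\<in>I. M *v (f i :: 'a::comm_ring_1 ^ 'n))"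
  by (induction I rule: infinite_finite_induct) (simp_all add: matrix_vector_right_distrib)

text \<open>\<open>w\<close> holds the coefficients of a real-linear coordinate \<open>z\<close>
  from the plane to the complex numbers, \<open>q\<close> those of its inverse in the form
  \<open>u_i = q_i z + cnj (q_i z)\<close>. Both are smooth in the parameter, so passing between
  monomials in \<open>u\<close> and monomials in \<open>z\<close>, \<open>cnj z\<close> keeps
  coefficients smooth.\<close>

locale complex_coordinate =
  fixes r :: nat and V :: "real set" and w q :: "2 \<Rightarrow> real \<Rightarrow> complex"
  assumes open_V: "open V"
    and w: "C_k_on r (w i) V" and q: "C_k_on r (q i) V"
    and onto: "\<mu> \<in> V \<Longrightarrow> \<exists>u :: real ^ 2. w 1 \<mu> * of_real (u $ 1) + w 2 \<mu> * of_real (u $ 2) = z"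
    and coord: "\<mu> \<in> V \<Longrightarrow> complex_of_real ((u :: real ^ 2) $ i) =
      q i \<mu> * (w 1 \<mu> * of_real (u $ 1) + w 2 \<mu> * of_real (u $ 2)) +
      cnj (q i \<mu> * (w 1 \<mu> * of_real (u $ 1) + w 2 \<mu> * of_real (u $ 2)))"
begin

definition zeta :: "real \<Rightarrow> real ^ 2 \<Rightarrow> complex" where
  "zeta \<mu> u = w 1 \<mu> * of_real (u $ 1) + w 2 \<mu> * of_real (u $ 2)"

definition zmon :: "nat \<Rightarrow> nat \<Rightarrow> real \<Rightarrow> real ^ 2 \<Rightarrow> complex" where
  "zmon a b \<mu> u = zeta \<mu> u ^ a * cnj (zeta \<mu> u) ^ b"

lemma zeta_onto: "\<mu> \<in> V \<Longrightarrow> \<exists>u. zeta \<mu> u = z"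
  using onto by (simp add: zeta_def)

lemma of_real_nth: "\<mu> \<in> V \<Longrightarrow> complex_of_real (u $ i) = q i \<mu> * zeta \<mu> u + cnj (q i \<mu>) * cnj (zeta \<mu> u)"
  using coord[of \<mu> u i] by (simp add: zeta_def)

definition zmon_family :: "nat \<Rightarrow> (real ^ 2 \<Rightarrow> real \<Rightarrow> complex) \<Rightarrow> bool" where
  "zmon_family k p \<longleftrightarrow> (\<exists>c. (\<forall>a. C_k_on r (c a) V) \<and> (\<forall>\<mu>\<in>V. \<forall>u. p u \<mu> = (\<Sum>a\<le>k. zmon a (k - a) \<mu> u * c a \<mu>)))"

lemma zmon_family_mult_nth:
  assumes "zmon_family k p"
  shows "zmon_family (Suc k) (\<lambda>u \<mu>. of_real (u $ i) * p u \<mu>)"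
proof -
  obtain c where c: "\<And>a. C_k_on r (c a) V" "\<forall>\<mu>\<in>V. \<forall>u. p u \<mu> = (\<Sum>a\<le>k. zmon a (k - a) \<mu> u * c a \<mu>)"
    using assms unfolding zmon_family_def by blast
  \<comment> \<open>Multiplication by \<open>u_i\<close> sends a term either one index up, through
    \<open>q_i z\<close>, or leaves the index and raises the power of \<open>cnj z\<close>. The top
    index \<open>Suc k\<close> receives only the first kind.\<close>
  define d where "d a \<mu> = (case a of 0 \<Rightarrow> 0 | Suc b \<Rightarrow> q i \<mu> * c b \<mu>) + (if a \<le> k then cnj (q i \<mu>) * c a \<mu> else 0)" for a \<mu>
  have "C_k_on r (\<lambda>\<mu>. case a of 0 \<Rightarrow> 0 | Suc b \<Rightarrow> q i \<mu> * c b \<mu>) V" for a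
    by (cases a) (auto intro: C_k_on_const C_k_on_mult open_V q c)
  moreover have "C_k_on r (\<lambda>\<mu>. if a \<le> k then cnj (q i \<mu>) * c a \<mu> else 0) V" for a
    by (cases "a \<le> k") (auto intro!: C_k_on_const C_k_on_mult[OF open_V C_k_on_linear[OF bounded_linear_cnj]] open_V q c)
  ultimately have d: "C_k_on r (d a) V" for a unfolding d_def by (intro C_k_on_add open_V)
  have "of_real (u $ i) * p u \<mu> = (\<Sum>a\<le>Suc k. zmon a (Suc k - a) \<mu> u * d a \<mu>)" if \<mu>: "\<mu> \<in> V" for u \<mu>
  proof -
    have "(\<Sum>a\<le>Suc k. zmon a (Suc k - a) \<mu> u * d a \<mu>) =
        (\<Sum>a\<le>Suc k. zmon a (Suc k - a) \<mu> u * (case a of 0 \<Rightarrow> 0 | Suc b \<Rightarrow> q i \<mu> * c b \<mu>)) +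
        (\<Sum>a\<le>Suc k. zmon a (Suc k - a) \<mu> u * (if a \<le> k then cnj (q i \<mu>) * c a \<mu> else 0))"
      by (simp only: d_def distrib_left sum.distrib)
    also have "(\<Sum>a\<le>Suc k. zmon a (Suc k - a) \<mu> u * (case a of 0 \<Rightarrow> 0 | Suc b \<Rightarrow> q i \<mu> * c b \<mu>)) =
        (\<Sum>a\<le>k. zmon (Suc a) (k - a) \<mu> u * (q i \<mu> * c a \<mu>))"
      by (subst sum.atMost_Suc_shift) simp
    also have "(\<Sum>a\<le>Suc k. zmon a (Suc k - a) \<mu> u * (if a \<le> k then cnj (q i \<mu>) * c a \<mu> else 0)) =
        (\<Sum>a\<le>k. zmon a (Suc (k - a)) \<mu> u * (cnj (q i \<mu>) * c a \<mu>))"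
      by (simp add: Suc_diff_le)
    also have "(\<Sum>a\<le>k. zmon (Suc a) (k - a) \<mu> u * (q i \<mu> * c a \<mu>)) + (\<Sum>a\<le>k. zmon a (Suc (k - a)) \<mu> u * (cnj (q i \<mu>) * c a \<mu>))
        = (\<Sum>a\<le>k. (q i \<mu> * zeta \<mu> u + cnj (q i \<mu>) * cnj (zeta \<mu> u)) * (zmon a (k - a) \<mu> u * c a \<mu>))"
      unfolding sum.distrib[symmetric] by (intro sum.cong refl) (simp add: zmon_def algebra_simps)
    also have "\<dots> = of_real (u $ i) * p u \<mu>"
      using c(2) \<mu> by (simp only: of_real_nth[OF \<mu>, symmetric] sum_distrib_left[symmetric])
    finally show ?thesis by simp
  qed
  then show ?thesis using d unfolding zmon_family_def by blast
qed

lemma zmon_family_monom: "zmon_family (a + b) (\<lambda>u \<mu>. of_real (u $ 1 ^ a * u $ 2 ^ b))"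
proof (induction a)
  case 0
  show ?case
  proof (induction b)
    case 0
    show ?case unfolding zmon_family_def
      by (intro exI[of _ "\<lambda>a \<mu>. 1"] conjI allI C_k_on_const) (simp add: zmon_def)
  next
    case (Suc b)
    from zmon_family_mult_nth[OF this, of 2] show ?case by (simp add: mult_ac)
  qed
next
  case (Suc a)
  from zmon_family_mult_nth[OF this, of 1] show ?case by (simp add: mult_ac)
qed

lemma C_k_on_smult:
  fixes f :: "real \<Rightarrow> complex" and g :: "real \<Rightarrow> complex ^ 'n::finite"
  shows "C_k_on r f V \<Longrightarrow> C_k_on r g V \<Longrightarrow> C_k_on r (\<lambda>\<mu>. f \<mu> *s g \<mu>) V"
  by (rule C_k_on_bilinear[OF bounded_bilinear_smult open_V])

lemma hom_family_zmon:
  fixes g :: "real ^ 2 \<Rightarrow> real \<Rightarrow> real ^ 'n::finite"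
  assumes "hom_family r V k g"
  shows "\<exists>c. (\<forall>a. C_k_on r (c a) V) \<and> (\<forall>\<mu>\<in>V. \<forall>u. cvec (g u \<mu>) = (\<Sum>a\<le>k. zmon a (k - a) \<mu> u *s c a \<mu>))"
proof -
  obtain c where c: "\<And>a. C_k_on r (c a) V" "\<forall>\<mu>\<in>V. \<forall>u. g u \<mu> = hom_poly k (\<lambda>a. c a \<mu>) u"
    using assms unfolding hom_family_def by blast
  have "\<forall>i\<in>{..k}. \<exists>d. (\<forall>a. C_k_on r (d a) V) \<and>
      (\<forall>\<mu>\<in>V. \<forall>u. complex_of_real (u $ 1 ^ i * u $ 2 ^ (k - i)) = (\<Sum>a\<le>k. zmon a (k - a) \<mu> u * d a \<mu>))"
  proof
    fix i assume "i \<in> {..k}"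
    then show "\<exists>d. (\<forall>a. C_k_on r (d a) V) \<and>
      (\<forall>\<mu>\<in>V. \<forall>u. complex_of_real (u $ 1 ^ i * u $ 2 ^ (k - i)) = (\<Sum>a\<le>k. zmon a (k - a) \<mu> u * d a \<mu>))"
      using zmon_family_monom[of i "k - i"] unfolding zmon_family_def by simp
  qed
  from bchoice[OF this] obtain d where d: "\<forall>i\<in>{..k}. (\<forall>a. C_k_on r (d i a) V) \<and>
      (\<forall>\<mu>\<in>V. \<forall>u. complex_of_real (u $ 1 ^ i * u $ 2 ^ (k - i)) = (\<Sum>a\<le>k. zmon a (k - a) \<mu> u * d i a \<mu>))"
    by blast
  define e where "e a \<mu> = (\<Sum>i\<le>k. d i a \<mu> *s cvec (c i \<mu>))" for a \<mu>
  have "C_k_on r (e a) V" for a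
    unfolding e_def using d by (intro C_k_on_sum open_V C_k_on_smult C_k_on_linear[OF bounded_linear_cvec] c) auto
  moreover have "cvec (g u \<mu>) = (\<Sum>a\<le>k. zmon a (k - a) \<mu> u *s e a \<mu>)" if \<mu>: "\<mu> \<in> V" for u \<mu>
  proof -
    have "cvec (g u \<mu>) = (\<Sum>i\<le>k. complex_of_real (u $ 1 ^ i * u $ 2 ^ (k - i)) *s cvec (c i \<mu>))"
      using c(2) \<mu> by (simp add: hom_poly_def linear_sum[OF bounded_linear.linear[OF bounded_linear_cvec]] cvec_scaleR del: of_real_mult of_real_power)
    also have "\<dots> = (\<Sum>i\<le>k. \<Sum>a\<le>k. (zmon a (k - a) \<mu> u * d i a \<mu>) *s cvec (c i \<mu>))"
      using d \<mu> by (intro sum.cong refl) (simp add: vec.scale_sum_left del: of_real_mult of_real_power)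
    also have "\<dots> = (\<Sum>a\<le>k. \<Sum>i\<le>k. (zmon a (k - a) \<mu> u * d i a \<mu>) *s cvec (c i \<mu>))"
      by (rule sum.swap)
    also have "\<dots> = (\<Sum>a\<le>k. zmon a (k - a) \<mu> u *s e a \<mu>)"
      by (simp add: e_def vec.scale_sum_right vector_smult_assoc)
    finally show ?thesis .
  qed
  ultimately show ?thesis by blast
qed

lemma hom_family_Re_zmon:
  fixes h :: "real \<Rightarrow> complex ^ 'n::finite"
  assumes "C_k_on r h V"
  shows "hom_family r V (a + b) (\<lambda>u \<mu>. Re_vec (zmon a b \<mu> u *s h \<mu>))"
proof -
  have nth: "hom_family r V (0 + 1) (\<lambda>u \<mu>. w i \<mu> * of_real (u $ i))" for i
    by (intro hom_family_bilinear[OF open_V bounded_bilinear_mult] hom_family_const w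
        hom_family_linear[OF open_V bounded_linear_of_real] hom_family_nth open_V)
  have z: "hom_family r V 1 (\<lambda>u \<mu>. zeta \<mu> u)"
    unfolding zeta_def using hom_family_add[OF open_V nth[of 1] nth[of 2]] by simp
  then have zc: "hom_family r V 1 (\<lambda>u \<mu>. cnj (zeta \<mu> u))"
    by (rule hom_family_linear[OF open_V bounded_linear_cnj])
  have pow: "hom_family r V a (\<lambda>u \<mu>. p u \<mu> ^ a)" if "hom_family r V 1 p" for p :: "real ^ 2 \<Rightarrow> real \<Rightarrow> complex" and a
  proof (induction a)
    case 0
    then show ?case using hom_family_const[OF C_k_on_const] by simp
  next
    case (Suc a)
    from hom_family_bilinear[OF open_V bounded_bilinear_mult that this] show ?case by simp
  qed
  have "hom_family r V (a + b + 0) (\<lambda>u \<mu>. zmon a b \<mu> u *s h \<mu>)"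
    unfolding zmon_def
    by (intro hom_family_bilinear[OF open_V bounded_bilinear_smult] hom_family_bilinear[OF open_V bounded_bilinear_mult]
        pow z zc hom_family_const assms)
  from hom_family_linear[OF open_V bounded_linear_Re_vec this] show ?thesis by simp
qed

text \<open>Leibniz' rule: the monomials are eigenfunctions of differentiation along the linear
  field \<open>L\<close>, which is what decouples the homological equation.\<close>

lemma zmon_has_derivative:
  assumes "\<And>u. zeta \<mu> (L *v u) = l * zeta \<mu> u"
  shows "\<exists>D. (zmon a b \<mu> has_derivative D) (at u) \<and> D (L *v u) = (of_nat a * l + of_nat b * cnj l) * zmon a b \<mu> u"
proof -
  have "((\<lambda>u. u $ i) has_derivative (\<lambda>v. v $ i)) (at u)" for i
    by (rule bounded_linear.has_derivative[OF bounded_linear_vec_nth has_derivative_ident])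
  then have z: "(zeta \<mu> has_derivative zeta \<mu>) (at u)"
    unfolding zeta_def by (intro has_derivative_add has_derivative_mult_right bounded_linear.has_derivative[OF bounded_linear_of_real])
  have zc: "((\<lambda>u. cnj (zeta \<mu> u)) has_derivative (\<lambda>v. cnj (zeta \<mu> v))) (at u)"
    by (rule bounded_linear.has_derivative[OF bounded_linear_cnj z])
  have "((\<lambda>u. zeta \<mu> u ^ a * cnj (zeta \<mu> u) ^ b) has_derivative
      (\<lambda>v. zeta \<mu> u ^ a * (of_nat b * cnj (zeta \<mu> v) * cnj (zeta \<mu> u) ^ (b - 1)) + of_nat a * zeta \<mu> v * zeta \<mu> u ^ (a - 1) * cnj (zeta \<mu> u) ^ b)) (at u)"
    by (intro has_derivative_mult has_derivative_power z zc)
  moreover have "zeta \<mu> u ^ a * (of_nat b * cnj (zeta \<mu> (L *v u)) * cnj (zeta \<mu> u) ^ (b - 1)) + of_nat a * zeta \<mu> (L *v u) * zeta \<mu> u ^ (a - 1) * cnj (zeta \<mu> u) ^ b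
      = (of_nat a * l + of_nat b * cnj l) * (zeta \<mu> u ^ a * cnj (zeta \<mu> u) ^ b)"
    unfolding assms by (cases a; cases b) (simp_all add: algebra_simps)
  ultimately show ?thesis unfolding zmon_def by blast
qed

text \<open>On the unit circle, multiplying by \<open>z ^ k\<close> turns
  \<open>z ^ a * cnj z ^ (k - a)\<close> into \<open>(z ^ 2) ^ a\<close>. The relation becomes a
  polynomial in \<open>y = z ^ 2\<close> that vanishes on the whole circle.\<close>

lemma zmon_independent:
  fixes x :: "nat \<Rightarrow> complex ^ 'n::finite"
  assumes \<mu>: "\<mu> \<in> V" and zero: "\<And>u. (\<Sum>a\<le>k. zmon a (k - a) \<mu> u *s x a) = 0" and "a \<le> k"
  shows "x a = 0"
proof -
  have "x a $ i = 0" for i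
  proof (rule ccontr)
    assume "x a $ i \<noteq> 0"
    with \<open>a \<le> k\<close> have fin: "finite {y. (\<Sum>a\<le>k. x a $ i * y ^ a) = 0}"
      using polyfun_finite_roots[where c = "\<lambda>a. x a $ i" and n = k] by blast
    have "sphere 0 1 \<subseteq> {y. (\<Sum>a\<le>k. x a $ i * y ^ a) = 0}"
    proof
      fix y :: complex assume y: "y \<in> sphere 0 1"
      define z where "z = csqrt y"
      have z2: "z\<^sup>2 = y" by (simp add: z_def)
      then have nz: "norm z = 1" using y by (metis mem_sphere_0 norm_power power2_eq_1_iff norm_ge_zero neg_equal_0_iff_equal norm_minus_cancel abs_norm_cancel abs_minus_cancel abs_one)
      have zz: "z * cnj z = 1" using nz by (simp add: complex_norm_square[symmetric])
      obtain u where u: "zeta \<mu> u = z" using zeta_onto[OF \<mu>] by blast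
      have "0 = z ^ k * (\<Sum>a\<le>k. zmon a (k - a) \<mu> u * x a $ i)"
        using arg_cong[OF zero[of u], of "\<lambda>v. v $ i"] by simp
      also have "\<dots> = (\<Sum>a\<le>k. x a $ i * y ^ a)"
        unfolding sum_distrib_left
      proof (intro sum.cong refl)
        fix a assume "a \<in> {..k}"
        then have "z ^ k = z ^ a * z ^ (k - a)" by (simp add: power_add[symmetric])
        then have "z ^ k * zmon a (k - a) \<mu> u = (z * z) ^ a * (z * cnj z) ^ (k - a)"
          by (simp add: zmon_def u power_mult_distrib)
        then show "z ^ k * (zmon a (k - a) \<mu> u * x a $ i) = x a $ i * y ^ a"
          using z2 by (simp add: zz power2_eq_square mult.assoc[symmetric])
      qed
      finally show "y \<in> {y. (\<Sum>a\<le>k. x a $ i * y ^ a) = 0}" by simp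
    qed
    then have "finite (sphere (0::complex) 1)" using fin finite_subset by blast
    moreover have "infinite (sphere (0::complex) 1)"
    proof
      assume "finite (sphere (0::complex) 1)"
      moreover have "connected (sphere (0::complex) 1)" by (rule connected_sphere) simp
      ultimately obtain c where "sphere (0::complex) 1 = {c} \<or> sphere (0::complex) 1 = {}"
        using connected_finite_iff_sing by blast
      moreover have "1 \<in> sphere (0::complex) 1" "-1 \<in> sphere (0::complex) 1" by simp_all
      ultimately show False by (metis empty_iff one_neq_neg_one singletonD)
    qed
    ultimately show False by simp
  qed
  then show ?thesis by (simp add: vec_eq_iff)
qed

text \<open>Solved monomial by monomial. The forcing is projected to the kernel of \<open>P\<close>,
  so applying \<open>P\<close> to the system gives \<open>P h = 0\<close> and what remains is
  \<open>(s - A) h = b\<close>. Taking real parts at the end is legitimate because \<open>A\<close>,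
  \<open>L\<close> and the forcing are real.\<close>

lemma homological_equation_solvable:
  fixes g :: "real ^ 2 \<Rightarrow> real \<Rightarrow> real ^ 'n::finite"
  assumes g: "hom_family r V k g"
    and zL: "\<And>\<mu> u. \<mu> \<in> V \<Longrightarrow> zeta \<mu> (L \<mu> *v u) = l \<mu> * zeta \<mu> u"
    and smooth: "C_k_on r l V" "C_k_on r A V" "C_k_on r P V"
    and proj: "\<And>\<mu>. \<mu> \<in> V \<Longrightarrow> spectral_projection (A \<mu>) (P \<mu>) (\<Lambda> \<mu>)"
    and nonres: "\<And>\<mu> a v. \<mu> \<in> V \<Longrightarrow> a \<le> k \<Longrightarrow> v \<noteq> 0 \<Longrightarrow>
      cmat (A \<mu>) *v v = (of_nat a * l \<mu> + of_nat (k - a) * cnj (l \<mu>)) *s v \<Longrightarrow>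
      of_nat a * l \<mu> + of_nat (k - a) * cnj (l \<mu>) \<in> \<Lambda> \<mu>"
  shows "\<exists>H. hom_family r V k H \<and> (\<forall>\<mu>\<in>V. \<forall>u. P \<mu> *v H u \<mu> = 0 \<and>
    (\<forall>D. ((\<lambda>u. H u \<mu>) has_derivative D) (at u) \<longrightarrow> D (L \<mu> *v u) = A \<mu> *v H u \<mu> + (g u \<mu> - P \<mu> *v g u \<mu>)))"
proof -
  obtain c where c: "\<And>a. C_k_on r (c a) V" "\<forall>\<mu>\<in>V. \<forall>u. cvec (g u \<mu>) = (\<Sum>a\<le>k. zmon a (k - a) \<mu> u *s c a \<mu>)"
    using hom_family_zmon[OF g] by blast
  define s where "s a \<mu> = of_nat a * l \<mu> + of_nat (k - a) * cnj (l \<mu>)" for a \<mu>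
  \<comment> \<open>Spelled out instead of using the locale constant, so that the smoothness rules
    apply to it as a function of \<mu>; on \<open>V\<close> it is the homological matrix.\<close>
  define M where "M a \<mu> = (mat (s a \<mu>) - cmat (A \<mu>)) ** (mat 1 - cmat (P \<mu>)) + cmat (P \<mu>)" for a \<mu>
  define b where "b a \<mu> = c a \<mu> - cmat (P \<mu>) *v c a \<mu>" for a \<mu>
  \<comment> \<open>A pointwise choice suffices: the solution is unique, and Cramer's rule makes it
    smooth.\<close>
  define h where "h a \<mu> = (SOME h. M a \<mu> *v h = b a \<mu>)" for a \<mu>
  have M: "M a \<mu> = spectral_projection.homological_matrix (A \<mu>) (P \<mu>) (s a \<mu>)" if "\<mu> \<in> V" for a \<mu>
    unfolding M_def spectral_projection.homological_matrix_def[OF proj[OF that]] ..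
  have det: "det (M a \<mu>) \<noteq> 0" if "\<mu> \<in> V" "a \<le> k" for a \<mu>
    unfolding M[OF that(1)]
    by (rule spectral_projection.det_homological_matrix[OF proj[OF that(1)]])
      (use nonres[OF that] in \<open>auto simp: s_def\<close>)
  have Mh: "M a \<mu> *v h a \<mu> = b a \<mu>" if "\<mu> \<in> V" "a \<le> k" for a \<mu>
    unfolding h_def by (rule someI_ex) (use cramer[OF det[OF that]] in blast)
  have cm: "C_k_on r (\<lambda>\<mu>. cmat (B \<mu>)) V" if "C_k_on r B V" for B :: "real \<Rightarrow> real ^ 'n ^ 'n"
    by (rule C_k_on_vecI[OF open_V], rule C_k_on_vecI[OF open_V])
      (use that in \<open>auto intro!: C_k_on_linear[OF bounded_linear_of_real] C_k_on_matrix_nth open_V\<close>)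
  have sm: "C_k_on r (s a) V" for a
    unfolding s_def
    by (intro C_k_on_add C_k_on_mult C_k_on_const smooth open_V C_k_on_linear[OF bounded_linear_cnj])
  have Mm: "C_k_on r (M a) V" for a
    unfolding M_def
    by (intro C_k_on_add C_k_on_diff C_k_on_matrix_matrix_mult C_k_on_mat C_k_on_const sm cm smooth open_V)
  have bm: "C_k_on r (b a) V" for a
    unfolding b_def by (intro C_k_on_diff C_k_on_matrix_vector_mult cm smooth open_V c)
  have hm: "C_k_on r (h a) V" if "a \<le> k" for a
    by (rule C_k_on_solve[OF open_V Mm bm]) (use Mh det that in auto)
  define H where "H u \<mu> = (\<Sum>a\<le>k. Re_vec (zmon a (k - a) \<mu> u *s h a \<mu>))" for u \<mu>
  have "hom_family r V k H"
    unfolding H_def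
  proof (rule hom_family_sum[OF open_V])
    show "hom_family r V k (\<lambda>u \<mu>. Re_vec (zmon a (k - a) \<mu> u *s h a \<mu>))" if "a \<in> {..k}" for a
      using hom_family_Re_zmon[OF hm, of a a "k - a"] that by simp
  qed
  moreover have "P \<mu> *v H u \<mu> = 0" and
    "((\<lambda>u. H u \<mu>) has_derivative D) (at u) \<Longrightarrow> D (L \<mu> *v u) = A \<mu> *v H u \<mu> + (g u \<mu> - P \<mu> *v g u \<mu>)"
    if \<mu>: "\<mu> \<in> V" for \<mu> u D
  proof -
    interpret sp: spectral_projection "A \<mu>" "P \<mu>" "\<Lambda> \<mu>" by (rule proj[OF \<mu>])
    have Ph: "cmat (P \<mu>) *v h a \<mu> = 0" if "a \<le> k" for a
      using arg_cong[OF Mh[OF \<mu> that], of "(*v) (cmat (P \<mu>))"]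
      by (simp add: M[OF \<mu>] sp.P_homological_matrix b_def matrix_vector_mult_diff_distrib sp.cmat_P_idem)
    have sA: "s a \<mu> *s h a \<mu> = cmat (A \<mu>) *v h a \<mu> + b a \<mu>" if "a \<le> k" for a
      using Mh[OF \<mu> that] Ph[OF that] by (simp add: M[OF \<mu>] sp.homological_matrix_mult algebra_simps)
    show "P \<mu> *v H u \<mu> = 0"
      by (simp add: H_def matrix_vector_sum Re_vec_mult[symmetric] vector_scalar_commute Ph)
        (simp add: Re_vec_def vec_eq_iff)
    assume D: "((\<lambda>u. H u \<mu>) has_derivative D) (at u)"
    have "\<forall>a. \<exists>D. (zmon a (k - a) \<mu> has_derivative D) (at u) \<and> D (L \<mu> *v u) = s a \<mu> * zmon a (k - a) \<mu> u"
      using zmon_has_derivative[OF zL[OF \<mu>]] unfolding s_def by blast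
    from choice[OF this] obtain Z where "\<forall>a. (zmon a (k - a) \<mu> has_derivative Z a) (at u) \<and> Z a (L \<mu> *v u) = s a \<mu> * zmon a (k - a) \<mu> u"
      by blast
    then have Z: "\<And>a. (zmon a (k - a) \<mu> has_derivative Z a) (at u)" "\<And>a. Z a (L \<mu> *v u) = s a \<mu> * zmon a (k - a) \<mu> u"
      by blast+
    have "((\<lambda>u. H u \<mu>) has_derivative (\<lambda>v. \<Sum>a\<le>k. Re_vec (Z a v *s h a \<mu>))) (at u)"
      unfolding H_def
      by (intro has_derivative_sum bounded_linear.has_derivative[OF bounded_linear_Re_vec]
          bounded_linear.has_derivative[OF bounded_bilinear.bounded_linear_left[OF bounded_bilinear_smult]] Z)
    from has_derivative_unique[OF D this]
    have "D (L \<mu> *v u) = (\<Sum>a\<le>k. Re_vec (Z a (L \<mu> *v u) *s h a \<mu>))" by (rule fun_cong)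
    also have "\<dots> = (\<Sum>a\<le>k. A \<mu> *v Re_vec (zmon a (k - a) \<mu> u *s h a \<mu>) + Re_vec (zmon a (k - a) \<mu> u *s b a \<mu>))"
    proof (intro sum.cong refl)
      fix a assume "a \<in> {..k}"
      then have "Z a (L \<mu> *v u) *s h a \<mu> = zmon a (k - a) \<mu> u *s (cmat (A \<mu>) *v h a \<mu> + b a \<mu>)"
        by (simp add: Z(2) sA[symmetric] vector_smult_assoc mult.commute)
      also have "\<dots> = cmat (A \<mu>) *v (zmon a (k - a) \<mu> u *s h a \<mu>) + zmon a (k - a) \<mu> u *s b a \<mu>"
        by (simp add: vec.scale_right_distrib vector_scalar_commute)
      finally show "Re_vec (Z a (L \<mu> *v u) *s h a \<mu>) = A \<mu> *v Re_vec (zmon a (k - a) \<mu> u *s h a \<mu>) + Re_vec (zmon a (k - a) \<mu> u *s b a \<mu>)"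
        by (simp add: Re_vec_add Re_vec_mult)
    qed
    also have "\<dots> = A \<mu> *v H u \<mu> + Re_vec (\<Sum>a\<le>k. zmon a (k - a) \<mu> u *s b a \<mu>)"
      by (simp add: sum.distrib H_def matrix_vector_sum linear_sum[OF bounded_linear.linear[OF bounded_linear_Re_vec]])
    also have "(\<Sum>a\<le>k. zmon a (k - a) \<mu> u *s b a \<mu>) = cvec (g u \<mu>) - cmat (P \<mu>) *v cvec (g u \<mu>)"
      using c(2) \<mu> by (simp add: b_def vec.scale_right_diff_distrib sum_subtractf matrix_vector_sum vector_scalar_commute)
    also have "\<dots> = cvec (g u \<mu> - P \<mu> *v g u \<mu>)" by (simp add: cmat_mult_cvec cvec_diff)
    finally show "D (L \<mu> *v u) = A \<mu> *v H u \<mu> + (g u \<mu> - P \<mu> *v g u \<mu>)" by (simp add: Re_vec_cvec)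
  qed
  ultimately show ?thesis by blast
qed

text \<open>Independence of the monomials turns \<open>P H = 0\<close> and the equation into
  \<open>P c = 0\<close> and \<open>(s - A) c = 0\<close> for each coefficient. The invertible
  homological matrix therefore annihilates \<open>c\<close>.\<close>

lemma homological_equation_injective:
  fixes H :: "real ^ 2 \<Rightarrow> real ^ 'n::finite"
  assumes \<mu>: "\<mu> \<in> V" and H: "is_hom k H" "\<And>u. P *v H u = 0"
    and D: "\<And>u. (H has_derivative D u) (at u)" "\<And>u. D u (L *v u) = A *v H u"
    and zL: "\<And>u. zeta \<mu> (L *v u) = l * zeta \<mu> u"
    and proj: "spectral_projection A P \<Lambda>"
    and nonres: "\<And>a v. a \<le> k \<Longrightarrow> v \<noteq> 0 \<Longrightarrow>
      cmat A *v v = (of_nat a * l + of_nat (k - a) * cnj l) *s v \<Longrightarrow> of_nat a * l + of_nat (k - a) * cnj l \<in> \<Lambda>"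
  shows "H u = 0"
proof -
  interpret sp: spectral_projection A P \<Lambda> by (rule proj)
  \<comment> \<open>The coordinate frozen at \<mu>, as a family constant in the parameter, makes
    \<open>hom_family_zmon\<close> available for a single polynomial.\<close>
  interpret K: complex_coordinate 0 UNIV "\<lambda>i _. w i \<mu>" "\<lambda>i _. q i \<mu>"
  proof
    show "\<exists>u :: real ^ 2. w 1 \<mu> * of_real (u $ 1) + w 2 \<mu> * of_real (u $ 2) = z" for z by (rule onto[OF \<mu>])
    show "complex_of_real (u $ i) = q i \<mu> * (w 1 \<mu> * of_real (u $ 1) + w 2 \<mu> * of_real (u $ 2)) +
      cnj (q i \<mu> * (w 1 \<mu> * of_real (u $ 1) + w 2 \<mu> * of_real (u $ 2)))" for u :: "real ^ 2" and i
      by (rule coord[OF \<mu>])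
  qed (rule open_UNIV C_k_on_const)+
  have zm: "K.zmon a b x u = zmon a b \<mu> u" for a b x u
    by (simp add: zmon_def K.zmon_def zeta_def K.zeta_def)
  obtain c where "\<forall>x\<in>UNIV. \<forall>u. cvec (H u) = (\<Sum>a\<le>k. K.zmon a (k - a) x u *s c a x)"
    using K.hom_family_zmon[OF iffD1[OF is_hom_iff_family H(1)]] by blast
  then have c: "cvec (H u) = (\<Sum>a\<le>k. zmon a (k - a) \<mu> u *s c a 0)" for u by (simp add: zm)
  define s where "s a = of_nat a * l + of_nat (k - a) * cnj l" for a
  have "(\<Sum>a\<le>k. zmon a (k - a) \<mu> u *s (cmat P *v c a 0)) = 0" for u
    using arg_cong[OF c[of u], of "(*v) (cmat P)"] H(2)
    by (simp add: matrix_vector_sum vector_scalar_commute cmat_mult_cvec cvec_eq_0_iff[THEN iffD2, OF refl])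
  then have Pc: "cmat P *v c a 0 = 0" if "a \<le> k" for a
    using zmon_independent[OF \<mu>, of k "\<lambda>a. cmat P *v c a 0"] that by blast
  have "(\<Sum>a\<le>k. zmon a (k - a) \<mu> u *s (s a *s c a 0 - cmat A *v c a 0)) = 0" for u
  proof -
    have "\<forall>a. \<exists>D. (zmon a (k - a) \<mu> has_derivative D) (at u) \<and> D (L *v u) = s a * zmon a (k - a) \<mu> u"
      using zmon_has_derivative[OF zL] unfolding s_def by blast
    from choice[OF this] obtain Z where "\<forall>a. (zmon a (k - a) \<mu> has_derivative Z a) (at u) \<and> Z a (L *v u) = s a * zmon a (k - a) \<mu> u"
      by blast
    then have Z: "\<And>a. (zmon a (k - a) \<mu> has_derivative Z a) (at u)" "\<And>a. Z a (L *v u) = s a * zmon a (k - a) \<mu> u"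
      by blast+
    have dH: "((\<lambda>u. cvec (H u)) has_derivative (\<lambda>v. cvec (D u v))) (at u)"
      by (rule bounded_linear.has_derivative[OF bounded_linear_cvec D(1)])
    have "((\<lambda>u. cvec (H u)) has_derivative (\<lambda>v. \<Sum>a\<le>k. Z a v *s c a 0)) (at u)"
      unfolding c by (intro has_derivative_sum
          bounded_linear.has_derivative[OF bounded_bilinear.bounded_linear_left[OF bounded_bilinear_smult]] Z)
    from has_derivative_unique[OF dH this]
    have "cvec (D u (L *v u)) = (\<Sum>a\<le>k. Z a (L *v u) *s c a 0)" by (rule fun_cong)
    also have "cvec (D u (L *v u)) = (\<Sum>a\<le>k. zmon a (k - a) \<mu> u *s (cmat A *v c a 0))"
      by (simp add: D(2) cmat_mult_cvec[symmetric] c matrix_vector_sum vector_scalar_commute)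
    finally show ?thesis
      by (simp add: vec.scale_right_diff_distrib sum_subtractf Z(2) vector_smult_assoc mult.commute)
  qed
  then have Ac: "s a *s c a 0 - cmat A *v c a 0 = 0" if "a \<le> k" for a
    using zmon_independent[OF \<mu>, of k "\<lambda>a. s a *s c a 0 - cmat A *v c a 0"] that by blast
  have "c a 0 = 0" if "a \<le> k" for a
  proof (rule ccontr)
    assume "c a 0 \<noteq> 0"
    have "det (sp.homological_matrix (s a)) \<noteq> 0"
      by (rule sp.det_homological_matrix) (use nonres[OF that] in \<open>auto simp: s_def\<close>)
    moreover have "sp.homological_matrix (s a) *v c a 0 = 0"
      using Pc[OF that] Ac[OF that] by (simp add: sp.homological_matrix_mult)
    ultimately show False
      using cramer[of "sp.homological_matrix (s a)" "c a 0" 0] cramer[of "sp.homological_matrix (s a)" 0 0] \<open>c a 0 \<noteq> 0\<close> by simp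
  qed
  then have "cvec (H u) = 0" by (simp add: c)
  then show ?thesis by (simp add: cvec_eq_0_iff)
qed

end

section \<open>Expansions of invariant graphs\<close>

lemma small_at0_dominated:
  assumes "small_at0 q g" "\<forall>\<^sub>F u in nhds 0. norm (f u) \<le> C * norm (g u)" "C \<ge> 0"
  shows "small_at0 q f"
  unfolding small_at0_def
proof (intro allI impI)
  fix e :: real assume "e > 0"
  then have "e / (C + 1) > 0" using assms(3) by simp
  then have "\<forall>\<^sub>F u in nhds 0. norm (g u) \<le> e / (C + 1) * norm u ^ q"
    using assms(1) unfolding small_at0_def by blast
  with assms(2) show "\<forall>\<^sub>F u in nhds 0. norm (f u) \<le> e * norm u ^ q"
  proof eventually_elim
    case (elim u)
    have "C * norm (g u) \<le> (C + 1) * (e / (C + 1) * norm u ^ q)"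
      using elim assms(3) by (intro mult_mono) auto
    also have "\<dots> = e * norm u ^ q"
    proof -
      have "C + 1 \<noteq> 0" using assms(3) by linarith
      then show ?thesis by simp
    qed
    finally show ?case using elim by simp
  qed
qed

lemma mpow_0: "mdeg k \<noteq> 0 \<Longrightarrow> mpow 0 k = 0"
  by (auto simp: mdeg_def mpow_def)

text \<open>The two notions differ only in the value at the origin, and there both sides vanish
  because \<open>g 0 = 0\<close> and no constant term occurs.\<close>

lemma has_expansion_iff_small:
  assumes "1 \<le> p" "g 0 = 0"
  shows "has_expansion g c p q \<longleftrightarrow>
    small_at0 q (\<lambda>u. g u - (\<Sum>k | p \<le> mdeg k \<and> mdeg k \<le> q. mpow u k *\<^sub>R c k))"
proof -
  have "(\<Sum>k | p \<le> mdeg k \<and> mdeg k \<le> q. mpow 0 k *\<^sub>R c k) = 0"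
    using assms(1) by (intro sum.neutral) (auto simp: mpow_0)
  then show ?thesis using assms(2)
    by (auto simp: has_expansion_def small_at0_def smallo_def eventually_nhds_conv_at)
qed

definition midx :: "nat \<Rightarrow> nat \<Rightarrow> 2 \<Rightarrow> nat" where
  "midx a b i = (if i = 1 then a else b)"

lemma midx_simps [simp]: "midx a b 1 = a" "midx a b 2 = b"
  by (auto simp: midx_def)

lemma mdeg_2: "mdeg k = k 1 + k (2::2)"
  by (simp add: mdeg_def sum_2)

lemma mpow_2: "mpow u k = u $ 1 ^ k 1 * u $ 2 ^ k (2::2)"
  by (simp add: mpow_def UNIV_2)

lemma midx_eq: "midx (k 1) (k 2) = k"
  using exhaust_2 by (auto simp: midx_def fun_eq_iff)

lemma multi_index_sum_eq_hom_poly: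
  "(\<Sum>k | p \<le> mdeg k \<and> mdeg k \<le> q. mpow u k *\<^sub>R c k) = (\<Sum>j=p..q. hom_poly j (\<lambda>a. c (midx a (j - a))) u)"
proof -
  have "(\<Sum>j=p..q. hom_poly j (\<lambda>a. c (midx a (j - a))) u) =
      (\<Sum>(j, a)\<in>Sigma {p..q} (\<lambda>j. {..j}). mpow u (midx a (j - a)) *\<^sub>R c (midx a (j - a)))"
    by (simp add: hom_poly_def sum.Sigma mpow_2)
  also have "\<dots> = (\<Sum>k | p \<le> mdeg k \<and> mdeg k \<le> q. mpow u k *\<^sub>R c k)"
    by (rule sum.reindex_bij_witness[where j = "\<lambda>(j, a). midx a (j - a)" and i = "\<lambda>k. (mdeg k, k 1)"])
      (auto simp: mdeg_2 midx_eq)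
  finally show ?thesis by simp
qed

lemma is_hom_hom_poly: "is_hom k (hom_poly k c)"
  by (auto simp: is_hom_def)

text \<open>On the line \<open>(t, 1)\<close> a homogeneous polynomial becomes a polynomial in
  \<open>t\<close> with the same coefficients.\<close>

lemma hom_poly_eq_0_imp:
  fixes c :: "nat \<Rightarrow> real ^ 'n::finite"
  assumes "\<And>u. hom_poly k c u = 0" "a \<le> k"
  shows "c a = 0"
proof -
  have "c a $ i = 0" for i
  proof -
    have "(\<Sum>b\<le>k. c b $ i * t ^ b) = 0" for t
    proof -
      have "hom_poly k c (vector [t, 1]) $ i = (\<Sum>b\<le>k. c b $ i * t ^ b)"
        by (simp add: hom_poly_def mult.commute)
      then show ?thesis by (simp add: assms(1))
    qed
    then show ?thesis using assms(2) polyfun_eq_0[where c = "\<lambda>b. c b $ i" and n = k] by blast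
  qed
  then show ?thesis by (simp add: vec_eq_iff)
qed

lemma expansion_coefficients_unique:
  fixes g g' :: "real ^ 2 \<Rightarrow> real ^ 'n::finite"
  assumes "has_expansion g c 1 q" "has_expansion g' c' 1 q" "g 0 = 0" "g' 0 = 0"
    and "small_at0 q (\<lambda>u. g u - g' u)" and k: "1 \<le> mdeg k" "mdeg k \<le> q"
  shows "c k = c' k"
proof -
  let ?p = "\<lambda>c j. hom_poly j (\<lambda>a. c (midx a (j - a)))"
  have "small_at0 q (\<lambda>u. g u - (\<Sum>j=1..q. ?p c j u))" "small_at0 q (\<lambda>u. g' u - (\<Sum>j=1..q. ?p c' j u))"
    using assms(1-4) by (simp_all add: has_expansion_iff_small multi_index_sum_eq_hom_poly)
  from small_at0_diff[OF small_at0_diff[OF this(2,1)]] assms(5)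
  have "small_at0 q (\<lambda>u. (g' u - (\<Sum>j=1..q. ?p c' j u)) - (g u - (\<Sum>j=1..q. ?p c j u)) + (g u - g' u))"
    using small_at0_add small_at0_diff[OF \<open>small_at0 q (\<lambda>u. g' u - (\<Sum>j=1..q. ?p c' j u))\<close> \<open>small_at0 q (\<lambda>u. g u - (\<Sum>j=1..q. ?p c j u))\<close>] by blast
  then have "small_at0 q (\<lambda>u. \<Sum>j=1..q. ?p c j u - ?p c' j u)"
    by (simp add: sum_subtractf algebra_simps)
  then have "?p c (mdeg k) u - ?p c' (mdeg k) u = 0" for u
    using k by (intro hom_sum_small_imp_zero[of 1 q "\<lambda>j u. ?p c j u - ?p c' j u"] is_hom_diff is_hom_hom_poly) auto
  then have "hom_poly (mdeg k) (\<lambda>a. c (midx a (mdeg k - a)) - c' (midx a (mdeg k - a))) u = 0" for u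
    by (simp add: hom_poly_def scaleR_diff_right sum_subtractf)
  from hom_poly_eq_0_imp[OF this, of "k 1"] show ?thesis by (simp add: mdeg_2 midx_eq)
qed

text \<open>Smallness to order \<open>k\<close> annihilates all parts up to degree \<open>k\<close>,
  so the first part that can survive is that of degree \<open>Suc k\<close>, and it is the leading
  term.\<close>

lemma small_at0_next_coefficient:
  assumes E: "\<And>j. is_hom j (E j)" and exp: "small_at0 q (\<lambda>u. d u - (\<Sum>j=s..q. E j u))"
    and d: "small_at0 k d" and "k < q" "s \<le> Suc k"
  shows "small_at0 (Suc k) (\<lambda>u. d u - E (Suc k) u)"
proof -
  have split: "(\<Sum>j=s..q. E j u) = (\<Sum>j=s..k. E j u) + (\<Sum>j\<in>{k<..q}. E j u)" for u
    using assms(4,5) by (subst sum.union_disjoint[symmetric]) (auto intro!: sum.cong)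
  have "small_at0 k (\<lambda>u. d u - (d u - (\<Sum>j=s..q. E j u)) - (\<Sum>j\<in>{k<..q}. E j u))"
    using assms(4) by (intro small_at0_diff d small_at0_mono[OF exp] small_at0_tail E) auto
  then have "small_at0 k (\<lambda>u. \<Sum>j=s..k. E j u)" by (simp add: split)
  then have zero: "E j u = 0" if "j \<in> {s..k}" for j u
    using hom_sum_small_imp_zero[of s k E] E that by blast
  have split2: "(\<Sum>j\<in>{k<..q}. E j u) = E (Suc k) u + (\<Sum>j\<in>{Suc k<..q}. E j u)" for u
    using assms(4) by (subst sum.remove[of _ "Suc k"]) (auto intro!: sum.cong)
  have "small_at0 (Suc k) (\<lambda>u. (d u - (\<Sum>j=s..q. E j u)) + (\<Sum>j\<in>{Suc k<..q}. E j u))"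
    using assms(4) by (intro small_at0_add small_at0_mono[OF exp] small_at0_tail E) auto
  moreover have "(d u - (\<Sum>j=s..q. E j u)) + (\<Sum>j\<in>{Suc k<..q}. E j u) = d u - E (Suc k) u" for u
    using zero by (simp add: split split2)
  ultimately show ?thesis by simp
qed

lemma is_hom_mult_vec: "is_hom k H \<Longrightarrow> is_hom k (\<lambda>u. A *v H u)" for A :: "real ^ 'n::finite ^ 'm::finite"
  by (rule is_hom_linear[OF matrix_vector_mul_bounded_linear])

lemma small_at0_mult_vec: "small_at0 k f \<Longrightarrow> small_at0 k (\<lambda>u. A *v f u)" for A :: "real ^ 'n::finite ^ 'm::finite"
  by (rule small_at0_linear[OF matrix_vector_mul_bounded_linear])

text \<open>The coefficients of the right-hand side below degree \<open>k + 1\<close> vanish because \<open>d\<close> does not see them.\<close>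

lemma transport_expansion:
  fixes d :: "real ^ 2 \<Rightarrow> real ^ 'n::finite" and A :: "real ^ 'n ^ 'n" and L :: "real ^ 2 ^ 2"
  assumes d: "\<forall>\<^sub>F u in nhds 0. (d has_derivative d' u) (at u)"
    and R: "small_at0 1 (\<lambda>u. R u - L *v u)"
    and B: "\<And>j. is_hom j (B j)" "small_at0 (Suc k) (\<lambda>u. d' u (R u) - A *v d u - (\<Sum>j=1..Suc k. B j u))"
    and H: "is_hom (Suc k) H" "small_at0 k d" "small_at0 (Suc k) (\<lambda>u. d u - H u)" "(H has_derivative H') (at u)"
  shows "H' (L *v u) = A *v H u + B (Suc k) u"
proof -
  have L: "bounded_linear ((*v) L)" by simp
  have zero: "B j u = 0" if "1 \<le> j" "j \<le> k" for j u
    using that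
  proof (induction j arbitrary: u rule: less_induct)
    case (less j)
    have split: "(\<Sum>i=1..Suc k. B i u) = B j u + (\<Sum>i\<in>{j<..Suc k}. B i u)" for u
    proof -
      have "(\<Sum>i=1..Suc k. B i u) = (\<Sum>i\<in>{1..<j} \<union> {j} \<union> {j<..Suc k}. B i u)"
        using less.prems by (intro sum.cong) auto
      also have "\<dots> = B j u + (\<Sum>i\<in>{j<..Suc k}. B i u)"
        using less by (subst sum.union_disjoint) auto
      finally show ?thesis .
    qed
    have dj: "small_at0 j d" by (rule small_at0_mono[OF H(2) less.prems(2)])
    have "small_at0 j (\<lambda>u. (d' u (R u) - A *v d u - (\<Sum>i=1..Suc k. B i u)) + A *v d u + (\<Sum>i\<in>{j<..Suc k}. B i u))"
      using less.prems by (intro small_at0_add small_at0_mono[OF B(2)] small_at0_mult_vec dj small_at0_tail B(1)) auto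
    moreover have "(d' u (R u) - A *v d u - (\<Sum>i=1..Suc k. B i u)) + A *v d u + (\<Sum>i\<in>{j<..Suc k}. B i u) = d' u (R u) - B j u" for u
      unfolding split by simp
    ultimately have rhs: "small_at0 j (\<lambda>u. d' u (R u) - B j u)" by (simp only:)
    have "small_at0 j (\<lambda>u. d u - 0)" using dj by simp
    from transport_limit[OF d is_hom_zero B(1) L this rhs R has_derivative_const] show ?case by simp
  qed
  have "(\<Sum>i=1..Suc k. B i u) = B (Suc k) u" for u
    using zero by (simp add: sum.atLeast_Suc_atMost)
  then have "small_at0 (Suc k) (\<lambda>u. (d' u (R u) - A *v d u - B (Suc k) u) + A *v (d u - H u))"
    using B(2) by (intro small_at0_add small_at0_mult_vec H) simp
  then have "small_at0 (Suc k) (\<lambda>u. d' u (R u) - (A *v H u + B (Suc k) u))"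
    by (simp add: matrix_vector_mult_diff_distrib algebra_simps)
  then show ?thesis
    by (intro transport_limit[OF d H(1) is_hom_add[OF is_hom_mult_vec[OF H(1)] B(1)] L H(3) _ R H(4)])
qed

section \<open>Invariant graphs at a fixed parameter value\<close>

locale ssm_setting = spectral_plane A P \<alpha> \<omega> S
  for A P :: "real ^ 'n ^ 'n::finite" and \<alpha> \<omega> :: real and S :: "real ^ 2 ^ 'n" +
  fixes g :: "real ^ 'n \<Rightarrow> real ^ 'n" and X :: "(real ^ 'n) set" and q :: nat
  assumes g0: "g 0 = 0"
    and quadratic: "\<exists>C\<ge>0. \<exists>\<rho>>0. \<forall>x y. norm x < \<rho> \<longrightarrow> norm y < \<rho> \<longrightarrow> norm (g x - g y) \<le> C * (norm x + norm y) * norm (x - y)"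
    and q: "1 \<le> q"
begin

abbreviation "ssm \<equiv> spectral_submanifold A g X P S q"

text \<open>The graph condition leaves \<open>S u\<close> after applying \<open>P\<close> to
  \<open>W\<close>. Uniqueness of homogeneous parts then puts every coefficient of degree at least 2
  into the kernel of \<open>P\<close>.\<close>

lemma ssm_expansion:
  assumes "ssm W R"
  shows "\<exists>C. (\<forall>j. is_hom j (C j)) \<and> C 1 = (*v) S \<and> small_at0 q (\<lambda>u. W u - (\<Sum>j=1..q. C j u)) \<and>
    (\<forall>j\<in>{2..q}. \<forall>u. P *v C j u = 0)"
proof -
  obtain c where W0: "W 0 = 0" and c: "has_expansion (\<lambda>u. W u - S *v u) c 2 q"
    using assms unfolding spectral_submanifold_def by blast
  define C where "C j = (if j = 1 then (*v) S else hom_poly j (\<lambda>a. c (midx a (j - a))))" for j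
  have "is_hom 1 (\<lambda>u. S *v u)"
  proof -
    have "hom_poly 1 (\<lambda>a. if a = 1 then column 1 S else column 2 S) u = S *v u" for u
      by (simp add: hom_poly_def matrix_mult_sum sum_2 scalar_mult_eq_scaleR)
    then show ?thesis unfolding is_hom_def
      by (intro exI[of _ "\<lambda>a. if a = 1 then column 1 S else column 2 S"] ext) (rule sym)
  qed
  then have hom: "is_hom j (C j)" for j by (auto simp: C_def is_hom_hom_poly)
  have "small_at0 q (\<lambda>u. W u - S *v u - (\<Sum>j=2..q. hom_poly j (\<lambda>a. c (midx a (j - a))) u))"
    using has_expansion_iff_small[of 2 "\<lambda>u. W u - S *v u" c q] c W0 by (simp add: multi_index_sum_eq_hom_poly)
  moreover have "(\<Sum>j=2..q. hom_poly j (\<lambda>a. c (midx a (j - a))) u) = (\<Sum>j=2..q. C j u)" for u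
    by (intro sum.cong) (auto simp: C_def)
  moreover have "(\<Sum>j=1..q. C j u) = S *v u + (\<Sum>j=2..q. C j u)" for u
    using q by (simp add: sum.atLeast_Suc_atMost C_def numeral_2_eq_2)
  ultimately have exp: "small_at0 q (\<lambda>u. W u - (\<Sum>j=1..q. C j u))" by (simp add: algebra_simps)
  have PW: "\<forall>\<^sub>F u in nhds 0. P *v W u = S *v u"
    using assms unfolding spectral_submanifold_def eventually_nhds by blast
  have "small_at0 q (\<lambda>u. - (P *v (W u - (\<Sum>j=1..q. C j u))))"
    by (intro small_at0_minus small_at0_mult_vec exp)
  then have "small_at0 q (\<lambda>u. \<Sum>j=2..q. P *v C j u)"
  proof (rule small_at0_cong[rotated])
    show "\<forall>\<^sub>F u in nhds 0. - (P *v (W u - (\<Sum>j=1..q. C j u))) = (\<Sum>j=2..q. P *v C j u)"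
      using PW
    proof eventually_elim
      case (elim u)
      then show ?case
        using \<open>(\<Sum>j=1..q. C j u) = S *v u + (\<Sum>j=2..q. C j u)\<close>
        by (simp add: matrix_vector_mult_diff_distrib matrix_vector_right_distrib P_S matrix_vector_sum)
    qed
  qed
  then have "P *v C j u = 0" if "j \<in> {2..q}" for j u
    using hom_sum_small_imp_zero[of 2 q "\<lambda>j u. P *v C j u"] that is_hom_mult_vec[OF hom] by blast
  then show ?thesis using hom exp by (intro exI[of _ C]) (simp add: C_def)
qed

text \<open>\<open>P\<close> commutes with \<open>A\<close> and \<open>S\<close> is injective, so
  the equation for \<open>R\<close> can be solved: \<open>R\<close> is linear plus a linear image of
  the nonlinearity along \<open>W\<close>.\<close>

lemma ssm_near:
  assumes "ssm W R"
  shows "\<forall>\<^sub>F u in nhds 0. (W has_derivative frechet_derivative W (at u)) (at u) \<and>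
    frechet_derivative W (at u) (R u) = A *v W u + g (W u) \<and>
    R u = reduced_matrix *v u + left_inverse *v g (W u)"
proof -
  obtain D where D: "open D" "0 \<in> D" "C_k_on 1 W D" and near: "\<forall>u\<in>D. P *v W u = S *v u \<and>
      S *v R u = P *v (A *v W u + g (W u)) \<and> frechet_derivative W (at u) (R u) = A *v W u + g (W u)"
    using assms unfolding spectral_submanifold_def by blast
  have "R u = reduced_matrix *v u + left_inverse *v g (W u)" if "u \<in> D" for u
  proof -
    have "S *v R u = A *v (P *v W u) + P *v g (W u)"
      using near that by (simp add: matrix_vector_right_distrib P_commute)
    also have "\<dots> = S *v (reduced_matrix *v u + left_inverse *v g (W u))"
      using near that by (simp add: matrix_vector_right_distrib A_S_vec S_left_inverse)
    finally show ?thesis by (simp only: S_cancel)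
  qed
  moreover have "(W has_derivative frechet_derivative W (at u)) (at u)" if "u \<in> D" for u
    using C_k_on_SucD[of 0 W D u] D(3) that by simp
  ultimately show ?thesis unfolding eventually_nhds using D(1,2) near by blast
qed

text \<open>Continuity of the two partial derivatives at 0 bounds the whole derivative nearby. The
  bound is used where the derivative of one parametrization acts on the small vector
  \<open>R - R'\<close>.\<close>

lemma ssm_derivative_bounded:
  assumes "ssm W R"
  shows "\<exists>K\<ge>0. \<forall>\<^sub>F u in nhds 0. \<forall>v. norm (frechet_derivative W (at u) v) \<le> K * norm v"
proof -
  obtain D where D: "open D" "0 \<in> D" "C_k_on 1 W D"
    using assms unfolding spectral_submanifold_def by blast
  have "\<forall>\<^sub>F u in nhds 0. norm (frechet_derivative W (at u) (axis i 1)) < norm (frechet_derivative W (at 0) (axis i 1)) + 1" for i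
  proof -
    have "continuous_on D (\<lambda>u. norm (frechet_derivative W (at u) (axis i 1)))"
      using D(3) by (auto intro: continuous_on_norm)
    then have "isCont (\<lambda>u. norm (frechet_derivative W (at u) (axis i 1))) 0"
      using D(1,2) by (simp add: continuous_on_eq_continuous_at)
    then have "((\<lambda>u. norm (frechet_derivative W (at u) (axis i 1))) \<longlongrightarrow> norm (frechet_derivative W (at 0) (axis i 1))) (nhds 0)"
      unfolding isCont_def by (rule tendsto_at_iff_tendsto_nhds[THEN iffD1])
    then show ?thesis by (rule order_tendstoD) simp
  qed
  from this[of 1] this[of 2] eventually_nhds_in_open[OF D(1,2)]
  have "\<forall>\<^sub>F u in nhds 0. \<forall>v. norm (frechet_derivative W (at u) v) \<le>
     (norm (frechet_derivative W (at 0) (axis 1 1)) + 1 + (norm (frechet_derivative W (at 0) (axis 2 1)) + 1)) * norm v"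
  proof eventually_elim
    case (elim u)
    let ?D = "frechet_derivative W (at u)"
    have lin: "linear ?D" using C_k_on_SucD[of 0 W D u] D(3) elim(3) has_derivative_linear by simp
    show ?case
    proof
      fix v :: "real ^ 2"
      have "v = v $ 1 *\<^sub>R axis 1 1 + v $ 2 *\<^sub>R axis 2 1"
        by (simp add: vec_eq_iff forall_2 axis_def)
      then have "?D v = v $ 1 *\<^sub>R ?D (axis 1 1) + v $ 2 *\<^sub>R ?D (axis 2 1)"
        using linear_add[OF lin] linear_scale[OF lin] by metis
      then have "norm (?D v) \<le> \<bar>v $ 1\<bar> * norm (?D (axis 1 1)) + \<bar>v $ 2\<bar> * norm (?D (axis 2 1))"
        by (metis norm_scaleR norm_triangle_ineq)
      also have "\<dots> \<le> norm v * (norm (frechet_derivative W (at 0) (axis 1 1)) + 1) + norm v * (norm (frechet_derivative W (at 0) (axis 2 1)) + 1)"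
        using elim component_le_norm_cart[of v] by (intro add_mono mult_mono) auto
      finally show "norm (?D v) \<le> (norm (frechet_derivative W (at 0) (axis 1 1)) + 1 + (norm (frechet_derivative W (at 0) (axis 2 1)) + 1)) * norm v"
        by (simp add: algebra_simps)
    qed
  qed
  then show ?thesis by (intro exI[of _ "norm (frechet_derivative W (at 0) (axis 1 1)) + 1 + (norm (frechet_derivative W (at 0) (axis 2 1)) + 1)"]) simp
qed

lemma ssm_big:
  assumes "ssm W R"
  shows "big_at0 1 W"
proof -
  obtain C where C: "\<And>j. is_hom j (C j)" "small_at0 q (\<lambda>u. W u - (\<Sum>j=1..q. C j u))"
    using ssm_expansion[OF assms] by blast
  have "big_at0 1 (\<lambda>u. (W u - (\<Sum>j=1..q. C j u)) + (\<Sum>j=1..q. C j u))"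
    using q by (intro big_at0_add big_at0_sum big_at0_mono[OF small_at0_imp_big[OF C(2)]] big_at0_mono[OF is_hom_big[OF C(1)]]) auto
  then show ?thesis by simp
qed

lemma nonlinearity_difference:
  assumes W: "big_at0 1 W" "big_at0 1 W'"
  shows "\<exists>C\<ge>0. \<forall>\<^sub>F u in nhds 0. norm (g (W u) - g (W' u)) \<le> C * norm ((norm (W u) + norm (W' u)) * norm (W u - W' u))"
proof -
  obtain C \<rho> where C: "C \<ge> 0" "\<rho> > 0"
    "\<forall>x y. norm x < \<rho> \<longrightarrow> norm y < \<rho> \<longrightarrow> norm (g x - g y) \<le> C * (norm x + norm y) * norm (x - y)"
    using quadratic by blast
  have "\<forall>\<^sub>F u in nhds 0. dist (W u) 0 < \<rho>" "\<forall>\<^sub>F u in nhds 0. dist (W' u) 0 < \<rho>"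
    using big_at0_tendsto_0[OF W(1)] big_at0_tendsto_0[OF W(2)] C(2) by (auto dest: tendstoD)
  then have "\<forall>\<^sub>F u in nhds 0. norm (g (W u) - g (W' u)) \<le> C * norm ((norm (W u) + norm (W' u)) * norm (W u - W' u))"
    by eventually_elim (use C(3) in \<open>simp add: mult.assoc\<close>)
  with C(1) show ?thesis by blast
qed

lemma big_at0_norm: "big_at0 k f \<Longrightarrow> big_at0 k (\<lambda>u. norm (f u))"
  by (simp add: big_at0_def)

lemma small_at0_norm: "small_at0 k f \<Longrightarrow> small_at0 k (\<lambda>u. norm (f u))"
  by (simp add: small_at0_def)

text \<open>The factor \<open>norm (W u) + norm (W' u)\<close> in the quadratic estimate is of order
  1 and supplies the gain of one order.\<close>

lemma nonlinearity_difference_small: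
  assumes W: "big_at0 1 W" "big_at0 1 W'" and d: "small_at0 k (\<lambda>u. W u - W' u)"
  shows "small_at0 (Suc k) (\<lambda>u. g (W u) - g (W' u))"
proof -
  have "small_at0 (1 + k) (\<lambda>u. (norm (W u) + norm (W' u)) * norm (W u - W' u))"
    by (intro small_at0_bilinear_right[OF bounded_bilinear_mult] big_at0_add big_at0_norm small_at0_norm W d)
  then show ?thesis using nonlinearity_difference[OF W] small_at0_dominated by fastforce
qed

lemma nonlinearity_big:
  assumes W: "big_at0 1 W"
  shows "big_at0 2 (\<lambda>u. g (W u))"
proof -
  obtain C where C: "C \<ge> 0" "\<forall>\<^sub>F u in nhds 0. norm (g (W u) - g 0) \<le> C * norm ((norm (W u) + norm (0 :: real ^ 'n)) * norm (W u - 0))"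
    using nonlinearity_difference[OF W big_at0_zero] by blast
  have "big_at0 (1 + 1) (\<lambda>u. (norm (W u) + norm (0 :: real ^ 'n)) * norm (W u - 0))"
    using W by (intro big_at0_bilinear[OF bounded_bilinear_mult]) (simp_all add: big_at0_norm)
  from big_at0_dominated[OF this _ C(1), of "\<lambda>u. g (W u)"] C(2) show ?thesis by (simp add: g0 numeral_2_eq_2)
qed

lemma ssm_reduced_small:
  assumes "ssm W R"
  shows "small_at0 1 (\<lambda>u. R u - reduced_matrix *v u)"
proof (rule small_at0_cong)
  show "small_at0 1 (\<lambda>u. left_inverse *v g (W u))"
    using nonlinearity_big[OF ssm_big[OF assms]] by (intro small_at0_mult_vec big_at0_imp_small[of 2]) auto
  show "\<forall>\<^sub>F u in nhds 0. left_inverse *v g (W u) = R u - reduced_matrix *v u"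
    using ssm_near[OF assms] by eventually_elim simp
qed

lemma ssm_zero:
  assumes "ssm W R"
  shows "W 0 = 0" "R 0 = 0"
proof -
  show "W 0 = 0" using assms unfolding spectral_submanifold_def by blast
  with eventually_nhds_x_imp_x[OF ssm_near[OF assms]] show "R 0 = 0" by (simp add: g0)
qed

end

section \<open>Families of spectral submanifolds\<close>

lemma C_k_on_column:
  fixes M :: "real \<Rightarrow> real ^ 'm ^ 'n"
  assumes "open V" "C_k_on r M V"
  shows "C_k_on r (\<lambda>\<mu>. column i (M \<mu>)) V"
  by (rule C_k_on_vecI[OF assms(1)]) (auto simp: column_def intro!: C_k_on_matrix_nth assms)

lemma matrix_vector_mult_sum_columns: "M *v x = (\<Sum>i\<in>UNIV. (x $ i) *\<^sub>R column i M)"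
  for M :: "real ^ 'm ^ 'n"
  by (simp add: matrix_mult_sum scalar_mult_eq_scaleR)

lemma hom_family_mult_vec_ident:
  fixes M :: "real \<Rightarrow> real ^ 2 ^ 'n"
  assumes "open V" "C_k_on r M V"
  shows "hom_family r V 1 (\<lambda>u \<mu>. M \<mu> *v u)"
proof -
  have "hom_family r V (1 + 0) (\<lambda>u \<mu>. (u $ i) *\<^sub>R column i (M \<mu>))" for i
    by (intro hom_family_bilinear[OF assms(1) bounded_bilinear_scaleR] hom_family_nth hom_family_const C_k_on_column assms)
  then show ?thesis unfolding matrix_vector_mult_sum_columns by (intro hom_family_sum assms(1)) simp
qed

lemma expands_mult_vec:
  fixes M :: "real \<Rightarrow> real ^ 'm ^ 'n"
  assumes V: "open V" "\<forall>z\<in>\<Omega>. fst z \<in> V" and M: "C_k_on r M V" and p: "expands r V \<Omega> s q p" "s \<le> q"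
  shows "expands r V \<Omega> s q (\<lambda>z u. M (fst z) *v p z u)"
proof -
  have "expands r V \<Omega> (s + 0) (min (q + 0) (q + s)) (\<lambda>z u. (p z u $ i) *\<^sub>R column i (M (fst z)))" for i
    by (intro expands_bilinear[OF V bounded_bilinear_scaleR] expands_linear[OF V bounded_linear_vec_nth]
        expands_const[OF V] C_k_on_column[OF V(1) M] p) auto
  then show ?thesis unfolding matrix_vector_mult_sum_columns by (intro expands_sum[OF V]) simp_all
qed

lemma inverse_2i_mult:
  "W \<noteq> 0 \<Longrightarrow> 1 / (2 * \<i> * complex_of_real W) * z = Complex (Im z / (2 * W)) (- Re z / (2 * W))"
  by (simp add: complex_eq_iff Re_divide Im_divide power2_eq_square field_simps)

text \<open>Smoothness is assumed of \<open>A\<close> and \<open>S\<close>; that of \<alpha>, of the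
  absolute value of \<omega> and of \<open>P\<close> is derived from them. Non-resonance is stated
  for the eigenvalue with positive imaginary part and permits sums that fall on the spectrum of the
  plane itself.\<close>

locale ssm_family =
  fixes r :: nat and V :: "real set" and A P :: "real \<Rightarrow> real ^ 'n ^ 'n::finite" and S :: "real \<Rightarrow> real ^ 2 ^ 'n"
    and \<alpha> \<omega> :: "real \<Rightarrow> real" and g :: "real \<Rightarrow> real ^ 'n \<Rightarrow> real ^ 'n" and X :: "real \<Rightarrow> (real ^ 'n) set" and q :: nat
  assumes V: "open V"
    and A_smooth: "C_k_on r A V" and S_smooth: "C_k_on r S V"
    and setting: "\<mu> \<in> V \<Longrightarrow> ssm_setting (A \<mu>) (P \<mu>) (\<alpha> \<mu>) (\<omega> \<mu>) (S \<mu>) (g \<mu>) q"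
    and nonresonant: "\<mu> \<in> V \<Longrightarrow> 2 \<le> k \<Longrightarrow> k \<le> q \<Longrightarrow> a \<le> k \<Longrightarrow> v \<noteq> 0 \<Longrightarrow>
      cmat (A \<mu>) *v v = (of_nat a * Complex (\<alpha> \<mu>) \<bar>\<omega> \<mu>\<bar> + of_nat (k - a) * cnj (Complex (\<alpha> \<mu>) \<bar>\<omega> \<mu>\<bar>)) *s v \<Longrightarrow>
      of_nat a * Complex (\<alpha> \<mu>) \<bar>\<omega> \<mu>\<bar> + of_nat (k - a) * cnj (Complex (\<alpha> \<mu>) \<bar>\<omega> \<mu>\<bar>)
        \<in> {Complex (\<alpha> \<mu>) (\<omega> \<mu>), Complex (\<alpha> \<mu>) (- \<omega> \<mu>)}"
begin

lemma plane: "\<mu> \<in> V \<Longrightarrow> spectral_plane (A \<mu>) (P \<mu>) (\<alpha> \<mu>) (\<omega> \<mu>) (S \<mu>)"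
  by (rule ssm_setting.axioms(1)[OF setting])

lemma projection: "\<mu> \<in> V \<Longrightarrow> spectral_projection (A \<mu>) (P \<mu>) {Complex (\<alpha> \<mu>) (\<omega> \<mu>), Complex (\<alpha> \<mu>) (- \<omega> \<mu>)}"
  by (rule spectral_plane.axioms(1)[OF plane])

definition "L \<mu> = spectral_plane.reduced_matrix (A \<mu>) (S \<mu>)"
definition "T \<mu> = spectral_plane.left_inverse (P \<mu>) (S \<mu>)"
definition "l \<mu> = Complex (\<alpha> \<mu>) \<bar>\<omega> \<mu>\<bar>"

lemma L_trace: "\<mu> \<in> V \<Longrightarrow> L \<mu> $ 1 $ 1 + L \<mu> $ 2 $ 2 = 2 * \<alpha> \<mu>"
  and L_det: "\<mu> \<in> V \<Longrightarrow> det (L \<mu>) = (\<alpha> \<mu>)\<^sup>2 + (\<omega> \<mu>)\<^sup>2"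
  and A_S: "\<mu> \<in> V \<Longrightarrow> A \<mu> ** S \<mu> = S \<mu> ** L \<mu>"
  and P_factor: "\<mu> \<in> V \<Longrightarrow> P \<mu> = S \<mu> ** T \<mu>"
  and det_gram: "\<mu> \<in> V \<Longrightarrow> det (transpose (S \<mu>) ** S \<mu>) \<noteq> 0"
  and omega: "\<mu> \<in> V \<Longrightarrow> \<omega> \<mu> \<noteq> 0"
proof -
  assume \<mu>: "\<mu> \<in> V"
  interpret spectral_plane "A \<mu>" "P \<mu>" "\<alpha> \<mu>" "\<omega> \<mu>" "S \<mu>" by (rule plane[OF \<mu>])
  show "L \<mu> $ 1 $ 1 + L \<mu> $ 2 $ 2 = 2 * \<alpha> \<mu>" "det (L \<mu>) = (\<alpha> \<mu>)\<^sup>2 + (\<omega> \<mu>)\<^sup>2" "A \<mu> ** S \<mu> = S \<mu> ** L \<mu>"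
    unfolding L_def by (rule reduced_trace, rule reduced_det, rule A_S)
  show "P \<mu> = S \<mu> ** T \<mu>" unfolding T_def by (rule P_factor)
  show "det (transpose (S \<mu>) ** S \<mu>) \<noteq> 0" by (rule det_transpose_mult_self[OF inj_S])
  show "\<omega> \<mu> \<noteq> 0" by (rule \<omega>)
qed

lemma gram_smooth: "C_k_on r (\<lambda>\<mu>. transpose (S \<mu>) ** S \<mu>) V"
  by (intro C_k_on_matrix_matrix_mult C_k_on_transpose V S_smooth)

lemma L_smooth: "C_k_on r L V"
proof (rule C_k_on_solve_matrix[OF V gram_smooth _ _ det_gram])
  show "C_k_on r (\<lambda>\<mu>. transpose (S \<mu>) ** (A \<mu> ** S \<mu>)) V"
    by (intro C_k_on_matrix_matrix_mult C_k_on_transpose V S_smooth A_smooth)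
  show "transpose (S \<mu>) ** S \<mu> ** L \<mu> = transpose (S \<mu>) ** (A \<mu> ** S \<mu>)" if "\<mu> \<in> V" for \<mu>
    by (simp add: A_S[OF that] matrix_mul_assoc)
qed

lemma alpha_smooth: "C_k_on r \<alpha> V"
proof (rule C_k_on_cong_imp[OF V])
  show "C_k_on r (\<lambda>\<mu>. (L \<mu> $ 1 $ 1 + L \<mu> $ 2 $ 2) / 2) V"
    by (intro C_k_on_divide C_k_on_add C_k_on_const C_k_on_matrix_nth V L_smooth) simp
  show "(L \<mu> $ 1 $ 1 + L \<mu> $ 2 $ 2) / 2 = \<alpha> \<mu>" if "\<mu> \<in> V" for \<mu> using L_trace[OF that] by simp
qed

text \<open>The radicand is the square of \<omega> and never 0, so its root is smooth whatever the
  sign of \<omega> does.\<close>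

lemma abs_omega_smooth: "C_k_on r (\<lambda>\<mu>. \<bar>\<omega> \<mu>\<bar>) V"
proof (rule C_k_on_cong_imp[OF V])
  show "C_k_on r (\<lambda>\<mu>. sqrt (det (L \<mu>) - (\<alpha> \<mu>)\<^sup>2)) V"
    by (intro C_k_on_sqrt C_k_on_diff C_k_on_det C_k_on_power V L_smooth alpha_smooth) (simp add: L_det omega)
  show "sqrt (det (L \<mu>) - (\<alpha> \<mu>)\<^sup>2) = \<bar>\<omega> \<mu>\<bar>" if "\<mu> \<in> V" for \<mu> using L_det[OF that] by simp
qed

lemma l_smooth: "C_k_on r l V"
proof (rule C_k_on_cong_imp[OF V])
  show "C_k_on r (\<lambda>\<mu>. complex_of_real (\<alpha> \<mu>) + \<i> * complex_of_real \<bar>\<omega> \<mu>\<bar>) V"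
    by (intro C_k_on_add C_k_on_mult C_k_on_const C_k_on_linear[OF bounded_linear_of_real] V alpha_smooth abs_omega_smooth)
  show "complex_of_real (\<alpha> \<mu>) + \<i> * complex_of_real \<bar>\<omega> \<mu>\<bar> = l \<mu>" for \<mu> by (simp add: l_def complex_eq_iff)
qed

lemma P_smooth: "C_k_on r P V"
proof -
  \<comment> \<open>\<open>det (L \<mu>)\<close> stands in for the sum of the squares of \<alpha>
    and \<omega>, so that every entry is visibly smooth.\<close>
  define B where "B \<mu> = A \<mu> ** A \<mu> - (2 * \<alpha> \<mu>) *\<^sub>R A \<mu> + det (L \<mu>) *\<^sub>R mat 1 + S \<mu> ** transpose (S \<mu>)" for \<mu>
  have B: "B \<mu> = spectral_plane.proj_matrix (A \<mu>) (\<alpha> \<mu>) (\<omega> \<mu>) (S \<mu>)" if "\<mu> \<in> V" for \<mu>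
    unfolding B_def spectral_plane.proj_matrix_def[OF plane[OF that]] spectral_plane.char_matrix_def[OF plane[OF that]]
    by (simp add: L_det[OF that])
  have B_smooth: "C_k_on r B V"
    unfolding B_def
    by (intro C_k_on_add C_k_on_diff C_k_on_scaleR C_k_on_mult C_k_on_const C_k_on_matrix_matrix_mult C_k_on_transpose C_k_on_det
        V A_smooth alpha_smooth L_smooth S_smooth)
  \<comment> \<open>The unknown \<open>P\<close> is the left factor in the equation; transposing
    moves it to the right, where the linear solver expects it.\<close>
  have "C_k_on r (\<lambda>\<mu>. transpose (P \<mu>)) V"
  proof (rule C_k_on_solve_matrix[OF V C_k_on_transpose[OF V B_smooth]])
    show "C_k_on r (\<lambda>\<mu>. transpose (S \<mu> ** transpose (S \<mu>))) V"
      by (intro C_k_on_matrix_matrix_mult C_k_on_transpose V S_smooth)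
    show "transpose (B \<mu>) ** transpose (P \<mu>) = transpose (S \<mu> ** transpose (S \<mu>))" if "\<mu> \<in> V" for \<mu>
      using spectral_plane.P_proj_matrix[OF plane[OF that]] by (simp only: matrix_transpose_mul[symmetric] B[OF that])
    show "det (transpose (B \<mu>)) \<noteq> 0" if "\<mu> \<in> V" for \<mu>
      using spectral_plane.det_proj_matrix[OF plane[OF that]] by (simp add: det_transpose B[OF that])
  qed
  from C_k_on_transpose[OF V this] show ?thesis by simp
qed

lemma T_smooth: "C_k_on r T V"
proof (rule C_k_on_solve_matrix[OF V gram_smooth _ _ det_gram])
  show "C_k_on r (\<lambda>\<mu>. transpose (S \<mu>) ** P \<mu>) V"
    by (intro C_k_on_matrix_matrix_mult C_k_on_transpose V S_smooth P_smooth)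
  show "transpose (S \<mu>) ** S \<mu> ** T \<mu> = transpose (S \<mu>) ** P \<mu>" if "\<mu> \<in> V" for \<mu>
    using P_factor[OF that] by (simp add: matrix_mul_assoc)
qed

text \<open>Coefficients of the left eigenvector \<open>(L\<^sub>2\<^sub>1, l - L\<^sub>1\<^sub>1)\<close> of \<open>L\<close> for \<open>l\<close>, and of the inverse change of coordinates.\<close>

definition wc :: "2 \<Rightarrow> real \<Rightarrow> complex" where
  "wc i \<mu> = (if i = 1 then of_real (L \<mu> $ 2 $ 1) else l \<mu> - of_real (L \<mu> $ 1 $ 1))"

definition qc :: "2 \<Rightarrow> real \<Rightarrow> complex" where
  "qc i \<mu> = (if i = 1
     then 1 / of_real (2 * L \<mu> $ 2 $ 1) - of_real ((\<alpha> \<mu> - L \<mu> $ 1 $ 1) / L \<mu> $ 2 $ 1) * (1 / (2 * \<i> * of_real \<bar>\<omega> \<mu>\<bar>))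
     else 1 / (2 * \<i> * of_real \<bar>\<omega> \<mu>\<bar>))"

lemma L_char: "\<mu> \<in> V \<Longrightarrow> L \<mu> $ 1 $ 2 * L \<mu> $ 2 $ 1 = - (\<alpha> \<mu> - L \<mu> $ 1 $ 1)\<^sup>2 - (\<omega> \<mu>)\<^sup>2"
  using L_trace[of \<mu>] L_det[of \<mu>] unfolding det_2 power2_eq_square by algebra

text \<open>The product of the off-diagonal entries is minus a sum of squares, one of them nonzero.
  Hence one formula for the left eigenvector works at every parameter, without a case
  distinction.\<close>

lemma L21: "\<mu> \<in> V \<Longrightarrow> L \<mu> $ 2 $ 1 \<noteq> 0"
proof
  assume \<mu>: "\<mu> \<in> V" and "L \<mu> $ 2 $ 1 = 0"
  then have "L \<mu> $ 1 $ 2 * L \<mu> $ 2 $ 1 = 0" by simp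
  then have "(\<alpha> \<mu> - L \<mu> $ 1 $ 1)\<^sup>2 + (\<omega> \<mu>)\<^sup>2 = 0" using L_char[OF \<mu>] by linarith
  then show False using omega[OF \<mu>] by (simp add: sum_power2_eq_zero_iff)
qed

sublocale complex_coordinate r V wc qc
proof
  show "open V" by (rule V)
  show "C_k_on r (wc i) V" for i
  proof (cases "i = 1")
    case True
    then show ?thesis unfolding wc_def
      by (auto intro!: C_k_on_linear[OF bounded_linear_of_real] C_k_on_matrix_nth V L_smooth)
  next
    case False
    then show ?thesis unfolding wc_def
      by (auto intro!: C_k_on_diff C_k_on_linear[OF bounded_linear_of_real] C_k_on_matrix_nth V L_smooth l_smooth)
  qed
  have om: "C_k_on r (\<lambda>\<mu>. 1 / (2 * \<i> * complex_of_real \<bar>\<omega> \<mu>\<bar>)) V"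
    by (intro C_k_on_divide C_k_on_mult C_k_on_const C_k_on_linear[OF bounded_linear_of_real] V abs_omega_smooth) (simp add: omega)
  have q1: "C_k_on r (\<lambda>\<mu>. 1 / complex_of_real (2 * L \<mu> $ 2 $ 1) -
      complex_of_real ((\<alpha> \<mu> - L \<mu> $ 1 $ 1) / L \<mu> $ 2 $ 1) * (1 / (2 * \<i> * complex_of_real \<bar>\<omega> \<mu>\<bar>))) V"
  proof (intro C_k_on_diff C_k_on_mult om V)
    show "C_k_on r (\<lambda>\<mu>. 1 / complex_of_real (2 * L \<mu> $ 2 $ 1)) V"
      by (rule C_k_on_divide[OF V C_k_on_const C_k_on_linear[OF bounded_linear_of_real V]])
        (intro C_k_on_mult C_k_on_const C_k_on_matrix_nth V L_smooth, simp add: L21)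
    show "C_k_on r (\<lambda>\<mu>. complex_of_real ((\<alpha> \<mu> - L \<mu> $ 1 $ 1) / L \<mu> $ 2 $ 1)) V"
      by (rule C_k_on_linear[OF bounded_linear_of_real V])
        (intro C_k_on_divide C_k_on_diff C_k_on_matrix_nth V L_smooth alpha_smooth, simp add: L21)
  qed
  show "C_k_on r (qc i) V" for i
    using om q1 by (cases "i = 1") (simp_all add: qc_def[abs_def])
  fix \<mu> assume \<mu>: "\<mu> \<in> V"
  have nz: "L \<mu> $ 2 $ 1 \<noteq> 0" "\<omega> \<mu> \<noteq> 0" using L21 omega \<mu> by auto
  have two: "(2::2) \<noteq> 1" by simp
  \<comment> \<open>Triangular system: the imaginary part of the coordinate involves only
    \<open>u $ 2\<close>, after which the real part gives \<open>u $ 1\<close>.\<close>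
  show "\<exists>u :: real ^ 2. wc 1 \<mu> * of_real (u $ 1) + wc 2 \<mu> * of_real (u $ 2) = z" for z
    using nz by (intro exI[of _ "vector [(Re z - (\<alpha> \<mu> - L \<mu> $ 1 $ 1) * (Im z / \<bar>\<omega> \<mu>\<bar>)) / L \<mu> $ 2 $ 1, Im z / \<bar>\<omega> \<mu>\<bar>]"])
      (simp add: wc_def l_def complex_eq_iff)
  fix u :: "real ^ 2" and i :: 2
  define z where "z = wc 1 \<mu> * of_real (u $ 1) + wc 2 \<mu> * of_real (u $ 2)"
  have Re_z: "Re z = L \<mu> $ 2 $ 1 * u $ 1 + (\<alpha> \<mu> - L \<mu> $ 1 $ 1) * u $ 2" and Im_z: "Im z = \<bar>\<omega> \<mu>\<bar> * u $ 2"
    by (simp_all add: z_def wc_def l_def)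
  \<comment> \<open>The inverse formula is equivalent to
    \<open>u $ i = 2 * Re (qc i \<mu> * z)\<close>; it is checked for \<open>i = 2\<close> first,
    because the formula for \<open>i = 1\<close> contains it.\<close>
  have qz2: "Re (1 / (2 * \<i> * of_real \<bar>\<omega> \<mu>\<bar>) * z) = u $ 2 / 2"
  proof -
    have "1 / (2 * \<i> * of_real \<bar>\<omega> \<mu>\<bar>) * z = Complex (Im z / (2 * \<bar>\<omega> \<mu>\<bar>)) (- Re z / (2 * \<bar>\<omega> \<mu>\<bar>))"
      using nz by (intro inverse_2i_mult) simp
    then show ?thesis using nz by (simp add: Im_z)
  qed
  have Re_of_real_mult: "Re (of_real a * b) = a * Re b" for a b by simp
  have qz1: "Re (qc 1 \<mu> * z) = u $ 1 / 2"
  proof -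
    have "qc 1 \<mu> * z = of_real (1 / (2 * L \<mu> $ 2 $ 1)) * z -
        of_real ((\<alpha> \<mu> - L \<mu> $ 1 $ 1) / L \<mu> $ 2 $ 1) * (1 / (2 * \<i> * of_real \<bar>\<omega> \<mu>\<bar>) * z)"
      by (simp add: qc_def algebra_simps)
    then have "Re (qc 1 \<mu> * z) = 1 / (2 * L \<mu> $ 2 $ 1) * Re z - (\<alpha> \<mu> - L \<mu> $ 1 $ 1) / L \<mu> $ 2 $ 1 * (u $ 2 / 2)"
      by (simp only: minus_complex.sel Re_of_real_mult qz2)
    then show ?thesis using nz by (simp add: Re_z field_simps)
  qed
  have "Re (qc i \<mu> * z) = u $ i / 2"
  proof (cases "i = 1")
    case True
    then show ?thesis using qz1 by (simp only:)
  next
    case False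
    then have "i = 2" using exhaust_2[of i] by blast
    then show ?thesis using qz2 unfolding qc_def by (simp only: two if_False)
  qed
  then have "u $ i = 2 * Re (qc i \<mu> * z)" by linarith
  then show "complex_of_real (u $ i) =
      qc i \<mu> * (wc 1 \<mu> * of_real (u $ 1) + wc 2 \<mu> * of_real (u $ 2)) +
      cnj (qc i \<mu> * (wc 1 \<mu> * of_real (u $ 1) + wc 2 \<mu> * of_real (u $ 2)))"
    by (simp only: z_def[symmetric] complex_add_cnj)
qed

text \<open>The coefficients \<open>wc\<close> form a left eigenvector of \<open>L\<close>: the
  imaginary part follows from the trace alone, the real part also uses the characteristic
  equation.\<close>

lemma zeta_L: "\<mu> \<in> V \<Longrightarrow> zeta \<mu> (L \<mu> *v u) = l \<mu> * zeta \<mu> u"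
proof -
  assume \<mu>: "\<mu> \<in> V"
  define W where "W = \<bar>\<omega> \<mu>\<bar>"
  have char: "L \<mu> $ 1 $ 2 * L \<mu> $ 2 $ 1 = - (\<alpha> \<mu> - L \<mu> $ 1 $ 1) * (\<alpha> \<mu> - L \<mu> $ 1 $ 1) - W * W"
    using L_char[OF \<mu>] by (simp add: W_def power2_eq_square algebra_simps)
  have tr: "L \<mu> $ 2 $ 2 = 2 * \<alpha> \<mu> - L \<mu> $ 1 $ 1" using L_trace[OF \<mu>] by simp
  have "Re (zeta \<mu> (L \<mu> *v u)) = Re (l \<mu> * zeta \<mu> u)"
    unfolding zeta_def wc_def l_def W_def[symmetric] matrix_vector_mult_def sum_2 using char tr by simp algebra
  moreover have "Im (zeta \<mu> (L \<mu> *v u)) = Im (l \<mu> * zeta \<mu> u)"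
    unfolding zeta_def wc_def l_def W_def[symmetric] matrix_vector_mult_def sum_2 by (simp add: tr algebra_simps)
  ultimately show ?thesis by (rule complex_eqI)
qed

lemma homological_zero:
  assumes \<mu>: "\<mu> \<in> V" and k: "2 \<le> k" "k \<le> q" and H: "is_hom k H" "\<And>u. P \<mu> *v H u = 0"
    and D: "\<And>u. (H has_derivative D u) (at u)" "\<And>u. D u (L \<mu> *v u) = A \<mu> *v H u"
  shows "H u = 0"
proof (rule homological_equation_injective[OF \<mu> H D zeta_L[OF \<mu>] projection[OF \<mu>]])
  show "of_nat a * l \<mu> + of_nat (k - a) * cnj (l \<mu>) \<in> {Complex (\<alpha> \<mu>) (\<omega> \<mu>), Complex (\<alpha> \<mu>) (- \<omega> \<mu>)}"
    if "a \<le> k" "v \<noteq> 0" "cmat (A \<mu>) *v v = (of_nat a * l \<mu> + of_nat (k - a) * cnj (l \<mu>)) *s v" for a v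
    using nonresonant[OF \<mu> k that(1,2)] that(3) unfolding l_def by blast
qed

abbreviation "SSM \<mu> \<equiv> spectral_submanifold (A \<mu>) (g \<mu>) (X \<mu>) (P \<mu>) (S \<mu>) q"

text \<open>Induction on the order of agreement. If \<open>W\<close> and \<open>W'\<close> agree to
  order \<open>k\<close>, then \<open>R\<close> and \<open>R'\<close> agree to order
  \<open>k + 1\<close>, so the next discrepancy solves the homological equation with zero forcing
  and vanishes.\<close>

lemma SSM_unique:
  assumes \<mu>: "\<mu> \<in> V" and W: "SSM \<mu> W R" "SSM \<mu> W' R'"
  shows "small_at0 q (\<lambda>u. W u - W' u)" "small_at0 (Suc q) (\<lambda>u. R u - R' u)"
proof -
  interpret s: ssm_setting "A \<mu>" "P \<mu>" "\<alpha> \<mu>" "\<omega> \<mu>" "S \<mu>" "g \<mu>" "X \<mu>" q by (rule setting[OF \<mu>])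
  have L: "s.reduced_matrix = L \<mu>" and T: "s.left_inverse = T \<mu>" by (simp_all add: L_def T_def)
  obtain C where C: "\<And>j. is_hom j (C j)" "C 1 = (*v) (S \<mu>)" "small_at0 q (\<lambda>u. W u - (\<Sum>j=1..q. C j u))"
    "\<forall>j\<in>{2..q}. \<forall>u. P \<mu> *v C j u = 0"
    using s.ssm_expansion[OF W(1)] by blast
  obtain C' where C': "\<And>j. is_hom j (C' j)" "C' 1 = (*v) (S \<mu>)" "small_at0 q (\<lambda>u. W' u - (\<Sum>j=1..q. C' j u))"
    "\<forall>j\<in>{2..q}. \<forall>u. P \<mu> *v C' j u = 0"
    using s.ssm_expansion[OF W(2)] by blast
  define E where "E j u = C j u - C' j u" for j u
  have E: "is_hom j (E j)" for j unfolding E_def by (intro is_hom_diff C C')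
  have exp: "small_at0 q (\<lambda>u. (W u - W' u) - (\<Sum>j=1..q. E j u))"
    using small_at0_diff[OF C(3) C'(3)] by (simp add: E_def sum_subtractf algebra_simps)
  note big = s.ssm_big[OF W(1)] s.ssm_big[OF W(2)]
  have RR: "\<forall>\<^sub>F u in nhds 0. T \<mu> *v (g \<mu> (W u) - g \<mu> (W' u)) = R u - R' u"
    using s.ssm_near[OF W(1)] s.ssm_near[OF W(2)]
    by eventually_elim (simp add: L T matrix_vector_mult_diff_distrib)
  have Rk: "small_at0 (Suc k) (\<lambda>u. R u - R' u)" if "small_at0 k (\<lambda>u. W u - W' u)" for k
    by (rule small_at0_cong[OF RR]) (intro small_at0_mult_vec s.nonlinearity_difference_small big that)
  have "small_at0 k (\<lambda>u. W u - W' u)" if "k \<le> q" for k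
    using that
  proof (induction k)
    case 0
    have "big_at0 1 (\<lambda>u. W u + (- 1) *\<^sub>R W' u)"
      by (intro big_at0_add big big_at0_linear[OF bounded_linear_scaleR_right])
    then show ?case using big_at0_imp_small by fastforce
  next
    case (Suc k)
    then have d: "small_at0 k (\<lambda>u. W u - W' u)" by simp
    have next_coeff: "small_at0 (Suc k) (\<lambda>u. (W u - W' u) - E (Suc k) u)"
      using Suc.prems by (intro small_at0_next_coefficient[OF E exp d]) auto
    have "E (Suc k) u = 0" for u
    \<comment> \<open>Degree 1 agrees by tangency, both linear parts being \<open>S \<mu>\<close>.
      From degree 2 on the homological equation decides.\<close>
    proof (cases "k = 0")
      case True
      then show ?thesis using C(2) C'(2) by (simp add: E_def)
    next
      case False
      let ?D = "\<lambda>u v. frechet_derivative W (at u) v - frechet_derivative W' (at u) v"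
      have deriv: "\<forall>\<^sub>F u in nhds 0. ((\<lambda>u. W u - W' u) has_derivative ?D u) (at u)"
        using s.ssm_near[OF W(1)] s.ssm_near[OF W(2)] by eventually_elim (intro has_derivative_diff; blast)
      obtain K where K: "K \<ge> 0" "\<forall>\<^sub>F u in nhds 0. \<forall>v. norm (frechet_derivative W' (at u) v) \<le> K * norm v"
        using s.ssm_derivative_bounded[OF W(2)] by blast
      \<comment> \<open>The two graphs are transported by different fields. Writing the second
        equation along \<open>R\<close> as well costs the derivative of \<open>W'\<close> applied to
        \<open>R - R'\<close>, which is negligible at this order.\<close>
      have "small_at0 (Suc k) (\<lambda>u. frechet_derivative W' (at u) (R u - R' u))"
        by (rule small_at0_dominated[OF Rk[OF d] _ K(1)]) (use K(2) in \<open>auto elim: eventually_mono\<close>)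
      then have "small_at0 (Suc k) (\<lambda>u. (g \<mu> (W u) - g \<mu> (W' u)) - frechet_derivative W' (at u) (R u - R' u))"
        by (intro small_at0_diff s.nonlinearity_difference_small big d)
      \<comment> \<open>The forcing is negligible, so \<open>transport_expansion\<close> is used
        with every \<open>B j\<close> equal to 0.\<close>
      then have rhs: "small_at0 (Suc k) (\<lambda>u. ?D u (R u) - A \<mu> *v (W u - W' u) - (\<Sum>j=1..Suc k. 0))"
      proof (rule small_at0_cong[rotated])
        show "\<forall>\<^sub>F u in nhds 0. (g \<mu> (W u) - g \<mu> (W' u)) - frechet_derivative W' (at u) (R u - R' u)
            = ?D u (R u) - A \<mu> *v (W u - W' u) - (\<Sum>j=1..Suc k. 0)"
          using s.ssm_near[OF W(1)] s.ssm_near[OF W(2)]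
        proof eventually_elim
          case (elim u)
          then have lin: "linear (frechet_derivative W' (at u))" using has_derivative_linear by blast
          have "frechet_derivative W (at u) (R u) = A \<mu> *v W u + g \<mu> (W u)"
            "frechet_derivative W' (at u) (R' u) = A \<mu> *v W' u + g \<mu> (W' u)"
            using elim by blast+
          then show ?case by (simp add: linear_diff[OF lin] matrix_vector_mult_diff_distrib)
        qed
      qed
      obtain g1 g2 where HD: "\<And>u. (E (Suc k) has_derivative (\<lambda>v. v $ 1 *\<^sub>R g1 u + v $ 2 *\<^sub>R g2 u)) (at u)"
        using is_hom_has_derivative[OF E] by blast
      show ?thesis
      proof (rule homological_zero[OF \<mu> _ Suc.prems E _ HD])
        show "2 \<le> Suc k" using False by simp
        show "P \<mu> *v E (Suc k) u = 0" for u
          using C(4) C'(4) False Suc.prems by (simp add: E_def matrix_vector_mult_diff_distrib)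
        show "(L \<mu> *v u) $ 1 *\<^sub>R g1 u + (L \<mu> *v u) $ 2 *\<^sub>R g2 u = A \<mu> *v E (Suc k) u" for u
          using transport_expansion[OF deriv s.ssm_reduced_small[OF W(1), unfolded L] is_hom_zero rhs E d next_coeff HD] by simp
      qed
    qed
    then show ?case using next_coeff by simp
  qed
  then show "small_at0 q (\<lambda>u. W u - W' u)" by simp
  from Rk[OF this] show "small_at0 (Suc q) (\<lambda>u. R u - R' u)" .
qed

end

section \<open>Smooth dependence of the coefficients on the parameter\<close>

locale ssm_family_expansion = ssm_family r V A P S \<alpha> \<omega> g X q
  for r :: nat and V :: "real set" and A P :: "real \<Rightarrow> real ^ 'n ^ 'n::finite" and S :: "real \<Rightarrow> real ^ 2 ^ 'n"
    and \<alpha> \<omega> :: "real \<Rightarrow> real" and g :: "real \<Rightarrow> real ^ 'n \<Rightarrow> real ^ 'n" and X :: "real \<Rightarrow> (real ^ 'n) set" and q :: nat +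
  fixes F :: "('n \<Rightarrow> nat) \<Rightarrow> real \<Rightarrow> real ^ 'n"
  assumes F_smooth: "2 \<le> mdeg j \<Longrightarrow> mdeg j \<le> Suc q \<Longrightarrow> C_k_on r (F j) V"
    and F_expansion: "\<mu> \<in> V \<Longrightarrow> has_expansion (g \<mu>) (\<lambda>j. F j \<mu>) 2 (Suc q)"
begin

text \<open>All parameters with all manifolds over them, at most parameters possibly none. A
  statement \<open>expands\<close> over this set has coefficients independent of the
  manifold.\<close>

definition \<Omega> :: "(real \<times> (real ^ 2 \<Rightarrow> real ^ 'n) \<times> (real ^ 2 \<Rightarrow> real ^ 2)) set" where
  "\<Omega> = {z. fst z \<in> V \<and> SSM (fst z) (fst (snd z)) (snd (snd z))}"

lemma \<Omega>_dom: "\<forall>z\<in>\<Omega>. fst z \<in> V"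
  by (auto simp: \<Omega>_def)

abbreviation "Wz z \<equiv> fst (snd z)"
abbreviation "Rz z \<equiv> snd (snd z)"

lemma \<Omega>_V: "z \<in> \<Omega> \<Longrightarrow> fst z \<in> V" and \<Omega>_SSM: "z \<in> \<Omega> \<Longrightarrow> SSM (fst z) (Wz z) (Rz z)"
  by (auto simp: \<Omega>_def)

text \<open>Every monomial of \<open>g\<close> has degree at least 2, so a product of components of
  \<open>W\<close> is known to one order more than \<open>W\<close>. The remainder of order
  \<open>Suc q\<close> stays negligible after inserting \<open>W\<close>, which is of order
  1.\<close>

lemma expands_nonlinearity:
  assumes W: "expands r V \<Omega> 1 k Wz" and k: "1 \<le> k" "k \<le> q"
  shows "expands r V \<Omega> 2 (Suc k) (\<lambda>z u. g (fst z) (Wz z u))"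
proof -
  let ?J = "{j :: 'n \<Rightarrow> nat. 2 \<le> mdeg j \<and> mdeg j \<le> Suc q}"
  let ?e = "\<lambda>\<mu> x. g \<mu> x - (\<Sum>j\<in>?J. mpow x j *\<^sub>R F j \<mu>)"
  have "expands r V \<Omega> 2 (Suc k) (\<lambda>z u. mpow (Wz z u) j *\<^sub>R F j (fst z))" if "j \<in> ?J" for j
  proof -
    have "expands r V \<Omega> (mdeg j) (k - 1 + mdeg j) (\<lambda>z u. \<Prod>i\<in>UNIV. (Wz z u $ i) ^ j i)"
      by (intro expands_prod[OF V \<Omega>_dom, where p = "\<lambda>i z u. Wz z u $ i"] expands_linear[OF V \<Omega>_dom bounded_linear_vec_nth] W k)
    then have "expands r V \<Omega> (mdeg j + 0) (min (k - 1 + mdeg j + 0) (k - 1 + mdeg j)) (\<lambda>z u. mpow (Wz z u) j *\<^sub>R F j (fst z))"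
      unfolding mpow_def using that
      by (intro expands_bilinear[OF V \<Omega>_dom bounded_bilinear_scaleR] expands_const[OF V \<Omega>_dom] F_smooth) auto
    then show ?thesis by (rule expands_weaken[OF V \<Omega>_dom]) (use that k in auto)
  qed
  then have "expands r V \<Omega> 2 (Suc k) (\<lambda>z u. \<Sum>j\<in>?J. mpow (Wz z u) j *\<^sub>R F j (fst z))"
    by (intro expands_sum[OF V \<Omega>_dom]) auto
  moreover have "expands r V \<Omega> 2 (Suc k) (\<lambda>z u. ?e (fst z) (Wz z u))"
  proof (rule expands_small[OF V \<Omega>_dom])
    fix z assume z: "z \<in> \<Omega>"
    interpret s: ssm_setting "A (fst z)" "P (fst z)" "\<alpha> (fst z)" "\<omega> (fst z)" "S (fst z)" "g (fst z)" "X (fst z)" q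
      by (rule setting[OF \<Omega>_V[OF z]])
    have "small_at0 (Suc q) (?e (fst z))"
      using F_expansion[OF \<Omega>_V[OF z]] has_expansion_iff_small[of 2 "g (fst z)"] s.g0 by simp
    from small_at0_mono[OF small_at0_compose[OF this s.ssm_big[OF \<Omega>_SSM[OF z]]]] k
    show "small_at0 (Suc k) (\<lambda>u. ?e (fst z) (Wz z u))" by simp
  qed
  ultimately have "expands r V \<Omega> 2 (Suc k) (\<lambda>z u. (\<Sum>j\<in>?J. mpow (Wz z u) j *\<^sub>R F j (fst z)) + ?e (fst z) (Wz z u))"
    by (rule expands_add[OF V \<Omega>_dom])
  then show ?thesis by simp
qed

lemma expands_reduced:
  assumes W: "expands r V \<Omega> 1 k Wz" and k: "1 \<le> k" "k \<le> q"
  shows "expands r V \<Omega> 1 (Suc k) Rz"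
proof -
  have "expands r V \<Omega> 2 (Suc k) (\<lambda>z u. T (fst z) *v g (fst z) (Wz z u))"
    using k by (intro expands_mult_vec[OF V \<Omega>_dom] T_smooth expands_nonlinearity W) auto
  from expands_weaken[OF V \<Omega>_dom this, of 1 "Suc k"]
  have "expands r V \<Omega> 1 (Suc k) (\<lambda>z u. L (fst z) *v u + T (fst z) *v g (fst z) (Wz z u))"
    by (intro expands_add[OF V \<Omega>_dom] expands_hom_family[OF V \<Omega>_dom hom_family_mult_vec_ident[OF V L_smooth]]) auto
  then show ?thesis
  proof (rule expands_cong[OF V \<Omega>_dom, rotated])
    fix z assume z: "z \<in> \<Omega>"
    interpret s: ssm_setting "A (fst z)" "P (fst z)" "\<alpha> (fst z)" "\<omega> (fst z)" "S (fst z)" "g (fst z)" "X (fst z)" q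
      by (rule setting[OF \<Omega>_V[OF z]])
    show "\<forall>\<^sub>F u in nhds 0. L (fst z) *v u + T (fst z) *v g (fst z) (Wz z u) = Rz z u"
      using s.ssm_near[OF \<Omega>_SSM[OF z]] by eventually_elim (simp add: L_def T_def)
  qed
qed

text \<open>The known polynomial \<open>N\<close> produces a forcing \<open>B\<close> with smooth
  coefficients, common to all manifolds. The smooth solution \<open>H\<close> is built first, for
  all parameters; the coefficient of each actual manifold satisfies the same equation and equals
  \<open>H\<close> by injectivity.\<close>

lemma expands_step:
  assumes W: "expands r V \<Omega> 1 k Wz" and k: "1 \<le> k" "Suc k \<le> q"
  shows "expands r V \<Omega> 1 (Suc k) Wz"
proof -
  obtain h where h: "\<And>j. hom_family r V j (h j)" "\<And>z. z \<in> \<Omega> \<Longrightarrow> small_at0 k (\<lambda>u. Wz z u - (\<Sum>j=1..k. h j u (fst z)))"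
    using W unfolding expands_def by blast
  define N where "N \<mu> u = (\<Sum>j=1..k. h j u \<mu>)" for \<mu> u
  have "\<forall>j. \<exists>G. hom_family r V (j - 1) (fst G) \<and> hom_family r V (j - 1) (snd G) \<and>
    (\<forall>\<mu>\<in>V. \<forall>u. ((\<lambda>u. h j u \<mu>) has_derivative (\<lambda>v. v $ 1 *\<^sub>R fst G u \<mu> + v $ 2 *\<^sub>R snd G u \<mu>)) (at u))"
    using hom_family_has_derivative[OF V h(1)] by simp
  from choice[OF this] obtain G where G: "\<And>j. hom_family r V (j - 1) (fst (G j))" "\<And>j. hom_family r V (j - 1) (snd (G j))"
    "\<forall>j. \<forall>\<mu>\<in>V. \<forall>u. ((\<lambda>u. h j u \<mu>) has_derivative (\<lambda>v. v $ 1 *\<^sub>R fst (G j) u \<mu> + v $ 2 *\<^sub>R snd (G j) u \<mu>)) (at u)"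
    by blast
  define N' where "N' \<mu> u v = (\<Sum>j=1..k. v $ 1 *\<^sub>R fst (G j) u \<mu> + v $ 2 *\<^sub>R snd (G j) u \<mu>)" for \<mu> u and v :: "real ^ 2"
  have N': "(N \<mu> has_derivative N' \<mu> u) (at u)" if "\<mu> \<in> V" for \<mu> u
    unfolding N_def N'_def using G(3) that by (intro has_derivative_sum) blast
  \<comment> \<open>\<open>R\<close> is already known one order further than \<open>W\<close>, so
    the forcing of degree \<open>Suc k\<close> is available before the coefficient of
    \<open>W\<close> in that degree.\<close>
  have R: "expands r V \<Omega> 1 (Suc k) Rz" by (rule expands_reduced[OF W]) (use k in auto)
  have comp: "expands r V \<Omega> 1 (Suc k) (\<lambda>z u. Rz z u $ i *\<^sub>R p u (fst z))" if "hom_family r V j p" for i j p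
  proof -
    have "expands r V \<Omega> (1 + 0) (min (Suc k + 0) (Suc k + 1)) (\<lambda>z u. Rz z u $ i *\<^sub>R p u (fst z))"
      by (intro expands_bilinear[OF V \<Omega>_dom bounded_bilinear_scaleR] expands_linear[OF V \<Omega>_dom bounded_linear_vec_nth] R
          expands_hom_family[OF V \<Omega>_dom that]) auto
    then show ?thesis by simp
  qed
  have "expands r V \<Omega> 1 (Suc k) (\<lambda>z u. N' (fst z) u (Rz z u))"
    unfolding N'_def by (intro expands_sum[OF V \<Omega>_dom] expands_add[OF V \<Omega>_dom] comp[OF G(1)] comp[OF G(2)])
  moreover have "expands r V \<Omega> 1 (Suc k) (\<lambda>z u. g (fst z) (Wz z u))"
    by (rule expands_weaken[OF V \<Omega>_dom expands_nonlinearity[OF W]]) (use k in auto)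
  moreover have "expands r V \<Omega> 1 (Suc k) (\<lambda>z u. A (fst z) *v N (fst z) u)"
    unfolding N_def
    by (intro expands_mult_vec[OF V \<Omega>_dom] A_smooth expands_sum[OF V \<Omega>_dom] expands_hom_family[OF V \<Omega>_dom h(1)]) auto
  \<comment> \<open>By invariance this expression equals, near 0, the derivative of
    \<open>W - N\<close> along \<open>R\<close> minus \<open>A (W - N)\<close>.\<close>
  ultimately have "expands r V \<Omega> 1 (Suc k) (\<lambda>z u. A (fst z) *v N (fst z) u + g (fst z) (Wz z u) - N' (fst z) u (Rz z u))"
    by (intro expands_diff[OF V \<Omega>_dom] expands_add[OF V \<Omega>_dom]) auto
  then obtain B where B: "\<And>j. hom_family r V j (B j)" "\<And>z. z \<in> \<Omega> \<Longrightarrow> small_at0 (Suc k)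
      (\<lambda>u. A (fst z) *v N (fst z) u + g (fst z) (Wz z u) - N' (fst z) u (Rz z u) - (\<Sum>j=1..Suc k. B j u (fst z)))"
    unfolding expands_def by blast
  \<comment> \<open>The forcing is projected because \<open>P B = 0\<close> is only available at
    parameters that carry a manifold, whereas \<open>H\<close> must be smooth on all of
    \<open>V\<close>.\<close>
  have "\<exists>H. hom_family r V (Suc k) H \<and> (\<forall>\<mu>\<in>V. \<forall>u. P \<mu> *v H u \<mu> = 0 \<and>
    (\<forall>D. ((\<lambda>u. H u \<mu>) has_derivative D) (at u) \<longrightarrow> D (L \<mu> *v u) = A \<mu> *v H u \<mu> + (B (Suc k) u \<mu> - P \<mu> *v B (Suc k) u \<mu>)))"
  proof (rule homological_equation_solvable[OF B(1) zeta_L l_smooth A_smooth P_smooth projection])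
    show "of_nat a * l \<mu> + of_nat (Suc k - a) * cnj (l \<mu>) \<in> {Complex (\<alpha> \<mu>) (\<omega> \<mu>), Complex (\<alpha> \<mu>) (- \<omega> \<mu>)}"
      if "\<mu> \<in> V" "a \<le> Suc k" "v \<noteq> 0" "cmat (A \<mu>) *v v = (of_nat a * l \<mu> + of_nat (Suc k - a) * cnj (l \<mu>)) *s v" for \<mu> a v
      using nonresonant[OF that(1) _ k(2) that(2,3)] that(4) k(1) unfolding l_def by simp
  qed
  then obtain H where H: "hom_family r V (Suc k) H" "\<And>\<mu> u. \<mu> \<in> V \<Longrightarrow> P \<mu> *v H u \<mu> = 0"
    "\<And>\<mu> u D. \<mu> \<in> V \<Longrightarrow> ((\<lambda>u. H u \<mu>) has_derivative D) (at u) \<Longrightarrow>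
      D (L \<mu> *v u) = A \<mu> *v H u \<mu> + (B (Suc k) u \<mu> - P \<mu> *v B (Suc k) u \<mu>)"
    by blast
  have main: "small_at0 (Suc k) (\<lambda>u. Wz z u - N (fst z) u - H u (fst z))" if z: "z \<in> \<Omega>" for z
  proof -
    let ?\<mu> = "fst z" and ?W = "Wz z" and ?R = "Rz z"
    have \<mu>: "?\<mu> \<in> V" by (rule \<Omega>_V[OF z])
    interpret s: ssm_setting "A ?\<mu>" "P ?\<mu>" "\<alpha> ?\<mu>" "\<omega> ?\<mu>" "S ?\<mu>" "g ?\<mu>" "X ?\<mu>" q by (rule setting[OF \<mu>])
    note W = \<Omega>_SSM[OF z]
    obtain C where C: "\<And>j. is_hom j (C j)" "small_at0 q (\<lambda>u. ?W u - (\<Sum>j=1..q. C j u))" "\<forall>j\<in>{2..q}. \<forall>u. P ?\<mu> *v C j u = 0"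
      using s.ssm_expansion[OF W] by blast
    define E where "E j u = C j u - (if j \<le> k then h j u ?\<mu> else 0)" for j u
    have E: "is_hom j (E j)" for j
      unfolding E_def using C(1) hom_family_imp_is_hom[OF h(1) \<mu>] is_hom_zero
      by (cases "j \<le> k") (simp_all add: is_hom_diff)
    have Ek: "E (Suc k) = C (Suc k)" by (auto simp: E_def)
    have "(\<Sum>j=1..q. E j u) = (\<Sum>j=1..q. C j u) - N ?\<mu> u" for u
    proof -
      have "(\<Sum>j=1..q. if j \<le> k then h j u ?\<mu> else 0) = N ?\<mu> u"
        unfolding N_def using k by (intro sum.mono_neutral_cong_right) auto
      then show ?thesis by (simp add: E_def sum_subtractf)
    qed
    then have exp: "small_at0 q (\<lambda>u. (?W u - N ?\<mu> u) - (\<Sum>j=1..q. E j u))"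
      using C(2) by simp
    have d: "small_at0 k (\<lambda>u. ?W u - N ?\<mu> u)" using h(2)[OF z] by (simp add: N_def)
    have next_coeff: "small_at0 (Suc k) (\<lambda>u. (?W u - N ?\<mu> u) - C (Suc k) u)"
      unfolding Ek[symmetric] using k by (intro small_at0_next_coefficient[OF E exp d]) auto
    let ?D = "\<lambda>u v. frechet_derivative ?W (at u) v - N' ?\<mu> u v"
    have deriv: "\<forall>\<^sub>F u in nhds 0. ((\<lambda>u. ?W u - N ?\<mu> u) has_derivative ?D u) (at u)"
      using s.ssm_near[OF W] by eventually_elim (intro has_derivative_diff N'[OF \<mu>]; blast)
    have rhs: "small_at0 (Suc k) (\<lambda>u. ?D u (?R u) - A ?\<mu> *v (?W u - N ?\<mu> u) - (\<Sum>j=1..Suc k. B j u ?\<mu>))"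
    proof (rule small_at0_cong[OF _ B(2)[OF z]])
      show "\<forall>\<^sub>F u in nhds 0. A ?\<mu> *v N ?\<mu> u + g ?\<mu> (?W u) - N' ?\<mu> u (?R u) - (\<Sum>j=1..Suc k. B j u ?\<mu>)
          = ?D u (?R u) - A ?\<mu> *v (?W u - N ?\<mu> u) - (\<Sum>j=1..Suc k. B j u ?\<mu>)"
        using s.ssm_near[OF W]
      proof eventually_elim
        case (elim u)
        then have "frechet_derivative ?W (at u) (?R u) = A ?\<mu> *v ?W u + g ?\<mu> (?W u)" by blast
        then show ?case by (simp add: matrix_vector_mult_diff_distrib)
      qed
    qed
    have Bhom: "is_hom j (\<lambda>u. B j u ?\<mu>)" for j by (rule hom_family_imp_is_hom[OF B(1) \<mu>])
    obtain c1 c2 where CD: "\<And>u. (C (Suc k) has_derivative (\<lambda>v. v $ 1 *\<^sub>R c1 u + v $ 2 *\<^sub>R c2 u)) (at u)"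
      using is_hom_has_derivative[OF C(1)] by blast
    have Ceq: "(L ?\<mu> *v u) $ 1 *\<^sub>R c1 u + (L ?\<mu> *v u) $ 2 *\<^sub>R c2 u = A ?\<mu> *v C (Suc k) u + B (Suc k) u ?\<mu>" for u
      by (rule transport_expansion[OF deriv s.ssm_reduced_small[OF W, folded L_def] Bhom rhs C(1) d next_coeff CD])
    have PC: "P ?\<mu> *v C (Suc k) u = 0" for u using C(3) k by simp
    \<comment> \<open>Differentiating \<open>P C = 0\<close> along \<open>L u\<close> and comparing
      with the equation for \<open>C\<close> shows that the forcing has no component in the plane.
      At this parameter the projected equation is therefore the true one.\<close>
    have PB: "P ?\<mu> *v B (Suc k) u ?\<mu> = 0" for u
    proof -
      have "((\<lambda>u. P ?\<mu> *v C (Suc k) u) has_derivative (\<lambda>v. P ?\<mu> *v (v $ 1 *\<^sub>R c1 u + v $ 2 *\<^sub>R c2 u))) (at u)"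
        by (rule bounded_linear.has_derivative[OF matrix_vector_mul_bounded_linear CD])
      then have "((\<lambda>u. 0) has_derivative (\<lambda>v. P ?\<mu> *v (v $ 1 *\<^sub>R c1 u + v $ 2 *\<^sub>R c2 u))) (at u)" by (simp only: PC)
      from fun_cong[OF has_derivative_unique[OF this has_derivative_const]]
      have "P ?\<mu> *v ((L ?\<mu> *v u) $ 1 *\<^sub>R c1 u + (L ?\<mu> *v u) $ 2 *\<^sub>R c2 u) = 0" .
      then show ?thesis unfolding Ceq by (simp add: matrix_vector_right_distrib s.P_commute PC)
    qed
    obtain h1 h2 where HD: "\<And>u. ((\<lambda>u. H u ?\<mu>) has_derivative (\<lambda>v. v $ 1 *\<^sub>R h1 u + v $ 2 *\<^sub>R h2 u)) (at u)"
      using is_hom_has_derivative[OF hom_family_imp_is_hom[OF H(1) \<mu>]] by blast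
    have "C (Suc k) u - H u ?\<mu> = 0" for u
    proof (rule homological_zero[OF \<mu> _ k(2), of "\<lambda>u. C (Suc k) u - H u ?\<mu>"])
      show "((\<lambda>u. C (Suc k) u - H u ?\<mu>) has_derivative
          (\<lambda>v. (v $ 1 *\<^sub>R c1 u + v $ 2 *\<^sub>R c2 u) - (v $ 1 *\<^sub>R h1 u + v $ 2 *\<^sub>R h2 u))) (at u)" for u
        by (intro has_derivative_diff CD HD)
      show "((L ?\<mu> *v u) $ 1 *\<^sub>R c1 u + (L ?\<mu> *v u) $ 2 *\<^sub>R c2 u) - ((L ?\<mu> *v u) $ 1 *\<^sub>R h1 u + (L ?\<mu> *v u) $ 2 *\<^sub>R h2 u)
          = A ?\<mu> *v (C (Suc k) u - H u ?\<mu>)" for u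
        unfolding Ceq H(3)[OF \<mu> HD] by (simp add: PB matrix_vector_mult_diff_distrib)
    qed (use k C(1) hom_family_imp_is_hom[OF H(1) \<mu>] in \<open>auto intro: is_hom_diff simp: PC H(2)[OF \<mu>] matrix_vector_mult_diff_distrib\<close>)
    then have "C (Suc k) u = H u ?\<mu>" for u by simp
    then show ?thesis using next_coeff by simp
  qed
  define h' where "h' j = (if j = Suc k then H else h j)" for j
  have "hom_family r V j (h' j)" for j using H(1) h(1) by (simp add: h'_def)
  moreover have "small_at0 (Suc k) (\<lambda>u. Wz z u - (\<Sum>j=1..Suc k. h' j u (fst z)))" if "z \<in> \<Omega>" for z
  proof -
    have "(\<Sum>j=1..Suc k. h' j u (fst z)) = N (fst z) u + H u (fst z)" for u
      unfolding N_def by (simp add: h'_def)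
    then show ?thesis using main[OF that] by (simp add: diff_diff_eq)
  qed
  ultimately show ?thesis unfolding expands_def by blast
qed

lemma expands_all:
  assumes "1 \<le> k" "k \<le> q"
  shows "expands r V \<Omega> 1 k Wz"
  using assms
proof (induction k rule: dec_induct)
  case base
  have "small_at0 1 (\<lambda>u. Wz z u - S (fst z) *v u)" if z: "z \<in> \<Omega>" for z
  proof -
    interpret s: ssm_setting "A (fst z)" "P (fst z)" "\<alpha> (fst z)" "\<omega> (fst z)" "S (fst z)" "g (fst z)" "X (fst z)" q
      by (rule setting[OF \<Omega>_V[OF z]])
    note W = \<Omega>_SSM[OF z]
    obtain C where C: "\<And>j. is_hom j (C j)" "C 1 = (*v) (S (fst z))" "small_at0 q (\<lambda>u. Wz z u - (\<Sum>j=1..q. C j u))"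
      using s.ssm_expansion[OF W] by blast
    have "small_at0 0 (Wz z)" using big_at0_imp_small[OF s.ssm_big[OF W]] by simp
    from small_at0_next_coefficient[OF C(1) C(3) this] s.q C(2) show ?thesis by simp
  qed
  then have "expands r V \<Omega> 1 1 (\<lambda>z u. Wz z u - S (fst z) *v u)" by (rule expands_small[OF V \<Omega>_dom])
  moreover have "expands r V \<Omega> 1 1 (\<lambda>z u. S (fst z) *v u)"
    by (intro expands_hom_family[OF V \<Omega>_dom hom_family_mult_vec_ident[OF V S_smooth]]) simp
  ultimately have "expands r V \<Omega> 1 1 (\<lambda>z u. (Wz z u - S (fst z) *v u) + S (fst z) *v u)"
    by (rule expands_add[OF V \<Omega>_dom])
  then show ?case by simp
next
  case (step k)
  then show ?case by (intro expands_step) auto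
qed

lemma reduced_expansion_smooth:
  assumes "1 \<le> q"
  shows "\<exists>c. (\<forall>k. C_k_on r (c k) V) \<and> (\<forall>\<mu>\<in>V. \<forall>W R. SSM \<mu> W R \<longrightarrow> has_expansion R (\<lambda>k. c k \<mu>) 1 (Suc q))"
proof -
  obtain h where h: "\<forall>j. hom_family r V j (h j)" "\<And>z. z \<in> \<Omega> \<Longrightarrow> small_at0 (Suc q) (\<lambda>u. Rz z u - (\<Sum>j=1..Suc q. h j u (fst z)))"
    using expands_reduced[OF expands_all[OF assms]] assms unfolding expands_def by blast
  from h(1)[unfolded hom_family_def] have "\<forall>j. \<exists>c. (\<forall>a. C_k_on r (c a) V) \<and> (\<forall>\<mu>\<in>V. \<forall>u. h j u \<mu> = hom_poly j (\<lambda>a. c a \<mu>) u)"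
    .
  from choice[OF this] obtain c where c: "\<forall>j. (\<forall>a. C_k_on r (c j a) V) \<and> (\<forall>\<mu>\<in>V. \<forall>u. h j u \<mu> = hom_poly j (\<lambda>a. c j a \<mu>) u)"
    by blast
  \<comment> \<open>A multi-index in two variables is determined by its degree and its first
    entry.\<close>
  have "has_expansion R (\<lambda>k. c (mdeg k) (k 1) \<mu>) 1 (Suc q)" if \<mu>: "\<mu> \<in> V" and W: "SSM \<mu> W R" for \<mu> W R
  proof -
    interpret s: ssm_setting "A \<mu>" "P \<mu>" "\<alpha> \<mu>" "\<omega> \<mu>" "S \<mu>" "g \<mu>" "X \<mu>" q by (rule setting[OF \<mu>])
    have "(\<mu>, W, R) \<in> \<Omega>" using \<mu> W by (simp add: \<Omega>_def)
    from h(2)[OF this] have "small_at0 (Suc q) (\<lambda>u. R u - (\<Sum>j=1..Suc q. hom_poly j (\<lambda>a. c j a \<mu>) u))"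
      using c \<mu> by simp
    moreover have "(\<Sum>j=1..Suc q. hom_poly j (\<lambda>a. c j a \<mu>) u) =
        (\<Sum>j=1..Suc q. hom_poly j (\<lambda>a. c (mdeg (midx a (j - a))) (midx a (j - a) 1) \<mu>) u)" for u
      by (intro sum.cong refl) (simp add: hom_poly_def mdeg_2)
    ultimately show ?thesis
      unfolding has_expansion_iff_small[of 1 R, OF order_refl s.ssm_zero(2)[OF W]] multi_index_sum_eq_hom_poly by (simp only:)
  qed
  moreover have "C_k_on r (c (mdeg k) (k 1)) V" for k :: "2 \<Rightarrow> nat" using c by blast
  ultimately show ?thesis by (intro exI[of _ "\<lambda>k. c (mdeg k) (k 1)"]) blast
qed

end

section \<open>The reduced dynamics\<close>

lemma has_derivative_imp_locally_lipschitz_at: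
  fixes h :: "'a::real_normed_vector \<Rightarrow> 'b::real_normed_vector"
  assumes "h differentiable (at a)"
  shows "\<exists>K\<ge>0. \<exists>d>0. \<forall>y. norm (y - a) < d \<longrightarrow> norm (h y - h a) \<le> K * norm (y - a)"
proof -
  obtain h' where h': "(h has_derivative h') (at a)" using assms unfolding differentiable_def by blast
  obtain K where K: "K \<ge> 0" "\<And>v. norm (h' v) \<le> norm v * K"
    using bounded_linear.nonneg_bounded[OF has_derivative_bounded_linear[OF h']] by blast
  obtain d where d: "d > 0" "\<And>y. norm (y - a) < d \<Longrightarrow> norm (h y - h a - h' (y - a)) \<le> 1 * norm (y - a)"
    using h' unfolding has_derivative_at_alt by (meson zero_less_one)
  have "norm (h y - h a) \<le> (K + 1) * norm (y - a)" if "norm (y - a) < d" for y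
    using norm_triangle_sub[of "h y - h a" "h' (y - a)"] d(2)[OF that] K(2)[of "y - a"]
    by (simp add: algebra_simps)
  then show ?thesis using K(1) d(1) by (intro exI[of _ "K + 1"] conjI exI[of _ d]) auto
qed

text \<open>Mean value inequality for \<open>\<phi> (a + z) - D a z\<close>: its derivative is
  \<open>D (a + z) - D a\<close>, which is of size \<open>norm z\<close> because \<open>D\<close> is
  differentiable at \<open>a\<close>.\<close>

lemma quadratic_remainder:
  fixes \<phi> :: "real ^ 'n::finite \<Rightarrow> real ^ 'n"
  assumes U: "open U" "a \<in> U" and D: "\<And>x. x \<in> U \<Longrightarrow> (\<phi> has_derivative D x) (at x)"
    and D2: "\<And>i. (\<lambda>x. D x (axis i 1)) differentiable (at a)"
  shows "\<exists>C\<ge>0. \<exists>\<rho>>0. \<forall>x y. norm x < \<rho> \<longrightarrow> norm y < \<rho> \<longrightarrow>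
    norm ((\<phi> (a + x) - D a x) - (\<phi> (a + y) - D a y)) \<le> C * (norm x + norm y) * norm (x - y)"
proof -
  have "\<forall>i. \<exists>Kd. fst Kd \<ge> 0 \<and> snd Kd > 0 \<and> (\<forall>y. norm (y - a) < snd Kd \<longrightarrow> norm (D y (axis i 1) - D a (axis i 1)) \<le> fst Kd * norm (y - a))"
    using has_derivative_imp_locally_lipschitz_at[OF D2] by auto
  from choice[OF this] obtain Kd where Kd: "\<And>i. fst (Kd i) \<ge> 0" "\<And>i. snd (Kd i) > 0"
    "\<And>i y. norm (y - a) < snd (Kd i) \<Longrightarrow> norm (D y (axis i 1) - D a (axis i 1)) \<le> fst (Kd i) * norm (y - a)"
    by blast
  define K where "K = (\<Sum>i\<in>UNIV. fst (Kd i))"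
  have K: "K \<ge> 0" unfolding K_def by (intro sum_nonneg Kd(1))
  obtain d where d: "d > 0" "ball a d \<subseteq> U" using U open_contains_ball by blast
  define \<rho> where "\<rho> = Min (insert d (range (\<lambda>i. snd (Kd i))))"
  have \<rho>: "\<rho> > 0" "\<rho> \<le> d" "\<And>i. \<rho> \<le> snd (Kd i)"
    unfolding \<rho>_def using d(1) Kd(2) by (auto intro: Min_le simp del: Min_insert)
  have inU: "a + x \<in> U" if "norm x < \<rho>" for x
    using that \<rho>(2) d(2) by (auto simp: subset_iff dist_norm)
  have bound: "norm (D (a + x) v - D a v) \<le> K * norm x * norm v" if x: "norm x < \<rho>" for x v
  proof -
    have lin: "linear (D (a + x))" "linear (D a)"
      using D[OF inU[OF x]] D[OF U(2)] has_derivative_linear by blast+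
    have "linear (\<lambda>v. D (a + x) v - D a v)" by (rule linear_compose_sub[OF lin])
    note sum = linear_sum[OF this, of "\<lambda>i. v $ i *\<^sub>R axis i 1" UNIV] and scale = linear_scale[OF this]
    have "(\<Sum>i\<in>UNIV. v $ i *\<^sub>R axis i 1) = v"
      using basis_expansion[of v] by (simp only: scalar_mult_eq_scaleR)
    then have "D (a + x) v - D a v = (\<Sum>i\<in>UNIV. v $ i *\<^sub>R (D (a + x) (axis i 1) - D a (axis i 1)))"
      using sum by (simp only: scale)
    also have "norm \<dots> \<le> (\<Sum>i\<in>UNIV. norm v * (fst (Kd i) * norm x))"
    proof (rule sum_norm_le)
      fix i
      have "norm (D (a + x) (axis i 1) - D a (axis i 1)) \<le> fst (Kd i) * norm x"
        using Kd(3)[of "a + x" i] x \<rho>(3)[of i] by simp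
      then show "norm (v $ i *\<^sub>R (D (a + x) (axis i 1) - D a (axis i 1))) \<le> norm v * (fst (Kd i) * norm x)"
        using component_le_norm_cart[of v i] by (simp add: mult_mono)
    qed
    also have "\<dots> = K * norm x * norm v"
      unfolding K_def sum_distrib_right by (intro sum.cong refl) (simp add: mult_ac)
    finally show ?thesis .
  qed
  have "norm ((\<phi> (a + x) - D a x) - (\<phi> (a + y) - D a y)) \<le> K * (norm x + norm y) * norm (x - y)"
    if xy: "norm x < \<rho>" "norm y < \<rho>" for x y
  \<comment> \<open>This ball is convex, contains both points, and every \<open>z\<close> in it has
    norm at most \<open>norm x + norm y\<close>.\<close>
  proof (rule differentiable_bound[of "cball 0 (max (norm x) (norm y))" _ "\<lambda>z v. D (a + z) v - D a v"])
    fix z :: "real ^ 'n" assume "z \<in> cball 0 (max (norm x) (norm y))"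
    then have z: "norm z < \<rho>" "norm z \<le> norm x + norm y"
      using xy by auto (smt (verit) norm_ge_zero)
    have "((\<lambda>z. \<phi> (a + z)) has_derivative (\<lambda>v. D (a + z) v)) (at z)"
      using has_derivative_compose[of "\<lambda>z. a + z" "\<lambda>v. v" z UNIV \<phi> "D (a + z)"] D[OF inU[OF z(1)]]
      by (simp add: has_derivative_add_const has_derivative_ident add.commute[of a])
    moreover have "(D a has_derivative D a) (at z)"
      by (rule bounded_linear_imp_has_derivative[OF has_derivative_bounded_linear[OF D[OF U(2)]]])
    ultimately have "((\<lambda>z. \<phi> (a + z) - D a z) has_derivative (\<lambda>v. D (a + z) v - D a v)) (at z)"
      by (rule has_derivative_diff)
    then show "((\<lambda>z. \<phi> (a + z) - D a z) has_derivative (\<lambda>v. D (a + z) v - D a v)) (at z within cball 0 (max (norm x) (norm y)))"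
      by (rule has_derivative_at_withinI)
    show "onorm (\<lambda>v. D (a + z) v - D a v) \<le> K * (norm x + norm y)"
    proof (rule onorm_le)
      fix v :: "real ^ 'n"
      have "K * norm z * norm v \<le> K * (norm x + norm y) * norm v"
        using K z(2) by (intro mult_right_mono mult_left_mono) auto
      then show "norm (D (a + z) v - D a v) \<le> K * (norm x + norm y) * norm v"
        using bound[OF z(1), of v] by linarith
    qed
  qed auto
  then show ?thesis using K \<rho>(1) by blast
qed

lemma C_k_on_Pair_ident:
  fixes x :: "real \<Rightarrow> 'a::euclidean_space"
  assumes "open V" "C_k_on r x V"
  shows "C_k_on r (\<lambda>\<mu>. (x \<mu>, \<mu>)) V"
proof -
  have "C_k_on r (\<lambda>\<mu>. (x \<mu>, 0) + (0, \<mu>)) V"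
    by (intro C_k_on_add assms(1) C_k_on_linear[OF _ assms] C_k_on_linear[OF _ assms(1) C_k_on_ident[OF assms(1)]]
        bounded_linear_Pair bounded_linear_ident bounded_linear_zero)
  then show ?thesis by simp
qed

lemma partial_has_derivative:
  assumes "((\<lambda>(x, \<mu>). f x \<mu>) has_derivative D) (at (x, \<mu>))"
  shows "((\<lambda>x. f x \<mu>) has_derivative (\<lambda>v. D (v, 0))) (at x)"
proof -
  have "((\<lambda>x. (x, \<mu>)) has_derivative (\<lambda>v. (v, 0))) (at x)"
    by (intro has_derivative_Pair has_derivative_ident has_derivative_const)
  from has_derivative_compose[OF this, of "\<lambda>(x, \<mu>). f x \<mu>" D] assms show ?thesis by simp
qed

lemma eigenvalue_in_list:
  fixes A :: "real ^ 'n ^ 'n::finite"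
  assumes "eigenvalue_list A ev" "v \<noteq> 0" "cmat A *v v = s *s v"
  obtains i where "i \<in> {1..CARD('n)}" "s = ev i"
proof -
  have "(mat s - cmat A) *v v = 0" using assms(3) by (simp add: matrix_vector_mult_diff_rdistrib mat_mult_vec)
  have "det (mat s - cmat A) = 0"
  proof (rule ccontr)
    assume "det (mat s - cmat A) \<noteq> 0"
    from cramer[OF this, of v 0] cramer[OF this, of 0 0] \<open>(mat s - cmat A) *v v = 0\<close> assms(2) show False by simp
  qed
  then have "(\<Prod>i = 1..CARD('n). (s - ev i)) = 0" using assms(1) by (simp add: eigenvalue_list_def)
  then show thesis using that by auto
qed

lemma eigenvector_exists:
  fixes A :: "real ^ 'n ^ 'n::finite"
  assumes "eigenvalue_list A ev" "i \<in> {1..CARD('n)}"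
  shows "\<exists>v. v \<noteq> 0 \<and> cmat A *v v = ev i *s v"
proof -
  have "(\<Prod>j = 1..CARD('n). (ev i - ev j)) = 0" using assms(2) by (intro prod_zero) auto
  then have "det (mat (ev i) - cmat A) = 0" using assms(1) by (simp add: eigenvalue_list_def)
  then obtain v where "v \<noteq> 0" "(mat (ev i) - cmat A) *v v = 0" by (rule det_zero_kernel)
  then show ?thesis by (auto simp: matrix_vector_mult_diff_rdistrib mat_mult_vec)
qed

text \<open>The smoothness claim is conditional on an expansion of \<open>f0\<close> with smooth
  coefficients, since class \<open>r + 1\<close> of \<open>f\<close> does not in general provide
  Taylor coefficients of order \<open>2 * m + 2\<close>, let alone their class \<open>r\<close> in
  the parameter. Uniqueness compares only differences of \<open>f0\<close> at nearby points.\<close>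

theorem lemma3p5:
  fixes U :: "(real ^ 'n::finite) set"
    and V Vt :: "real set"
    and f f0 :: "real ^ 'n \<Rightarrow> real \<Rightarrow> real ^ 'n"
    and x0 :: "real \<Rightarrow> real ^ 'n"
    and A P :: "real \<Rightarrow> real ^ 'n ^ 'n"
    and S :: "real \<Rightarrow> real ^ 2 ^ 'n"
    and ev :: "nat \<Rightarrow> real \<Rightarrow> complex"
    and \<alpha> \<omega> \<nu> :: "real \<Rightarrow> real"
    and \<mu>\<^sub>0 \<mu>\<^sub>m M :: real
    and r m :: nat
  assumes N: "CARD('n) \<ge> 3" and r: "r \<ge> 1" and m: "m \<ge> 1"
    and U: "open U" "connected U" and V: "open V" "connected V"
    and f: "C_k_on (r + 1) (\<lambda>(x, \<mu>). f x \<mu>) (U \<times> V)"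
    and x0: "C_k_on r x0 V" "\<And>\<mu>. \<mu> \<in> V \<Longrightarrow> x0 \<mu> \<in> U \<and> f (x0 \<mu>) \<mu> = 0"
    and A: "\<And>\<mu>. \<mu> \<in> V \<Longrightarrow> A \<mu> = jacobian (\<lambda>x. f x \<mu>) (at (x0 \<mu>))"
    and f0: "\<And>\<mu> x. \<mu> \<in> V \<Longrightarrow> f0 x \<mu> = f (x0 \<mu> + x) \<mu> - A \<mu> *v x"
    and ev: "\<And>\<mu>. \<mu> \<in> V \<Longrightarrow> eigenvalue_list (A \<mu>) (\<lambda>i. ev i \<mu>)"
    and P: "\<And>\<mu>. \<mu> \<in> V \<Longrightarrow> is_spectral_projection (A \<mu>) {ev 1 \<mu>, ev 2 \<mu>} (P \<mu>)"
    and S: "C_k_on r S V"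
      "\<And>\<mu>. \<mu> \<in> V \<Longrightarrow>
        bij_betw ((*v) (S \<mu>)) UNIV (spectral_subspace (A \<mu>) {ev 1 \<mu>, ev 2 \<mu>})"
    and A4: "\<mu>\<^sub>0 \<in> V"
      "\<And>\<mu>. \<mu> \<in> V \<Longrightarrow> ev 1 \<mu> = Complex (\<alpha> \<mu>) (\<omega> \<mu>) \<and> ev 2 \<mu> = Complex (\<alpha> \<mu>) (- \<omega> \<mu>) \<and> \<omega> \<mu> \<noteq> 0"
      "\<alpha> \<mu>\<^sub>0 = 0"
      "\<And>\<mu>. \<mu> \<in> V \<Longrightarrow> \<mu> < \<mu>\<^sub>0 \<Longrightarrow> \<alpha> \<mu> < 0"
      "\<And>\<mu>. \<mu> \<in> V \<Longrightarrow> \<mu> > \<mu>\<^sub>0 \<Longrightarrow> \<alpha> \<mu> > 0"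
      "\<And>\<mu> i j. \<mu> \<in> V \<Longrightarrow> \<mu> \<le> \<mu>\<^sub>0 \<or> \<mu> \<in> Vt \<Longrightarrow> 3 \<le> i \<Longrightarrow> i \<le> j \<Longrightarrow> j \<le> CARD('n) \<Longrightarrow>
        Re (ev j \<mu>) \<le> Re (ev i \<mu>)"
      "\<And>\<mu>. \<mu> \<in> V \<Longrightarrow> \<mu> \<le> \<mu>\<^sub>0 \<or> \<mu> \<in> Vt \<Longrightarrow> Re (ev 3 \<mu>) < 0"
    and A5: "\<And>\<mu>. \<mu> \<in> V \<Longrightarrow> \<mu> \<le> \<mu>\<^sub>0 \<Longrightarrow>
        ev 3 \<mu> = complex_of_real (\<nu> \<mu>) \<and> \<nu> \<mu> < 0 \<and> \<nu> \<mu> < \<alpha> \<mu>"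
    and A6: "\<And>\<mu> i j. \<mu> \<in> V \<Longrightarrow> i \<in> {1, 2, 3} \<Longrightarrow> j \<in> {1..CARD('n)} \<Longrightarrow> j \<noteq> i \<Longrightarrow> ev i \<mu> \<noteq> ev j \<mu>"
    and Vt: "Vt = {\<mu>\<^sub>m<..<\<mu>\<^sub>0 + M}" "Vt \<subseteq> V" "M > 0"
      "\<mu>\<^sub>m \<in> V" "\<mu>\<^sub>m < \<mu>\<^sub>0" "\<nu> \<mu>\<^sub>m = 2 * real m * \<alpha> \<mu>\<^sub>m"
      "\<And>\<mu> q. \<mu> \<in> Vt \<Longrightarrow> resonance CARD('n) (\<lambda>i. ev i \<mu>) q \<Longrightarrow> 2 * m + 2 \<le> q"
  defines "SSM \<equiv> \<lambda>\<mu>. spectral_submanifold (A \<mu>) (\<lambda>x. f0 x \<mu>) {x. x0 \<mu> + x \<in> U} (P \<mu>) (S \<mu>) (2 * m + 1)"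
  shows "(\<forall>\<mu>\<in>Vt. \<forall>W R W' R' c c'.
            SSM \<mu> W R \<longrightarrow> SSM \<mu> W' R' \<longrightarrow>
            has_expansion R c 1 (2 * m + 2) \<longrightarrow> has_expansion R' c' 1 (2 * m + 2) \<longrightarrow>
            (\<forall>k. 1 \<le> mdeg k \<and> mdeg k \<le> 2 * m + 2 \<longrightarrow> c k = c' k)) \<and>
         ((\<exists>F. (\<forall>j. 2 \<le> mdeg j \<and> mdeg j \<le> 2 * m + 2 \<longrightarrow> C_k_on r (F j) Vt) \<and>
               (\<forall>\<mu>\<in>Vt. has_expansion (\<lambda>x. f0 x \<mu>) (\<lambda>j. F j \<mu>) 2 (2 * m + 2))) \<longrightarrow>
          (\<exists>Rc. (\<forall>k. 1 \<le> mdeg k \<and> mdeg k \<le> 2 * m + 2 \<longrightarrow> C_k_on r (Rc k) Vt) \<and>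
                (\<forall>\<mu>\<in>Vt. \<forall>W R. SSM \<mu> W R \<longrightarrow> has_expansion R (\<lambda>k. Rc k \<mu>) 1 (2 * m + 2))))"
proof -
  let ?fc = "\<lambda>(x, \<mu>). f x \<mu>" and ?g = "\<lambda>\<mu> x. f0 x \<mu>" and ?X = "\<lambda>\<mu>. {x. x0 \<mu> + x \<in> U}"
  \<comment> \<open>The partial derivative in \<open>x\<close>, read off from the joint derivative
    in the direction \<open>(v, 0)\<close>.\<close>
  let ?D = "\<lambda>\<mu> x v. frechet_derivative ?fc (at (x, \<mu>)) (v, 0)"
  have openVt: "open Vt" using Vt(1) by simp
  have VtV: "\<mu> \<in> V" if "\<mu> \<in> Vt" for \<mu> using that Vt(2) by blast
  have fc: "C_k_on (Suc r) ?fc (U \<times> V)" using f by simp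
  have D: "((\<lambda>x. f x \<mu>) has_derivative ?D \<mu> x) (at x)" if "x \<in> U" "\<mu> \<in> V" for x \<mu>
    by (rule partial_has_derivative[OF C_k_on_SucD[OF fc]]) (use that in simp)
  have A_eq: "A \<mu> *v v = ?D \<mu> (x0 \<mu>) v" if \<mu>: "\<mu> \<in> V" for \<mu> v
  proof -
    have d: "((\<lambda>x. f x \<mu>) has_derivative ?D \<mu> (x0 \<mu>)) (at (x0 \<mu>))" by (rule D) (use x0(2)[OF \<mu>] \<mu> in auto)
    then have "A \<mu> = matrix (?D \<mu> (x0 \<mu>))"
      using A[OF \<mu>] frechet_derivative_at[OF d] by (simp add: jacobian_def)
    then show ?thesis using matrix_works[OF linear_matrix_vector_mul_eq[THEN iffD2, OF has_derivative_linear[OF d]]] by simp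
  qed
  have A_smooth: "C_k_on r A V"
  proof (rule C_k_on_vecI[OF V(1)], rule C_k_on_vecI[OF V(1)])
    fix i j
    \<comment> \<open>A column of \<open>A\<close> is a joint partial derivative of
      \<open>f\<close>, of class \<open>r\<close>, composed with the smooth curve of fixed
      points.\<close>
    have "C_k_on r (\<lambda>\<mu>. ?D \<mu> (x0 \<mu>) (axis j 1)) V"
    proof (rule C_k_on_compose[OF V(1), of "\<lambda>\<mu>. (x0 \<mu>, \<mu>)" "U \<times> V" r "\<lambda>p. frechet_derivative ?fc (at p) (axis j 1, 0)"])
      show "(\<lambda>\<mu>. (x0 \<mu>, \<mu>)) ` V \<subseteq> U \<times> V" using x0(2) by auto
      show "C_k_on r (\<lambda>p. frechet_derivative ?fc (at p) (axis j 1, 0)) (U \<times> V)"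
        by (rule C_k_on_frechet_derivative[OF fc])
      show "C_k_on r (\<lambda>\<mu>. (x0 \<mu>, \<mu>)) V" by (rule C_k_on_Pair_ident[OF V(1) x0(1)])
    qed
    from C_k_on_vec_nth[OF V(1) this, of i]
    show "C_k_on r (\<lambda>\<mu>. A \<mu> $ i $ j) V"
      by (rule C_k_on_cong_imp[OF V(1), rotated]) (simp add: A_eq[symmetric] matrix_vector_mult_basis column_def)
  qed
  have quadratic: "\<exists>C\<ge>0. \<exists>\<rho>>0. \<forall>x y. norm x < \<rho> \<longrightarrow> norm y < \<rho> \<longrightarrow>
      norm (f0 x \<mu> - f0 y \<mu>) \<le> C * (norm x + norm y) * norm (x - y)" if \<mu>: "\<mu> \<in> V" for \<mu>
    unfolding f0[OF \<mu>] A_eq[OF \<mu>]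
  proof (rule quadratic_remainder[OF U(1) _ D[OF _ \<mu>]])
    show "x0 \<mu> \<in> U" using x0(2)[OF \<mu>] by blast
    fix i
    have "C_k_on r (\<lambda>p. frechet_derivative ?fc (at p) (axis i 1, 0)) (U \<times> V)"
      by (rule C_k_on_frechet_derivative[OF fc])
    \<comment> \<open>Here \<open>r \<ge> 1\<close> enters: the first derivative is differentiable,
      as the quadratic estimate requires.\<close>
    then have "C_k_on (Suc 0) (\<lambda>p. frechet_derivative ?fc (at p) (axis i 1, 0)) (U \<times> V)"
      by (rule C_k_on_mono) (use r in simp)
    then have "((\<lambda>(x, \<mu>). ?D \<mu> x (axis i 1)) has_derivative
        frechet_derivative (\<lambda>(x, \<mu>). ?D \<mu> x (axis i 1)) (at (x0 \<mu>, \<mu>))) (at (x0 \<mu>, \<mu>))"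
      using \<mu> x0(2)[OF \<mu>] by (intro C_k_on_SucD[of 0 _ "U \<times> V"]) (auto simp: case_prod_unfold)
    from partial_has_derivative[OF this]
    show "(\<lambda>x. ?D \<mu> x (axis i 1)) differentiable (at (x0 \<mu>))" unfolding differentiable_def by blast
  qed
  have setting: "ssm_setting (A \<mu>) (P \<mu>) (\<alpha> \<mu>) (\<omega> \<mu>) (S \<mu>) (?g \<mu>) (2 * m + 1)" if \<mu>: "\<mu> \<in> V" for \<mu>
  proof
    have ev12: "ev 1 \<mu> = Complex (\<alpha> \<mu>) (\<omega> \<mu>)" "ev 2 \<mu> = Complex (\<alpha> \<mu>) (- \<omega> \<mu>)" "\<omega> \<mu> \<noteq> 0"
      using A4(2)[OF \<mu>] by auto
    show "cnj ` {Complex (\<alpha> \<mu>) (\<omega> \<mu>), Complex (\<alpha> \<mu>) (- \<omega> \<mu>)} \<subseteq> {Complex (\<alpha> \<mu>) (\<omega> \<mu>), Complex (\<alpha> \<mu>) (- \<omega> \<mu>)}"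
      by (auto simp: complex_eq_iff)
    show "is_spectral_projection (A \<mu>) {Complex (\<alpha> \<mu>) (\<omega> \<mu>), Complex (\<alpha> \<mu>) (- \<omega> \<mu>)} (P \<mu>)"
      using P[OF \<mu>] by (simp only: ev12)
    show "\<omega> \<mu> \<noteq> 0" by (rule ev12(3))
    show "bij_betw ((*v) (S \<mu>)) UNIV (spectral_subspace (A \<mu>) {Complex (\<alpha> \<mu>) (\<omega> \<mu>), Complex (\<alpha> \<mu>) (- \<omega> \<mu>)})"
      using S(2)[OF \<mu>] by (simp only: ev12)
    show "\<exists>v. v \<noteq> 0 \<and> cmat (A \<mu>) *v v = Complex (\<alpha> \<mu>) (\<omega> \<mu>) *s v"
      using eigenvector_exists[OF ev[OF \<mu>], of 1] N unfolding ev12 by simp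
    show "f0 0 \<mu> = 0" using x0(2)[OF \<mu>] by (simp add: f0[OF \<mu>])
    show "\<exists>C\<ge>0. \<exists>\<rho>>0. \<forall>x y. norm x < \<rho> \<longrightarrow> norm y < \<rho> \<longrightarrow>
      norm (f0 x \<mu> - f0 y \<mu>) \<le> C * (norm x + norm y) * norm (x - y)" by (rule quadratic[OF \<mu>])
    show "1 \<le> 2 * m + 1" by simp
  qed
  interpret fam: ssm_family r Vt A P S \<alpha> \<omega> ?g ?X "2 * m + 1"
  proof (rule ssm_family.intro)
    show "open Vt" by (rule openVt)
    show "C_k_on r A Vt" "C_k_on r S Vt" using C_k_on_subset[OF _ Vt(2)] A_smooth S(1) by blast+
    fix \<mu> assume \<mu>: "\<mu> \<in> Vt"
    show "ssm_setting (A \<mu>) (P \<mu>) (\<alpha> \<mu>) (\<omega> \<mu>) (S \<mu>) (?g \<mu>) (2 * m + 1)" by (rule setting[OF VtV[OF \<mu>]])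
    fix k a v
    let ?l = "Complex (\<alpha> \<mu>) \<bar>\<omega> \<mu>\<bar>"
    let ?s = "of_nat a * ?l + of_nat (k - a) * cnj ?l"
    assume k: "2 \<le> k" "k \<le> 2 * m + 1" "a \<le> k" and v: "v \<noteq> 0" "cmat (A \<mu>) *v v = ?s *s v"
    have ev12: "ev 1 \<mu> = Complex (\<alpha> \<mu>) (\<omega> \<mu>)" "ev 2 \<mu> = Complex (\<alpha> \<mu>) (- \<omega> \<mu>)"
      using A4(2)[OF VtV[OF \<mu>]] by auto
    obtain i where i: "i \<in> {1..CARD('n)}" "?s = ev i \<mu>" using eigenvalue_in_list[OF ev[OF VtV[OF \<mu>]] v] .
    have "\<not> 3 \<le> i"
    proof
      assume "3 \<le> i"
      \<comment> \<open>For negative \<omega> the eigenvalue \<open>l\<close> is the second one in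
        the list, so the two multiplicities are exchanged. The resulting resonance would have order
        at most \<open>2 * m + 1\<close>.\<close>
      have "\<exists>m1 m2. m1 + m2 = k \<and> ?s = of_nat m1 * ev 1 \<mu> + of_nat m2 * ev 2 \<mu>"
      proof (cases "\<omega> \<mu> > 0")
        case True
        show ?thesis
          by (rule exI[of _ a], rule exI[of _ "k - a"], unfold ev12) (use True k(3) in \<open>simp add: complex_eq_iff\<close>)
      next
        case False
        show ?thesis
          by (rule exI[of _ "k - a"], rule exI[of _ a], unfold ev12) (use False k(3) in \<open>simp add: complex_eq_iff\<close>)
      qed
      then have "resonance CARD('n) (\<lambda>i. ev i \<mu>) k"
        unfolding resonance_def using i \<open>3 \<le> i\<close> k(1) by auto
      then show False using Vt(7)[OF \<mu>] k(2) by fastforce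
    qed
    then have "i = 1 \<or> i = 2" using i(1) by auto
    then show "?s \<in> {Complex (\<alpha> \<mu>) (\<omega> \<mu>), Complex (\<alpha> \<mu>) (- \<omega> \<mu>)}" using i(2) unfolding ev12[symmetric] by blast
  qed
  have zero: "R 0 = 0" if "\<mu> \<in> Vt" "SSM \<mu> W R" for \<mu> W R
    using ssm_setting.ssm_zero(2)[OF setting[OF VtV[OF that(1)]]] that(2) unfolding SSM_def by blast
  show ?thesis
  proof (intro conjI ballI allI impI)
    fix \<mu> W R W' R' c c' and k :: "2 \<Rightarrow> nat"
    assume \<mu>: "\<mu> \<in> Vt" and W: "SSM \<mu> W R" "SSM \<mu> W' R'"
      and c: "has_expansion R c 1 (2 * m + 2)" "has_expansion R' c' 1 (2 * m + 2)"
      and k: "1 \<le> mdeg k \<and> mdeg k \<le> 2 * m + 2"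
    have "small_at0 (Suc (2 * m + 1)) (\<lambda>u. R u - R' u)"
      using fam.SSM_unique(2)[OF \<mu>] W unfolding SSM_def by blast
    then show "c k = c' k"
      using expansion_coefficients_unique[OF c zero[OF \<mu> W(1)] zero[OF \<mu> W(2)]] k by simp
  next
    assume "\<exists>F. (\<forall>j. 2 \<le> mdeg j \<and> mdeg j \<le> 2 * m + 2 \<longrightarrow> C_k_on r (F j) Vt) \<and>
      (\<forall>\<mu>\<in>Vt. has_expansion (\<lambda>x. f0 x \<mu>) (\<lambda>j. F j \<mu>) 2 (2 * m + 2))"
    then obtain F where F: "\<And>j. 2 \<le> mdeg j \<Longrightarrow> mdeg j \<le> 2 * m + 2 \<Longrightarrow> C_k_on r (F j) Vt"
      "\<And>\<mu>. \<mu> \<in> Vt \<Longrightarrow> has_expansion (\<lambda>x. f0 x \<mu>) (\<lambda>j. F j \<mu>) 2 (2 * m + 2)"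
      by blast
    interpret ex: ssm_family_expansion r Vt A P S \<alpha> \<omega> ?g ?X "2 * m + 1" F
      by unfold_locales (use F in auto)
    obtain Rc where "\<forall>k. C_k_on r (Rc k) Vt"
      "\<forall>\<mu>\<in>Vt. \<forall>W R. SSM \<mu> W R \<longrightarrow> has_expansion R (\<lambda>k. Rc k \<mu>) 1 (Suc (2 * m + 1))"
      using ex.reduced_expansion_smooth unfolding SSM_def by auto
    then show "\<exists>Rc. (\<forall>k. 1 \<le> mdeg k \<and> mdeg k \<le> 2 * m + 2 \<longrightarrow> C_k_on r (Rc k) Vt) \<and>
      (\<forall>\<mu>\<in>Vt. \<forall>W R. SSM \<mu> W R \<longrightarrow> has_expansion R (\<lambda>k. Rc k \<mu>) 1 (2 * m + 2))"
      by (intro exI[of _ Rc]) simp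
  qed
qed

end
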